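(* Let $\mathcal{A}$ be an abelian category and $T\colon\mathcal{A}\to\mathsf{Ab}$ a right exact functor. Then every term-wise split short exact sequence of chain complexes in $\mathcal{A}$ $$0\to A\xrightarrow{\alpha}B\xrightarrow{\beta}C\to 0$$ determines an isomorphism of long exact sequences of abelian groups, from $$\cdots\to\mathrm{Nat}(\mathrm{H}^{n+1}\mathrm{Hom}(C,-),T)\xrightarrow{(\delta^{n+1})^{*}}\mathrm{Nat}(\mathrm{H}^{n}\mathrm{Hom}(A,-),T)\xrightarrow{(\alpha^{*})^{*}}\mathrm{Nat}(\mathrm{H}^{n}\mathrm{Hom}(B,-),T)\xrightarrow{(\beta^{*})^{*}}\mathrm{Nat}(\mathrm{H}^{n}\mathrm{Hom}(C,-),T)\to\cdots$$ to $$\cdots\to\mathrm{H}_{n+1}(TC)\xrightarrow{\partial_{n+1}}\mathrm{H}_n(TA)\xrightarrow{T\alpha}\mathrm{H}_n(TB)\xrightarrow{T\beta}\mathrm{H}_n(TC)\to\cdots,$$ given by the Yoneda isomorphisms $\mathsf{Y}_{n+1}(C)$, $\mathsf{Y}_n(A)$, $\mathsf{Y}_n(B)$, $\mathsf{Y}_n(C)$ ($n\in\mathbb{Z}$); that is, both sequences are exact and all squares of the resulting ladder commute. Moreover, this isomorphism is natural with respect to $T$ and with respect to morphisms of such short exact sequences.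
   Context: Chain complexes are $\mathbb{Z}$-graded. $\mathrm{Hom}=\mathrm{Hom}_{\mathcal{A}}$; for a chain complex $U$ in $\mathcal{A}$, $\mathrm{H}^n\mathrm{Hom}(U,-)\colon\mathcal{A}\to\mathsf{Ab}$ sends $M$ to the $n$-th cohomology of the cochain complex $\mathrm{Hom}(U,M)$ whose differentials are precomposition with those of $U$ (no signs). $\mathrm{Nat}$ denotes abelian groups of natural transformations between functors $\mathcal{A}\to\mathsf{Ab}$. The Yoneda isomorphism $\mathsf{Y}_n(U)\colon\mathrm{Nat}(\mathrm{H}^n\mathrm{Hom}(U,-),T)\to\mathrm{H}_n(TU)$ is the following. Let $q\colon U_n\to Q=\mathrm{Coker}(d_{n+1})$ be the quotient map; it is an $n$-cocycle of $\mathrm{Hom}(U,Q)$. Since $T$ is right exact, $TQ\cong\mathrm{Coker}(Td_{n+1})$, and $\mathrm{H}_n(TU)\cong\mathrm{Ker}(\mathrm{Coker}(Td_{n+1})\to TU_{n-1})$. Then $\mathsf{Y}_n(U)(\tau)=\tau_Q([q])$, which lies in this kernel. $\delta^{n+1}\colon\mathrm{H}^n\mathrm{Hom}(A,-)\to\mathrm{H}^{n+1}\mathrm{Hom}(C,-)$ is the usual connecting morphism of the (term-wise split) short exact sequence of cochain complexes $0\to\mathrm{Hom}(C,-)\to\mathrm{Hom}(B,-)\to\mathrm{Hom}(A,-)\to0$, and $\partial_{n+1}$ is the usual connecting morphism of the short exact sequence of chain complexes $0\to TA\to TB\to TC\to0$. *)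

theory Defs
  imports "HOL-Algebra.Exact_Sequence"
begin

section \<open>Abelian categories\<close>

text \<open>
  Objects and arrows are elements of carrier sets. The composite \<open>g \<cdot> f\<close> (first \<open>f\<close>, then \<open>g\<close>) is
  meaningful only if \<open>Dom g = Cod f\<close>, and \<open>Add f g\<close> only if \<open>f\<close> and \<open>g\<close> are parallel.
\<close>

record ('o, 'm) precat =
  Obj :: "'o set"
  Arr :: "'m set"
  Dom :: "'m \<Rightarrow> 'o"
  Cod :: "'m \<Rightarrow> 'o"
  Ident :: "'o \<Rightarrow> 'm"
  Comp :: "'m \<Rightarrow> 'm \<Rightarrow> 'm"  (infixr \<open>\<cdot>\<index>\<close> 75)
  Add :: "'m \<Rightarrow> 'm \<Rightarrow> 'm"
  Zero :: "'o \<Rightarrow> 'o \<Rightarrow> 'm"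

definition hom_set :: "('o, 'm) precat \<Rightarrow> 'o \<Rightarrow> 'o \<Rightarrow> 'm set" where
  "hom_set \<A> X Y = {f \<in> Arr \<A>. Dom \<A> f = X \<and> Cod \<A> f = Y}"

text \<open>As usual in HOL-Algebra, abelian groups are commutative groups in multiplicative notation.\<close>

definition hom_group :: "('o, 'm) precat \<Rightarrow> 'o \<Rightarrow> 'o \<Rightarrow> 'm monoid" where
  "hom_group \<A> X Y = \<lparr>carrier = hom_set \<A> X Y, mult = Add \<A>, one = Zero \<A> X Y\<rparr>"

locale preadditive_category =
  fixes \<A> :: "('o, 'm) precat" (structure)
  assumes Dom_in_Obj: "f \<in> Arr \<A> \<Longrightarrow> Dom \<A> f \<in> Obj \<A>"
    and Cod_in_Obj: "f \<in> Arr \<A> \<Longrightarrow> Cod \<A> f \<in> Obj \<A>"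
    and Ident_in_hom: "X \<in> Obj \<A> \<Longrightarrow> Ident \<A> X \<in> hom_set \<A> X X"
    and Comp_in_hom: "\<lbrakk>f \<in> hom_set \<A> X Y; g \<in> hom_set \<A> Y Z\<rbrakk> \<Longrightarrow> g \<cdot> f \<in> hom_set \<A> X Z"
    and Comp_assoc: "\<lbrakk>f \<in> hom_set \<A> W X; g \<in> hom_set \<A> X Y; h \<in> hom_set \<A> Y Z\<rbrakk>
          \<Longrightarrow> (h \<cdot> g) \<cdot> f = h \<cdot> (g \<cdot> f)"
    and Comp_Ident_right: "f \<in> hom_set \<A> X Y \<Longrightarrow> f \<cdot> Ident \<A> X = f"
    and Comp_Ident_left: "f \<in> hom_set \<A> X Y \<Longrightarrow> Ident \<A> Y \<cdot> f = f"
    and comm_group_hom_group: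
          "\<lbrakk>X \<in> Obj \<A>; Y \<in> Obj \<A>\<rbrakk> \<Longrightarrow> comm_group (hom_group \<A> X Y)"
    and Comp_Add_right: "\<lbrakk>f \<in> hom_set \<A> X Y; f' \<in> hom_set \<A> X Y; g \<in> hom_set \<A> Y Z\<rbrakk>
          \<Longrightarrow> g \<cdot> Add \<A> f f' = Add \<A> (g \<cdot> f) (g \<cdot> f')"
    and Comp_Add_left: "\<lbrakk>f \<in> hom_set \<A> X Y; g \<in> hom_set \<A> Y Z; g' \<in> hom_set \<A> Y Z\<rbrakk>
          \<Longrightarrow> Add \<A> g g' \<cdot> f = Add \<A> (g \<cdot> f) (g' \<cdot> f)"

definition is_mono :: "('o, 'm) precat \<Rightarrow> 'm \<Rightarrow> bool" where
  "is_mono \<A> f \<longleftrightarrow> f \<in> Arr \<A> \<and>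
     (\<forall>W. \<forall>g \<in> hom_set \<A> W (Dom \<A> f). \<forall>h \<in> hom_set \<A> W (Dom \<A> f).
        f \<cdot>\<^bsub>\<A>\<^esub> g = f \<cdot>\<^bsub>\<A>\<^esub> h \<longrightarrow> g = h)"

definition is_epi :: "('o, 'm) precat \<Rightarrow> 'm \<Rightarrow> bool" where
  "is_epi \<A> f \<longleftrightarrow> f \<in> Arr \<A> \<and>
     (\<forall>W. \<forall>g \<in> hom_set \<A> (Cod \<A> f) W. \<forall>h \<in> hom_set \<A> (Cod \<A> f) W.
        g \<cdot>\<^bsub>\<A>\<^esub> f = h \<cdot>\<^bsub>\<A>\<^esub> f \<longrightarrow> g = h)"

definition is_kernel :: "('o, 'm) precat \<Rightarrow> 'm \<Rightarrow> 'm \<Rightarrow> bool" where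
  "is_kernel \<A> f k \<longleftrightarrow> f \<in> Arr \<A> \<and> k \<in> Arr \<A> \<and> Cod \<A> k = Dom \<A> f \<and>
     f \<cdot>\<^bsub>\<A>\<^esub> k = Zero \<A> (Dom \<A> k) (Cod \<A> f) \<and>
     (\<forall>W. \<forall>g \<in> hom_set \<A> W (Dom \<A> f). f \<cdot>\<^bsub>\<A>\<^esub> g = Zero \<A> W (Cod \<A> f) \<longrightarrow>
        (\<exists>!h. h \<in> hom_set \<A> W (Dom \<A> k) \<and> k \<cdot>\<^bsub>\<A>\<^esub> h = g))"

definition is_cokernel :: "('o, 'm) precat \<Rightarrow> 'm \<Rightarrow> 'm \<Rightarrow> bool" where
  "is_cokernel \<A> f q \<longleftrightarrow> f \<in> Arr \<A> \<and> q \<in> Arr \<A> \<and> Dom \<A> q = Cod \<A> f \<and>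
     q \<cdot>\<^bsub>\<A>\<^esub> f = Zero \<A> (Dom \<A> f) (Cod \<A> q) \<and>
     (\<forall>W. \<forall>g \<in> hom_set \<A> (Cod \<A> f) W. g \<cdot>\<^bsub>\<A>\<^esub> f = Zero \<A> (Dom \<A> f) W \<longrightarrow>
        (\<exists>!h. h \<in> hom_set \<A> (Cod \<A> q) W \<and> h \<cdot>\<^bsub>\<A>\<^esub> q = g))"

definition is_zero_object :: "('o, 'm) precat \<Rightarrow> 'o \<Rightarrow> bool" where
  "is_zero_object \<A> Z \<longleftrightarrow> Z \<in> Obj \<A> \<and>
     (\<forall>X \<in> Obj \<A>. (\<exists>!f. f \<in> hom_set \<A> X Z) \<and> (\<exists>!f. f \<in> hom_set \<A> Z X))"

definition is_biproduct ::
    "('o, 'm) precat \<Rightarrow> 'o \<Rightarrow> 'o \<Rightarrow> 'o \<Rightarrow> 'm \<Rightarrow> 'm \<Rightarrow> 'm \<Rightarrow> 'm \<Rightarrow> bool" where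
  "is_biproduct \<A> X Y P i j p r \<longleftrightarrow> P \<in> Obj \<A> \<and>
     i \<in> hom_set \<A> X P \<and> j \<in> hom_set \<A> Y P \<and> p \<in> hom_set \<A> P X \<and> r \<in> hom_set \<A> P Y \<and>
     p \<cdot>\<^bsub>\<A>\<^esub> i = Ident \<A> X \<and> r \<cdot>\<^bsub>\<A>\<^esub> j = Ident \<A> Y \<and>
     p \<cdot>\<^bsub>\<A>\<^esub> j = Zero \<A> Y X \<and> r \<cdot>\<^bsub>\<A>\<^esub> i = Zero \<A> X Y \<and>
     Add \<A> (i \<cdot>\<^bsub>\<A>\<^esub> p) (j \<cdot>\<^bsub>\<A>\<^esub> r) = Ident \<A> P"

locale abelian_category = preadditive_category +
  assumes zero_object: "\<exists>Z. is_zero_object \<A> Z"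
    and biproducts: "\<lbrakk>X \<in> Obj \<A>; Y \<in> Obj \<A>\<rbrakk> \<Longrightarrow> \<exists>P i j p r. is_biproduct \<A> X Y P i j p r"
    and kernels: "f \<in> Arr \<A> \<Longrightarrow> \<exists>k. is_kernel \<A> f k"
    and cokernels: "f \<in> Arr \<A> \<Longrightarrow> \<exists>q. is_cokernel \<A> f q"
    and mono_is_kernel: "is_mono \<A> k \<Longrightarrow> \<exists>f. is_kernel \<A> f k"
    and epi_is_cokernel: "is_epi \<A> q \<Longrightarrow> \<exists>f. is_cokernel \<A> f q"

text \<open>
  Exactness of \<open>f\<close>, \<open>g\<close> at \<open>Cod f = Dom g\<close>: one arrow \<open>k\<close> is both the image of \<open>f\<close> (a kernel of a
  cokernel of \<open>f\<close>) and a kernel of \<open>g\<close>.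
\<close>

definition exact_at :: "('o, 'm) precat \<Rightarrow> 'm \<Rightarrow> 'm \<Rightarrow> bool" where
  "exact_at \<A> f g \<longleftrightarrow> f \<in> Arr \<A> \<and> g \<in> Arr \<A> \<and> Cod \<A> f = Dom \<A> g \<and>
     (\<exists>q k. is_cokernel \<A> f q \<and> is_kernel \<A> q k \<and> is_kernel \<A> g k)"


section \<open>Functors to abelian groups and natural transformations\<close>

record ('o, 'm, 'b) ab_fun =
  FObj :: "'o \<Rightarrow> 'b monoid"
  FMap :: "'m \<Rightarrow> 'b \<Rightarrow> 'b"

definition ab_functor :: "('o, 'm) precat \<Rightarrow> ('o, 'm, 'b) ab_fun \<Rightarrow> bool" where
  "ab_functor \<A> F \<longleftrightarrow>
     (\<forall>X \<in> Obj \<A>. comm_group (FObj F X)) \<and>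
     (\<forall>f \<in> Arr \<A>. FMap F f \<in> hom (FObj F (Dom \<A> f)) (FObj F (Cod \<A> f))) \<and>
     (\<forall>X \<in> Obj \<A>. \<forall>x \<in> carrier (FObj F X). FMap F (Ident \<A> X) x = x) \<and>
     (\<forall>f \<in> Arr \<A>. \<forall>g \<in> Arr \<A>. Cod \<A> f = Dom \<A> g \<longrightarrow>
        (\<forall>x \<in> carrier (FObj F (Dom \<A> f)). FMap F (g \<cdot>\<^bsub>\<A>\<^esub> f) x = FMap F g (FMap F f x)))"

definition additive_functor :: "('o, 'm) precat \<Rightarrow> ('o, 'm, 'b) ab_fun \<Rightarrow> bool" where
  "additive_functor \<A> F \<longleftrightarrow> ab_functor \<A> F \<and>
     (\<forall>X Y. \<forall>f \<in> hom_set \<A> X Y. \<forall>g \<in> hom_set \<A> X Y. \<forall>x \<in> carrier (FObj F X).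
        FMap F (Add \<A> f g) x = FMap F f x \<otimes>\<^bsub>FObj F Y\<^esub> FMap F g x)"

definition right_exact_functor :: "('o, 'm) precat \<Rightarrow> ('o, 'm, 'b) ab_fun \<Rightarrow> bool" where
  "right_exact_functor \<A> F \<longleftrightarrow> additive_functor \<A> F \<and>
     (\<forall>f g. exact_at \<A> f g \<and> is_epi \<A> g \<longrightarrow>
        exact_seq ([FObj F (Cod \<A> g), FObj F (Dom \<A> g), FObj F (Dom \<A> f)], [FMap F g, FMap F f]) \<and>
        FMap F g ` carrier (FObj F (Dom \<A> g)) = carrier (FObj F (Cod \<A> g)))"

text \<open>
  Natural transformations are extensional (\<open>undefined\<close> off the objects of the category, and each
  component \<open>undefined\<close> off its source group), so that equal ones are equal as functions.
\<close>

definition nat_trans ::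
    "('o, 'm) precat \<Rightarrow> ('o, 'm, 'x) ab_fun \<Rightarrow> ('o, 'm, 'y) ab_fun \<Rightarrow> ('o \<Rightarrow> 'x \<Rightarrow> 'y) set" where
  "nat_trans \<A> F G = {\<tau>. \<tau> \<in> extensional (Obj \<A>) \<and>
     (\<forall>M \<in> Obj \<A>. \<tau> M \<in> hom (FObj F M) (FObj G M) \<and> \<tau> M \<in> extensional (carrier (FObj F M))) \<and>
     (\<forall>f \<in> Arr \<A>. \<forall>x \<in> carrier (FObj F (Dom \<A> f)).
        \<tau> (Cod \<A> f) (FMap F f x) = FMap G f (\<tau> (Dom \<A> f) x))}"

definition Nat_group ::
    "('o, 'm) precat \<Rightarrow> ('o, 'm, 'x) ab_fun \<Rightarrow> ('o, 'm, 'y) ab_fun \<Rightarrow> ('o \<Rightarrow> 'x \<Rightarrow> 'y) monoid" where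
  "Nat_group \<A> F G = \<lparr>carrier = nat_trans \<A> F G,
     mult = (\<lambda>\<sigma> \<tau>. \<lambda>M \<in> Obj \<A>. \<lambda>x \<in> carrier (FObj F M). \<sigma> M x \<otimes>\<^bsub>FObj G M\<^esub> \<tau> M x),
     one = (\<lambda>M \<in> Obj \<A>. \<lambda>x \<in> carrier (FObj F M). \<one>\<^bsub>FObj G M\<^esub>)\<rparr>"

text \<open>The composite of \<open>\<rho>\<close>, with source functor \<open>F\<close>, followed by \<open>\<sigma>\<close>.\<close>

definition nat_comp ::
    "('o, 'm) precat \<Rightarrow> ('o, 'm, 'x) ab_fun \<Rightarrow> ('o \<Rightarrow> 'y \<Rightarrow> 'z) \<Rightarrow> ('o \<Rightarrow> 'x \<Rightarrow> 'y) \<Rightarrow> 'o \<Rightarrow> 'x \<Rightarrow> 'z" where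
  "nat_comp \<A> F \<sigma> \<rho> = (\<lambda>M \<in> Obj \<A>. \<lambda>x \<in> carrier (FObj F M). \<sigma> M (\<rho> M x))"


section \<open>Complexes and their (co)homology\<close>

text \<open>
  Used for chain complexes in \<open>\<A>\<close> (\<open>cdiff U n : U n \<rightarrow> U (n - 1)\<close>), and, with objects of type
  \<open>'b monoid\<close> and maps of type \<open>'b \<Rightarrow> 'b\<close>, for chain complexes of abelian groups and for cochain
  complexes of abelian groups (\<open>cdiff U n : U n \<rightarrow> U (n + 1)\<close>).
\<close>

record ('o, 'm) cplx =
  cobj :: "int \<Rightarrow> 'o"
  cdiff :: "int \<Rightarrow> 'm"

definition chain_complex :: "('o, 'm) precat \<Rightarrow> ('o, 'm) cplx \<Rightarrow> bool" where
  "chain_complex \<A> U \<longleftrightarrow>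
     (\<forall>n. cobj U n \<in> Obj \<A>) \<and>
     (\<forall>n. cdiff U n \<in> hom_set \<A> (cobj U n) (cobj U (n - 1))) \<and>
     (\<forall>n. cdiff U (n - 1) \<cdot>\<^bsub>\<A>\<^esub> cdiff U n = Zero \<A> (cobj U n) (cobj U (n - 2)))"

definition chain_map ::
    "('o, 'm) precat \<Rightarrow> ('o, 'm) cplx \<Rightarrow> ('o, 'm) cplx \<Rightarrow> (int \<Rightarrow> 'm) \<Rightarrow> bool" where
  "chain_map \<A> U V u \<longleftrightarrow>
     (\<forall>n. u n \<in> hom_set \<A> (cobj U n) (cobj V n)) \<and>
     (\<forall>n. cdiff V n \<cdot>\<^bsub>\<A>\<^esub> u n = u (n - 1) \<cdot>\<^bsub>\<A>\<^esub> cdiff U n)"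

definition short_exact :: "('o, 'm) precat \<Rightarrow> 'm \<Rightarrow> 'm \<Rightarrow> bool" where
  "short_exact \<A> f g \<longleftrightarrow> is_mono \<A> f \<and> exact_at \<A> f g \<and> is_epi \<A> g"

definition termwise_split_ses ::
    "('o, 'm) precat \<Rightarrow> ('o, 'm) cplx \<Rightarrow> (int \<Rightarrow> 'm) \<Rightarrow> ('o, 'm) cplx \<Rightarrow> (int \<Rightarrow> 'm) \<Rightarrow>
     ('o, 'm) cplx \<Rightarrow> bool" where
  "termwise_split_ses \<A> A \<alpha> B \<beta> C \<longleftrightarrow>
     chain_complex \<A> A \<and> chain_complex \<A> B \<and> chain_complex \<A> C \<and>
     chain_map \<A> A B \<alpha> \<and> chain_map \<A> B C \<beta> \<and>
     (\<forall>n. short_exact \<A> (\<alpha> n) (\<beta> n)) \<and>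
     (\<forall>n. \<exists>s \<in> hom_set \<A> (cobj C n) (cobj B n). \<beta> n \<cdot>\<^bsub>\<A>\<^esub> s = Ident \<A> (cobj C n))"

definition ses_morphism ::
    "('o, 'm) precat \<Rightarrow>
     ('o, 'm) cplx \<Rightarrow> (int \<Rightarrow> 'm) \<Rightarrow> ('o, 'm) cplx \<Rightarrow> (int \<Rightarrow> 'm) \<Rightarrow> ('o, 'm) cplx \<Rightarrow>
     ('o, 'm) cplx \<Rightarrow> (int \<Rightarrow> 'm) \<Rightarrow> ('o, 'm) cplx \<Rightarrow> (int \<Rightarrow> 'm) \<Rightarrow> ('o, 'm) cplx \<Rightarrow>
     (int \<Rightarrow> 'm) \<Rightarrow> (int \<Rightarrow> 'm) \<Rightarrow> (int \<Rightarrow> 'm) \<Rightarrow> bool" where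
  "ses_morphism \<A> A \<alpha> B \<beta> C A' \<alpha>' B' \<beta>' C' a b c \<longleftrightarrow>
     chain_map \<A> A A' a \<and> chain_map \<A> B B' b \<and> chain_map \<A> C C' c \<and>
     (\<forall>n. b n \<cdot>\<^bsub>\<A>\<^esub> \<alpha> n = \<alpha>' n \<cdot>\<^bsub>\<A>\<^esub> a n) \<and>
     (\<forall>n. c n \<cdot>\<^bsub>\<A>\<^esub> \<beta> n = \<beta>' n \<cdot>\<^bsub>\<A>\<^esub> b n)"

text \<open>
  The map of quotient groups \<open>G Mod K \<rightarrow> H Mod N\<close>, \<open>[x] \<mapsto> [f x]\<close>, induced by \<open>f\<close>. Elements of a
  quotient are cosets, i.e. sets.
\<close>

definition quot_map :: "'y monoid \<Rightarrow> 'y set \<Rightarrow> ('x \<Rightarrow> 'y) \<Rightarrow> 'x set \<Rightarrow> 'y set" where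
  "quot_map H N f S = the_elem ((\<lambda>x. N #>\<^bsub>H\<^esub> f x) ` S)"

definition boundaries :: "('b monoid, 'b \<Rightarrow> 'b) cplx \<Rightarrow> int \<Rightarrow> 'b set" where
  "boundaries X n = cdiff X (n + 1) ` carrier (cobj X (n + 1))"

definition homology :: "('b monoid, 'b \<Rightarrow> 'b) cplx \<Rightarrow> int \<Rightarrow> 'b set monoid" where
  "homology X n =
     (cobj X n)\<lparr>carrier := kernel (cobj X n) (cobj X (n - 1)) (cdiff X n)\<rparr> Mod boundaries X n"

definition homology_map ::
    "('c monoid, 'c \<Rightarrow> 'c) cplx \<Rightarrow> (int \<Rightarrow> 'b \<Rightarrow> 'c) \<Rightarrow> int \<Rightarrow> 'b set \<Rightarrow> 'c set" where
  "homology_map Y u n = quot_map (cobj Y n) (boundaries Y n) (u n)"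

definition coboundaries :: "('b monoid, 'b \<Rightarrow> 'b) cplx \<Rightarrow> int \<Rightarrow> 'b set" where
  "coboundaries X n = cdiff X (n - 1) ` carrier (cobj X (n - 1))"

definition cohomology :: "('b monoid, 'b \<Rightarrow> 'b) cplx \<Rightarrow> int \<Rightarrow> 'b set monoid" where
  "cohomology X n =
     (cobj X n)\<lparr>carrier := kernel (cobj X n) (cobj X (n + 1)) (cdiff X n)\<rparr> Mod coboundaries X n"

definition cohomology_map ::
    "('c monoid, 'c \<Rightarrow> 'c) cplx \<Rightarrow> (int \<Rightarrow> 'b \<Rightarrow> 'c) \<Rightarrow> int \<Rightarrow> 'b set \<Rightarrow> 'c set" where
  "cohomology_map Y u n = quot_map (cobj Y n) (coboundaries Y n) (u n)"

text \<open>
  The snake construction. For a short exact sequence of complexes with maps \<open>i\<close> and \<open>p\<close>, a class \<open>S\<close>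
  of the right-hand complex is sent to the class \<open>[x]\<close>, where \<open>y\<close> is any element of the middle group
  \<open>Y\<close> such that \<open>p y\<close> represents \<open>S\<close>, and \<open>i x = d y\<close> with \<open>d\<close> the differential of the middle
  complex; \<open>x\<close> lies in the group \<open>X\<close> of the left-hand complex, whose (co)boundaries are \<open>N\<close>.
\<close>

definition connecting ::
    "'x monoid \<Rightarrow> 'x set \<Rightarrow> ('x \<Rightarrow> 'y) \<Rightarrow> 'y monoid \<Rightarrow> ('y \<Rightarrow> 'y) \<Rightarrow> ('y \<Rightarrow> 'z) \<Rightarrow> 'z set \<Rightarrow> 'x set" where
  "connecting X N i Y d p S =
     the_elem {N #>\<^bsub>X\<^esub> x |x y. x \<in> carrier X \<and> y \<in> carrier Y \<and> p y \<in> S \<and> i x = d y}"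

definition homology_connecting ::
    "('b monoid, 'b \<Rightarrow> 'b) cplx \<Rightarrow> (int \<Rightarrow> 'b \<Rightarrow> 'b) \<Rightarrow> ('b monoid, 'b \<Rightarrow> 'b) cplx \<Rightarrow>
     (int \<Rightarrow> 'b \<Rightarrow> 'b) \<Rightarrow> int \<Rightarrow> 'b set \<Rightarrow> 'b set" where
  "homology_connecting X i Y p n =
     connecting (cobj X (n - 1)) (boundaries X (n - 1)) (i (n - 1)) (cobj Y n) (cdiff Y n) (p n)"

definition cohomology_connecting ::
    "('b monoid, 'b \<Rightarrow> 'b) cplx \<Rightarrow> (int \<Rightarrow> 'b \<Rightarrow> 'b) \<Rightarrow> ('b monoid, 'b \<Rightarrow> 'b) cplx \<Rightarrow>
     (int \<Rightarrow> 'b \<Rightarrow> 'b) \<Rightarrow> int \<Rightarrow> 'b set \<Rightarrow> 'b set" where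
  "cohomology_connecting X i Y p n =
     connecting (cobj X n) (coboundaries X n) (i n) (cobj Y (n - 1)) (cdiff Y (n - 1)) (p (n - 1))"


section \<open>The complexes \<open>TU\<close> and \<open>Hom(U, M)\<close>\<close>

definition app_cplx ::
    "('o, 'm, 'b) ab_fun \<Rightarrow> ('o, 'm) cplx \<Rightarrow> ('b monoid, 'b \<Rightarrow> 'b) cplx" where
  "app_cplx T U = \<lparr>cobj = (\<lambda>n. FObj T (cobj U n)), cdiff = (\<lambda>n. FMap T (cdiff U n))\<rparr>"

definition Hom_cplx ::
    "('o, 'm) precat \<Rightarrow> ('o, 'm) cplx \<Rightarrow> 'o \<Rightarrow> ('m monoid, 'm \<Rightarrow> 'm) cplx" where
  "Hom_cplx \<A> U M = \<lparr>cobj = (\<lambda>n. hom_group \<A> (cobj U n) M),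
     cdiff = (\<lambda>n f. f \<cdot>\<^bsub>\<A>\<^esub> cdiff U (n + 1))\<rparr>"

definition HHom :: "('o, 'm) precat \<Rightarrow> ('o, 'm) cplx \<Rightarrow> int \<Rightarrow> ('o, 'm, 'm set) ab_fun" where
  "HHom \<A> U n = \<lparr>FObj = (\<lambda>M. cohomology (Hom_cplx \<A> U M) n),
     FMap = (\<lambda>g. cohomology_map (Hom_cplx \<A> U (Cod \<A> g)) (\<lambda>_ f. g \<cdot>\<^bsub>\<A>\<^esub> f) n)\<rparr>"

text \<open>
  For a chain map \<open>u : U \<rightarrow> V\<close>, the transformation
  \<open>u\<^sup>* : HHom \<A> V n \<rightarrow> HHom \<A> U n\<close>.
\<close>

definition HHom_map ::
    "('o, 'm) precat \<Rightarrow> ('o, 'm) cplx \<Rightarrow> (int \<Rightarrow> 'm) \<Rightarrow> int \<Rightarrow> 'o \<Rightarrow> 'm set \<Rightarrow> 'm set" where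
  "HHom_map \<A> U u n M = cohomology_map (Hom_cplx \<A> U M) (\<lambda>k f. f \<cdot>\<^bsub>\<A>\<^esub> u k) n"

text \<open>
  \<open>delta \<dots> n : HHom \<A> A (n - 1) \<rightarrow> HHom \<A> C n\<close>, from the sequence
  \<open>0 \<rightarrow> Hom(C,M) \<rightarrow> Hom(B,M) \<rightarrow> Hom(A,M) \<rightarrow> 0\<close>; the complex \<open>A\<close> enters only through the given class.
\<close>

definition delta ::
    "('o, 'm) precat \<Rightarrow> (int \<Rightarrow> 'm) \<Rightarrow> ('o, 'm) cplx \<Rightarrow> (int \<Rightarrow> 'm) \<Rightarrow> ('o, 'm) cplx \<Rightarrow>
     int \<Rightarrow> 'o \<Rightarrow> 'm set \<Rightarrow> 'm set" where
  "delta \<A> \<alpha> B \<beta> C n M =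
     cohomology_connecting (Hom_cplx \<A> C M) (\<lambda>k f. f \<cdot>\<^bsub>\<A>\<^esub> \<beta> k)
       (Hom_cplx \<A> B M) (\<lambda>k f. f \<cdot>\<^bsub>\<A>\<^esub> \<alpha> k) n"


section \<open>The Yoneda isomorphism\<close>

text \<open>\<open>\<kappa>\<close> chooses a cokernel \<open>\<kappa> f : Cod f \<rightarrow> Coker f\<close> of every arrow \<open>f\<close>.\<close>

definition cokernel_choice :: "('o, 'm) precat \<Rightarrow> ('m \<Rightarrow> 'm) \<Rightarrow> bool" where
  "cokernel_choice \<A> \<kappa> \<longleftrightarrow> (\<forall>f \<in> Arr \<A>. is_cokernel \<A> f (\<kappa> f))"

text \<open>
  With \<open>q : U\<^sub>n \<rightarrow> Q\<close> the chosen cokernel of \<open>d\<^sub>n\<^sub>+\<^sub>1\<close>, the canonical map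
  \<open>Coker(T d\<^sub>n\<^sub>+\<^sub>1) \<rightarrow> TQ\<close>, \<open>[x] \<mapsto> T q x\<close>; it is bijective if \<open>T\<close> is right exact.
\<close>

definition Coker_comparison ::
    "('m \<Rightarrow> 'm) \<Rightarrow> ('o, 'm, 'b) ab_fun \<Rightarrow> ('o, 'm) cplx \<Rightarrow> int \<Rightarrow> 'b set \<Rightarrow> 'b" where
  "Coker_comparison \<kappa> T U n S = the_elem (FMap T (\<kappa> (cdiff U (n + 1))) ` S)"

text \<open>
  \<open>\<tau>\<^sub>Q([q])\<close>, transported to the group \<open>Coker(T d\<^sub>n\<^sub>+\<^sub>1) = TU\<^sub>n Mod boundaries\<close>. No further
  identification is needed: the homology class of a cycle and its class in \<open>Coker(T d\<^sub>n\<^sub>+\<^sub>1)\<close> are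
  the same coset of the boundaries, so \<open>homology (TU) n\<close> is literally the kernel of
  \<open>Coker(T d\<^sub>n\<^sub>+\<^sub>1) \<rightarrow> TU\<^sub>n\<^sub>-\<^sub>1\<close>.
\<close>

definition Yoneda ::
    "('o, 'm) precat \<Rightarrow> ('m \<Rightarrow> 'm) \<Rightarrow> ('o, 'm, 'b) ab_fun \<Rightarrow> ('o, 'm) cplx \<Rightarrow> int \<Rightarrow>
     ('o \<Rightarrow> 'm set \<Rightarrow> 'b) \<Rightarrow> 'b set" where
  "Yoneda \<A> \<kappa> T U n \<tau> =
     (let q = \<kappa> (cdiff U (n + 1));
          Q = Cod \<A> q;
          q_class = coboundaries (Hom_cplx \<A> U Q) n #>\<^bsub>hom_group \<A> (cobj U n) Q\<^esub> q
      in inv_into (carrier (FObj T (cobj U n) Mod boundaries (app_cplx T U) n))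
           (Coker_comparison \<kappa> T U n) (\<tau> Q q_class))"


section \<open>Long exact sequences and ladders\<close>

text \<open>
  The sequence
  \<open>\<dots> \<rightarrow> grpC (n + 1) \<rightarrow> grpA n \<rightarrow> grpB n \<rightarrow> grpC n \<rightarrow> grpA (n - 1) \<rightarrow> \<dots>\<close>
  with maps \<open>mapAB n : grpA n \<rightarrow> grpB n\<close>, \<open>mapBC n : grpB n \<rightarrow> grpC n\<close> and
  \<open>conn n : grpC n \<rightarrow> grpA (n - 1)\<close>.
\<close>

record 'x long_seq =
  grpA :: "int \<Rightarrow> 'x monoid"
  grpB :: "int \<Rightarrow> 'x monoid"
  grpC :: "int \<Rightarrow> 'x monoid"
  mapAB :: "int \<Rightarrow> 'x \<Rightarrow> 'x"
  mapBC :: "int \<Rightarrow> 'x \<Rightarrow> 'x"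
  conn :: "int \<Rightarrow> 'x \<Rightarrow> 'x"

text \<open>The lists in \<^const>\<open>exact_seq\<close> run from right to left.\<close>

definition long_exact :: "'x long_seq \<Rightarrow> bool" where
  "long_exact S \<longleftrightarrow> (\<forall>n.
     comm_group (grpA S n) \<and> comm_group (grpB S n) \<and> comm_group (grpC S n) \<and>
     exact_seq ([grpA S (n - 1), grpC S n, grpB S n, grpA S n, grpC S (n + 1)],
                [conn S n, mapBC S n, mapAB S n, conn S (n + 1)]))"

record ('x, 'y) ladder =
  onA :: "int \<Rightarrow> 'x \<Rightarrow> 'y"
  onB :: "int \<Rightarrow> 'x \<Rightarrow> 'y"
  onC :: "int \<Rightarrow> 'x \<Rightarrow> 'y"

definition ladder_morphism :: "'x long_seq \<Rightarrow> 'y long_seq \<Rightarrow> ('x, 'y) ladder \<Rightarrow> bool" where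
  "ladder_morphism S S' \<phi> \<longleftrightarrow> (\<forall>n.
     onA \<phi> n \<in> hom (grpA S n) (grpA S' n) \<and>
     onB \<phi> n \<in> hom (grpB S n) (grpB S' n) \<and>
     onC \<phi> n \<in> hom (grpC S n) (grpC S' n) \<and>
     (\<forall>x \<in> carrier (grpA S n). onB \<phi> n (mapAB S n x) = mapAB S' n (onA \<phi> n x)) \<and>
     (\<forall>x \<in> carrier (grpB S n). onC \<phi> n (mapBC S n x) = mapBC S' n (onB \<phi> n x)) \<and>
     (\<forall>x \<in> carrier (grpC S n). onA \<phi> (n - 1) (conn S n x) = conn S' n (onC \<phi> n x)))"

definition ladder_iso :: "'x long_seq \<Rightarrow> 'y long_seq \<Rightarrow> ('x, 'y) ladder \<Rightarrow> bool" where
  "ladder_iso S S' \<phi> \<longleftrightarrow> ladder_morphism S S' \<phi> \<and> (\<forall>n.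
     onA \<phi> n \<in> iso (grpA S n) (grpA S' n) \<and>
     onB \<phi> n \<in> iso (grpB S n) (grpB S' n) \<and>
     onC \<phi> n \<in> iso (grpC S n) (grpC S' n))"

text \<open>\<open>\<psi> \<circ> \<phi> = \<psi>' \<circ> \<phi>'\<close> as maps out of \<open>S\<close>.\<close>

definition ladder_square ::
    "'w long_seq \<Rightarrow> ('w, 'x) ladder \<Rightarrow> ('x, 'z) ladder \<Rightarrow> ('w, 'y) ladder \<Rightarrow> ('y, 'z) ladder \<Rightarrow> bool"
  where
  "ladder_square S \<phi> \<psi> \<phi>' \<psi>' \<longleftrightarrow> (\<forall>n.
     (\<forall>x \<in> carrier (grpA S n). onA \<psi> n (onA \<phi> n x) = onA \<psi>' n (onA \<phi>' n x)) \<and>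
     (\<forall>x \<in> carrier (grpB S n). onB \<psi> n (onB \<phi> n x) = onB \<psi>' n (onB \<phi>' n x)) \<and>
     (\<forall>x \<in> carrier (grpC S n). onC \<psi> n (onC \<phi> n x) = onC \<psi>' n (onC \<phi>' n x)))"

definition Nat_seq ::
    "('o, 'm) precat \<Rightarrow> ('o, 'm, 'b) ab_fun \<Rightarrow> ('o, 'm) cplx \<Rightarrow> (int \<Rightarrow> 'm) \<Rightarrow> ('o, 'm) cplx \<Rightarrow>
     (int \<Rightarrow> 'm) \<Rightarrow> ('o, 'm) cplx \<Rightarrow> ('o \<Rightarrow> 'm set \<Rightarrow> 'b) long_seq" where
  "Nat_seq \<A> T A \<alpha> B \<beta> C = \<lparr>
     grpA = (\<lambda>n. Nat_group \<A> (HHom \<A> A n) T),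
     grpB = (\<lambda>n. Nat_group \<A> (HHom \<A> B n) T),
     grpC = (\<lambda>n. Nat_group \<A> (HHom \<A> C n) T),
     mapAB = (\<lambda>n \<sigma>. nat_comp \<A> (HHom \<A> B n) \<sigma> (HHom_map \<A> A \<alpha> n)),
     mapBC = (\<lambda>n \<sigma>. nat_comp \<A> (HHom \<A> C n) \<sigma> (HHom_map \<A> B \<beta> n)),
     conn = (\<lambda>n \<sigma>. nat_comp \<A> (HHom \<A> A (n - 1)) \<sigma> (delta \<A> \<alpha> B \<beta> C n))\<rparr>"

definition H_seq ::
    "('o, 'm, 'b) ab_fun \<Rightarrow> ('o, 'm) cplx \<Rightarrow> (int \<Rightarrow> 'm) \<Rightarrow> ('o, 'm) cplx \<Rightarrow> (int \<Rightarrow> 'm) \<Rightarrow>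
     ('o, 'm) cplx \<Rightarrow> 'b set long_seq" where
  "H_seq T A \<alpha> B \<beta> C = \<lparr>
     grpA = homology (app_cplx T A),
     grpB = homology (app_cplx T B),
     grpC = homology (app_cplx T C),
     mapAB = homology_map (app_cplx T B) (\<lambda>n. FMap T (\<alpha> n)),
     mapBC = homology_map (app_cplx T C) (\<lambda>n. FMap T (\<beta> n)),
     conn = homology_connecting (app_cplx T A) (\<lambda>n. FMap T (\<alpha> n))
              (app_cplx T B) (\<lambda>n. FMap T (\<beta> n))\<rparr>"

definition Yoneda_ladder ::
    "('o, 'm) precat \<Rightarrow> ('m \<Rightarrow> 'm) \<Rightarrow> ('o, 'm, 'b) ab_fun \<Rightarrow>
     ('o, 'm) cplx \<Rightarrow> ('o, 'm) cplx \<Rightarrow> ('o, 'm) cplx \<Rightarrow> ('o \<Rightarrow> 'm set \<Rightarrow> 'b, 'b set) ladder" where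
  "Yoneda_ladder \<A> \<kappa> T A B C =
     \<lparr>onA = Yoneda \<A> \<kappa> T A, onB = Yoneda \<A> \<kappa> T B, onC = Yoneda \<A> \<kappa> T C\<rparr>"

text \<open>The ladders induced by \<open>\<theta> : T \<rightarrow> T'\<close>.\<close>

definition Nat_ladder_T ::
    "('o, 'm) precat \<Rightarrow> ('o \<Rightarrow> 'b \<Rightarrow> 'c) \<Rightarrow> ('o, 'm) cplx \<Rightarrow> ('o, 'm) cplx \<Rightarrow> ('o, 'm) cplx \<Rightarrow>
     ('o \<Rightarrow> 'm set \<Rightarrow> 'b, 'o \<Rightarrow> 'm set \<Rightarrow> 'c) ladder" where
  "Nat_ladder_T \<A> \<theta> A B C = \<lparr>
     onA = (\<lambda>n \<tau>. nat_comp \<A> (HHom \<A> A n) \<theta> \<tau>),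
     onB = (\<lambda>n \<tau>. nat_comp \<A> (HHom \<A> B n) \<theta> \<tau>),
     onC = (\<lambda>n \<tau>. nat_comp \<A> (HHom \<A> C n) \<theta> \<tau>)\<rparr>"

definition H_ladder_T ::
    "('o, 'm, 'c) ab_fun \<Rightarrow> ('o \<Rightarrow> 'b \<Rightarrow> 'c) \<Rightarrow> ('o, 'm) cplx \<Rightarrow> ('o, 'm) cplx \<Rightarrow> ('o, 'm) cplx \<Rightarrow>
     ('b set, 'c set) ladder" where
  "H_ladder_T T' \<theta> A B C = \<lparr>
     onA = homology_map (app_cplx T' A) (\<lambda>n. \<theta> (cobj A n)),
     onB = homology_map (app_cplx T' B) (\<lambda>n. \<theta> (cobj B n)),
     onC = homology_map (app_cplx T' C) (\<lambda>n. \<theta> (cobj C n))\<rparr>"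

text \<open>
  The ladders induced by a morphism of short exact sequences
  \<open>a : A \<rightarrow> A'\<close>, \<open>b : B \<rightarrow> B'\<close>, \<open>c : C \<rightarrow> C'\<close>.
\<close>

definition Nat_ladder_ses ::
    "('o, 'm) precat \<Rightarrow> ('o, 'm) cplx \<Rightarrow> ('o, 'm) cplx \<Rightarrow> ('o, 'm) cplx \<Rightarrow>
     ('o, 'm) cplx \<Rightarrow> ('o, 'm) cplx \<Rightarrow> ('o, 'm) cplx \<Rightarrow>
     (int \<Rightarrow> 'm) \<Rightarrow> (int \<Rightarrow> 'm) \<Rightarrow> (int \<Rightarrow> 'm) \<Rightarrow>
     ('o \<Rightarrow> 'm set \<Rightarrow> 'b, 'o \<Rightarrow> 'm set \<Rightarrow> 'b) ladder" where
  "Nat_ladder_ses \<A> A B C A' B' C' a b c = \<lparr>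
     onA = (\<lambda>n \<tau>. nat_comp \<A> (HHom \<A> A' n) \<tau> (HHom_map \<A> A a n)),
     onB = (\<lambda>n \<tau>. nat_comp \<A> (HHom \<A> B' n) \<tau> (HHom_map \<A> B b n)),
     onC = (\<lambda>n \<tau>. nat_comp \<A> (HHom \<A> C' n) \<tau> (HHom_map \<A> C c n))\<rparr>"

definition H_ladder_ses ::
    "('o, 'm, 'b) ab_fun \<Rightarrow> ('o, 'm) cplx \<Rightarrow> ('o, 'm) cplx \<Rightarrow> ('o, 'm) cplx \<Rightarrow>
     (int \<Rightarrow> 'm) \<Rightarrow> (int \<Rightarrow> 'm) \<Rightarrow> (int \<Rightarrow> 'm) \<Rightarrow> ('b set, 'b set) ladder" where
  "H_ladder_ses T A' B' C' a b c = \<lparr>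
     onA = homology_map (app_cplx T A') (\<lambda>n. FMap T (a n)),
     onB = homology_map (app_cplx T B') (\<lambda>n. FMap T (b n)),
     onC = homology_map (app_cplx T C') (\<lambda>n. FMap T (c n))\<rparr>"

end

theory Submission
  imports Defs
begin

text \<open>
  A natural transformation \<open>\<tau>\<close> from \<open>H\<^sup>n Hom(U,-)\<close> to \<open>T\<close> is determined by \<open>\<tau>\<^sub>Q [q]\<close>, since every cocycle
  \<open>f : U\<^sub>n \<rightarrow> M\<close> factors through the cokernel \<open>q : U\<^sub>n \<rightarrow> Q\<close> of \<open>d\<^sub>n\<^sub>+\<^sub>1\<close>. As \<open>T q\<close> is surjective, \<open>\<tau>\<^sub>Q [q] = T q z\<close>
  for some \<open>z \<in> T U\<^sub>n\<close>, so that \<open>\<tau>\<^sub>M [f] = T f z\<close> for all \<open>f\<close>. Taking \<open>f = d\<^sub>n\<close>, a coboundary, shows that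
  \<open>z\<close> is a cycle. Conversely every cycle \<open>z\<close> gives a transformation \<open>[f] \<mapsto> T f z\<close>, which depends only on
  the homology class of \<open>z\<close>, and its image under the Yoneda map is this class.

  In these terms all squares are calculations with representatives. For the connecting maps, let
  \<open>y \<in> T B\<^sub>n\<close> and \<open>x \<in> T A\<^sub>n\<^sub>-\<^sub>1\<close> with \<open>T \<beta> y = z\<close> and \<open>T \<alpha> x = T d y\<close>, and let \<open>f = h \<alpha>\<close> and \<open>g \<beta> = h d\<close>, so
  that \<open>\<delta> [f] = [g]\<close>. Then \<open>T g z = T (g \<beta>) y = T h (T d y) = T h (T \<alpha> x) = T f x\<close>.

  An additive functor preserves term-wise split sequences, so the homology sequence is exact; the
  exactness of the other sequence and its naturality are transported along the Yoneda isomorphism.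
\<close>

section \<open>Homology of complexes of abelian groups\<close>

text \<open>Classes are sets, and the maps between them are given by \<open>the_elem\<close> or
  \<open>inv_into\<close>. Each map therefore gets an evaluation rule on representatives
  (\<open>homology_map_hclass\<close>, \<open>connecting_hclass\<close>,
  \<open>eval_nat_coclass\<close>, \<open>Yoneda_eval_nat\<close>), and later proofs calculate with
  these rules. On the side of transformations little is visible directly: neither that
  \<open>Nat_group\<close> is an abelian group, nor that composing with \<open>delta\<close> or with
  the pullback along a chain map gives a natural transformation again. Both come from cycles: a
  composite is identified with \<open>eval_nat\<close> of another cycle, hence is natural, and the
  group axioms are carried back along the Yoneda bijection. Term-wise splitting enters twice,
  through one biproduct decomposition of B_n: its equations survive under Hom(-,M), which makes
  \<open>delta\<close> well defined, and under T. Right exactness enters through the cokernel q: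
  surjectivity of T q supplies z, and the kernel of T q, the boundaries, fixes the class of
  z.\<close>

lemma hom_inv:
  assumes "h \<in> hom G H" "group G" "group H" "x \<in> carrier G"
  shows "h (inv\<^bsub>G\<^esub> x) = inv\<^bsub>H\<^esub> (h x)"
  using assms group_hom.hom_inv[of G H h x] by (simp add: group_hom_def group_hom_axioms_def)

text \<open>Formed for every x, not only for cycles: the same coset then names a homology class and
  an element of Coker(T d_(n+1)), as \<open>Yoneda_eval_nat\<close> requires.\<close>

definition hclass :: "('b monoid, 'b \<Rightarrow> 'b) cplx \<Rightarrow> int \<Rightarrow> 'b \<Rightarrow> 'b set" where
  "hclass X n x = boundaries X n #>\<^bsub>cobj X n\<^esub> x"

definition cycles :: "('b monoid, 'b \<Rightarrow> 'b) cplx \<Rightarrow> int \<Rightarrow> 'b set" where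
  "cycles X n = kernel (cobj X n) (cobj X (n - 1)) (cdiff X n)"

locale group_complex =
  fixes X :: "('b monoid, 'b \<Rightarrow> 'b) cplx"
  assumes comm_group_cobj: "comm_group (cobj X n)"
    and cdiff_hom: "cdiff X n \<in> hom (cobj X n) (cobj X (n - 1))"
    and cdiff_cdiff: "x \<in> carrier (cobj X n) \<Longrightarrow>
          cdiff X (n - 1) (cdiff X n x) = \<one>\<^bsub>cobj X (n - 2)\<^esub>"
begin

sublocale G: comm_group "cobj X n" for n
  by (rule comm_group_cobj)

text \<open>The premise \<open>m = n - 1\<close> lets the simplifier match every index that is
  arithmetically equal to n - 1, for instance n for the differential out of degree n + 1.\<close>

lemma cdiff_closed [simp]:
  "x \<in> carrier (cobj X n) \<Longrightarrow> m = n - 1 \<Longrightarrow> cdiff X n x \<in> carrier (cobj X m)"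
  using cdiff_hom[of n] by (auto simp: hom_def)

lemma cdiff_mult [simp]:
  "\<lbrakk>x \<in> carrier (cobj X n); y \<in> carrier (cobj X n)\<rbrakk> \<Longrightarrow>
     cdiff X n (x \<otimes>\<^bsub>cobj X n\<^esub> y) = cdiff X n x \<otimes>\<^bsub>cobj X (n - 1)\<^esub> cdiff X n y"
  using cdiff_hom[of n] by (auto simp: hom_def)

lemma cdiff_inv [simp]:
  "x \<in> carrier (cobj X n) \<Longrightarrow>
     cdiff X n (inv\<^bsub>cobj X n\<^esub> x) = inv\<^bsub>cobj X (n - 1)\<^esub> cdiff X n x"
  using hom_inv[OF cdiff_hom] by simp

lemma cdiff_one [simp]: "cdiff X n \<one>\<^bsub>cobj X n\<^esub> = \<one>\<^bsub>cobj X (n - 1)\<^esub>"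
  using hom_one[OF cdiff_hom] by simp

lemma cdiff_cdiff' [simp]:
  "x \<in> carrier (cobj X n) \<Longrightarrow> m = n - 1 \<Longrightarrow> cdiff X m (cdiff X n x) = \<one>\<^bsub>cobj X (n - 2)\<^esub>"
  using cdiff_cdiff by simp

lemma cycles_iff: "x \<in> cycles X n \<longleftrightarrow>
    x \<in> carrier (cobj X n) \<and> cdiff X n x = \<one>\<^bsub>cobj X (n - 1)\<^esub>"
  by (simp add: cycles_def kernel_def)

lemma boundaries_iff: "x \<in> boundaries X n \<longleftrightarrow>
    (\<exists>w \<in> carrier (cobj X (n + 1)). x = cdiff X (n + 1) w)"
  by (auto simp: boundaries_def)

lemma boundaries_subset: "boundaries X n \<subseteq> cycles X n"
  by (auto simp: boundaries_iff cycles_iff)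

lemma subgroup_cycles: "subgroup (cycles X n) (cobj X n)"
proof -
  have "\<one>\<^bsub>cobj X n\<^esub> \<in> cycles X n"
    by (simp add: cycles_iff)
  then have "cycles X n \<noteq> {}"
    by blast
  then show ?thesis
    by (intro G.subgroupI) (auto simp: cycles_iff)
qed

lemma subgroup_boundaries: "subgroup (boundaries X n) (cobj X n)"
proof (rule G.subgroupI)
  show "boundaries X n \<subseteq> carrier (cobj X n)"
    by (auto simp: boundaries_iff)
  show "boundaries X n \<noteq> {}"
    using G.one_closed[of "n + 1"] by (auto simp: boundaries_def)
  fix a assume "a \<in> boundaries X n"
  then obtain w where "w \<in> carrier (cobj X (n + 1))" "a = cdiff X (n + 1) w"
    by (auto simp: boundaries_iff)
  then show "inv\<^bsub>cobj X n\<^esub> a \<in> boundaries X n"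
    unfolding boundaries_iff by (intro bexI[of _ "inv\<^bsub>cobj X (n + 1)\<^esub> w"]) auto
next
  fix a b assume "a \<in> boundaries X n" "b \<in> boundaries X n"
  then obtain w v where "w \<in> carrier (cobj X (n + 1))" "a = cdiff X (n + 1) w"
      "v \<in> carrier (cobj X (n + 1))" "b = cdiff X (n + 1) v"
    by (auto simp: boundaries_iff)
  then show "a \<otimes>\<^bsub>cobj X n\<^esub> b \<in> boundaries X n"
    unfolding boundaries_iff by (intro bexI[of _ "w \<otimes>\<^bsub>cobj X (n + 1)\<^esub> v"]) auto
qed

lemma normal_boundaries: "normal (boundaries X n) (cobj X n)"
  by (simp add: G.normal_iff_subgroup subgroup_boundaries)

text \<open>Turns an equality of cosets into the choice of an explicit w whose boundary is the
  difference; identities of classes below are proved by naming this w.\<close>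

lemma hclass_eq_iff:
  assumes "x \<in> carrier (cobj X n)" "y \<in> carrier (cobj X n)"
  shows "hclass X n x = hclass X n y \<longleftrightarrow>
    (\<exists>w \<in> carrier (cobj X (n + 1)). x = cdiff X (n + 1) w \<otimes>\<^bsub>cobj X n\<^esub> y)"
proof -
  have "hclass X n x = hclass X n y \<longleftrightarrow> x \<in> hclass X n y"
    unfolding hclass_def
    by (metis G.repr_independence G.rcos_self assms subgroup_boundaries)
  then show ?thesis
    by (auto simp: hclass_def r_coset_def boundaries_def)
qed

lemma mem_hclass_iff:
  "x \<in> hclass X n y \<longleftrightarrow> (\<exists>w \<in> carrier (cobj X (n + 1)). x = cdiff X (n + 1) w \<otimes>\<^bsub>cobj X n\<^esub> y)"
  by (auto simp: hclass_def r_coset_def boundaries_def)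

lemma self_mem_hclass: "x \<in> carrier (cobj X n) \<Longrightarrow> x \<in> hclass X n x"
  by (simp add: hclass_def G.rcos_self subgroup_boundaries)

lemma carrier_homology: "carrier (homology X n) = hclass X n ` cycles X n"
  by (auto simp: homology_def carrier_FactGroup hclass_def cycles_def r_coset_def)

lemma hclass_mult:
  assumes "x \<in> carrier (cobj X n)" "y \<in> carrier (cobj X n)"
  shows "hclass X n x \<otimes>\<^bsub>homology X n\<^esub> hclass X n y = hclass X n (x \<otimes>\<^bsub>cobj X n\<^esub> y)"
proof -
  have "hclass X n x <#>\<^bsub>cobj X n\<^esub> hclass X n y = hclass X n (x \<otimes>\<^bsub>cobj X n\<^esub> y)"
    using assms unfolding hclass_def by (rule normal.rcos_sum[OF normal_boundaries])
  \<comment> \<open>The product in \<open>homology X n\<close> is formed in the subgroup of cycles;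
    \<open>set_mult\<close> depends on the multiplication alone, so it agrees with the set product
    in the whole group.\<close>
  then show ?thesis
    by (simp add: homology_def set_mult_def)
qed

lemma one_homology: "\<one>\<^bsub>homology X n\<^esub> = hclass X n \<one>\<^bsub>cobj X n\<^esub>"
  using subgroup.subset[OF subgroup_boundaries]
  by (simp add: homology_def hclass_def G.coset_mult_one)

lemma comm_group_homology: "comm_group (homology X n)"
  unfolding homology_def cycles_def[symmetric]
proof (rule comm_group.abelian_FactGroup)
  show "comm_group (cobj X n\<lparr>carrier := cycles X n\<rparr>)"
    by (rule group.group_comm_groupI[OF G.subgroup_imp_group[OF subgroup_cycles]])
      (simp add: cycles_iff G.m_comm)
  show "subgroup (boundaries X n) (cobj X n\<lparr>carrier := cycles X n\<rparr>)"
    using G.subgroup_incl[OF subgroup_boundaries subgroup_cycles boundaries_subset] .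
qed

lemma hclass_eq_one_iff:
  assumes "x \<in> carrier (cobj X n)"
  shows "hclass X n x = \<one>\<^bsub>homology X n\<^esub> \<longleftrightarrow>
    (\<exists>w \<in> carrier (cobj X (n + 1)). x = cdiff X (n + 1) w)"
  using assms unfolding one_homology by (subst hclass_eq_iff) auto

end

section \<open>Chain maps and the induced maps on homology\<close>

locale group_chain_map = X: group_complex X + Y: group_complex Y
  for X :: "('b monoid, 'b \<Rightarrow> 'b) cplx" and Y :: "('c monoid, 'c \<Rightarrow> 'c) cplx" +
  fixes u :: "int \<Rightarrow> 'b \<Rightarrow> 'c"
  assumes u_hom: "u n \<in> hom (cobj X n) (cobj Y n)"
    and u_cdiff: "x \<in> carrier (cobj X n) \<Longrightarrow> cdiff Y n (u n x) = u (n - 1) (cdiff X n x)"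
begin

lemma map_closed [simp]: "x \<in> carrier (cobj X n) \<Longrightarrow> u n x \<in> carrier (cobj Y n)"
  using u_hom[of n] by (auto simp: hom_def)

lemma map_mult [simp]:
  "\<lbrakk>x \<in> carrier (cobj X n); y \<in> carrier (cobj X n)\<rbrakk> \<Longrightarrow>
     u n (x \<otimes>\<^bsub>cobj X n\<^esub> y) = u n x \<otimes>\<^bsub>cobj Y n\<^esub> u n y"
  using u_hom[of n] by (auto simp: hom_def)

lemma map_inv [simp]:
  "x \<in> carrier (cobj X n) \<Longrightarrow> u n (inv\<^bsub>cobj X n\<^esub> x) = inv\<^bsub>cobj Y n\<^esub> u n x"
  using hom_inv[OF u_hom] by simp

lemma map_one [simp]: "u n \<one>\<^bsub>cobj X n\<^esub> = \<one>\<^bsub>cobj Y n\<^esub>"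
  using hom_one[OF u_hom] by simp

lemma map_cycle: "x \<in> cycles X n \<Longrightarrow> u n x \<in> cycles Y n"
  by (auto simp: X.cycles_iff Y.cycles_iff u_cdiff)

text \<open>\<open>the_elem\<close> is harmless because the image of the coset is a singleton: two
  representatives differ by the boundary of some w, and their images by the boundary of
  \<open>u (n + 1) w\<close>.\<close>

lemma homology_map_hclass:
  assumes "x \<in> carrier (cobj X n)"
  shows "homology_map Y u n (hclass X n x) = hclass Y n (u n x)"
proof -
  have "hclass Y n (u n x') = hclass Y n (u n x)" if x': "x' \<in> hclass X n x" for x'
  proof -
    obtain w where w: "w \<in> carrier (cobj X (n + 1))" "x' = cdiff X (n + 1) w \<otimes>\<^bsub>cobj X n\<^esub> x"
      using x' by (auto simp: X.mem_hclass_iff)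
    show ?thesis
      using w assms u_cdiff[of w "n + 1"]
      by (subst Y.hclass_eq_iff) (auto intro!: bexI[of _ "u (n + 1) w"])
  qed
  then have "(\<lambda>x'. hclass Y n (u n x')) ` hclass X n x = {hclass Y n (u n x)}"
    using X.self_mem_hclass[OF assms] by blast
  then show ?thesis
    by (simp add: homology_map_def quot_map_def hclass_def)
qed

lemma homology_map_hom: "homology_map Y u n \<in> hom (homology X n) (homology Y n)"
proof (rule homI)
  fix S assume "S \<in> carrier (homology X n)"
  then show "homology_map Y u n S \<in> carrier (homology Y n)"
    by (auto simp: X.carrier_homology Y.carrier_homology homology_map_hclass X.cycles_iff
        intro!: imageI map_cycle)
next
  fix S S' assume "S \<in> carrier (homology X n)" "S' \<in> carrier (homology X n)"
  then show "homology_map Y u n (S \<otimes>\<^bsub>homology X n\<^esub> S') =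
      homology_map Y u n S \<otimes>\<^bsub>homology Y n\<^esub> homology_map Y u n S'"
    by (auto simp: X.carrier_homology X.cycles_iff X.hclass_mult Y.hclass_mult homology_map_hclass)
qed

end

section \<open>The long exact homology sequence\<close>

definition homology_seq ::
    "('b monoid, 'b \<Rightarrow> 'b) cplx \<Rightarrow> (int \<Rightarrow> 'b \<Rightarrow> 'b) \<Rightarrow> ('b monoid, 'b \<Rightarrow> 'b) cplx \<Rightarrow>
     (int \<Rightarrow> 'b \<Rightarrow> 'b) \<Rightarrow> ('b monoid, 'b \<Rightarrow> 'b) cplx \<Rightarrow> 'b set long_seq" where
  "homology_seq X i Y p Z = \<lparr>grpA = homology X, grpB = homology Y, grpC = homology Z,
     mapAB = homology_map Y i, mapBC = homology_map Z p, conn = homology_connecting X i Y p\<rparr>"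

text \<open>Instantiated twice: with TA, TB, TC for the homology sequence, and with the reversed Hom
  complexes of C, B, A (in this order) for \<open>delta\<close>.\<close>

locale complex_ses = i: group_chain_map X Y i + p: group_chain_map Y Z p
  for X Y Z :: "('b monoid, 'b \<Rightarrow> 'b) cplx" and i p +
  assumes i_inj: "inj_on (i n) (carrier (cobj X n))"
    and p_surj: "p n ` carrier (cobj Y n) = carrier (cobj Z n)"
    and exact: "kernel (cobj Y n) (cobj Z n) (p n) = i n ` carrier (cobj X n)"
begin

lemma i_eq_iff [simp]:
  "\<lbrakk>x \<in> carrier (cobj X n); x' \<in> carrier (cobj X n)\<rbrakk> \<Longrightarrow> i n x = i n x' \<longleftrightarrow> x = x'"
  using i_inj[of n] by (auto dest: inj_onD)

lemma i_eq_one_iff [simp]: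
  "x \<in> carrier (cobj X n) \<Longrightarrow> i n x = \<one>\<^bsub>cobj Y n\<^esub> \<longleftrightarrow> x = \<one>\<^bsub>cobj X n\<^esub>"
  using i_eq_iff[of x n "\<one>\<^bsub>cobj X n\<^esub>"] by (simp del: i_eq_iff)

lemma p_i [simp]:
  assumes "x \<in> carrier (cobj X n)" shows "p n (i n x) = \<one>\<^bsub>cobj Z n\<^esub>"
proof -
  have "i n x \<in> kernel (cobj Y n) (cobj Z n) (p n)"
    unfolding exact using assms by blast
  then show ?thesis
    by (simp add: kernel_def)
qed

lemma p_eq_one:
  assumes "y \<in> carrier (cobj Y n)" "p n y = \<one>\<^bsub>cobj Z n\<^esub>"
  obtains x where "x \<in> carrier (cobj X n)" "y = i n x"
proof -
  have "y \<in> i n ` carrier (cobj X n)"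
    unfolding exact[symmetric] using assms by (simp add: kernel_def)
  then show thesis
    using that by blast
qed

lemma p_lift:
  assumes "z \<in> carrier (cobj Z n)"
  obtains y where "y \<in> carrier (cobj Y n)" "z = p n y"
  using assms p_surj[of n] by (metis imageE)

section \<open>The snake construction\<close>

text \<open>A pair (y, x) with i x = d y is the datum on which the snake construction rests. The
  first claim is p i = 1, the second d d = 1 together with injectivity of i.\<close>

lemma snake:
  assumes "y \<in> carrier (cobj Y n)" "x \<in> carrier (cobj X (n - 1))" "i (n - 1) x = cdiff Y n y"
  shows "p n y \<in> cycles Z n" "x \<in> cycles X (n - 1)"
proof -
  have "cdiff Z n (p n y) = p (n - 1) (i (n - 1) x)"
    using assms by (simp add: p.u_cdiff)
  also have "\<dots> = \<one>\<^bsub>cobj Z (n - 1)\<^esub>"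
    by (rule p_i[OF assms(2)])
  finally show "p n y \<in> cycles Z n"
    using assms by (simp add: p.Y.cycles_iff)
  have "i (n - 1 - 1) (cdiff X (n - 1) x) = cdiff Y (n - 1) (cdiff Y n y)"
    using assms i.u_cdiff[of x "n - 1"] by simp
  then show "x \<in> cycles X (n - 1)"
    using assms by (simp add: i.X.cycles_iff)
qed

lemma snake_exists:
  assumes "z \<in> cycles Z n"
  obtains y x where "y \<in> carrier (cobj Y n)" "x \<in> carrier (cobj X (n - 1))"
    "i (n - 1) x = cdiff Y n y" "p n y = z"
proof -
  obtain y where y: "y \<in> carrier (cobj Y n)" "z = p n y"
    using assms p_lift by (auto simp: p.Y.cycles_iff)
  have "p (n - 1) (cdiff Y n y) = \<one>\<^bsub>cobj Z (n - 1)\<^esub>"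
    using assms y by (simp add: p.Y.cycles_iff p.u_cdiff)
  then obtain x where "x \<in> carrier (cobj X (n - 1))" "cdiff Y n y = i (n - 1) x"
    using y p_eq_one[of "cdiff Y n y" "n - 1"] by auto
  then show thesis
    using that y by metis
qed

text \<open>Independence of all choices: y' differs from y by a boundary d v, where v lifts w, and
  by an element i u. The differential kills d v, and i u changes x only by the boundary d u.\<close>

lemma snake_unique:
  assumes "y \<in> carrier (cobj Y n)" "x \<in> carrier (cobj X (n - 1))" "i (n - 1) x = cdiff Y n y"
    and "y' \<in> carrier (cobj Y n)" "x' \<in> carrier (cobj X (n - 1))" "i (n - 1) x' = cdiff Y n y'"
    and "p n y' \<in> hclass Z n (p n y)"
  shows "hclass X (n - 1) x' = hclass X (n - 1) x"
proof -
  obtain w where w: "w \<in> carrier (cobj Z (n + 1))"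
      "p n y' = cdiff Z (n + 1) w \<otimes>\<^bsub>cobj Z n\<^esub> p n y"
    using assms(7) by (auto simp: p.Y.mem_hclass_iff)
  then obtain v where v: "v \<in> carrier (cobj Y (n + 1))" "w = p (n + 1) v"
    using p_lift by blast
  let ?t = "cdiff Y (n + 1) v \<otimes>\<^bsub>cobj Y n\<^esub> y"
  have t: "?t \<in> carrier (cobj Y n)"
    using v assms by simp
  \<comment> \<open>\<open>?t\<close> is y corrected by d v, so that it has the same image as y' and
    exactness applies to the quotient of the two.\<close>
  have pt: "p n ?t = p n y'"
    using v w assms p.u_cdiff[of v "n + 1"] by simp
  then have "p n (y' \<otimes>\<^bsub>cobj Y n\<^esub> inv\<^bsub>cobj Y n\<^esub> ?t) = \<one>\<^bsub>cobj Z n\<^esub>"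
    using t assms by (simp del: i.Y.cdiff_mult i.Y.G.inv_mult_group p.map_mult add: p.map_mult[of y'])
  then obtain u where u: "u \<in> carrier (cobj X n)"
      "y' \<otimes>\<^bsub>cobj Y n\<^esub> inv\<^bsub>cobj Y n\<^esub> ?t = i n u"
    using p_eq_one[of "y' \<otimes>\<^bsub>cobj Y n\<^esub> inv\<^bsub>cobj Y n\<^esub> ?t" n] t assms
    by (metis i.Y.G.inv_closed i.Y.G.m_closed)
  then have "y' = i n u \<otimes>\<^bsub>cobj Y n\<^esub> ?t"
    using t assms by (metis i.Y.G.inv_solve_right' i.map_closed)
  then have "cdiff Y n y' = i (n - 1) (cdiff X n u) \<otimes>\<^bsub>cobj Y (n - 1)\<^esub> i (n - 1) x"
    using u v assms by (simp add: i.u_cdiff)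
  then have "i (n - 1) x' = i (n - 1) (cdiff X n u \<otimes>\<^bsub>cobj X (n - 1)\<^esub> x)"
    using assms u by simp
  then have "x' = cdiff X n u \<otimes>\<^bsub>cobj X (n - 1)\<^esub> x"
    using assms u by (simp del: i.map_mult)
  then show ?thesis
    using assms u by (subst i.X.hclass_eq_iff) (auto intro!: bexI[of _ u])
qed

text \<open>Any pair (y, x) at hand may be used to evaluate the connecting map, since by
  \<open>snake_unique\<close> the set under \<open>the_elem\<close> is a singleton.\<close>

lemma connecting_hclass:
  assumes "y \<in> carrier (cobj Y n)" "x \<in> carrier (cobj X (n - 1))" "i (n - 1) x = cdiff Y n y"
  shows "homology_connecting X i Y p n (hclass Z n (p n y)) = hclass X (n - 1) x"
proof -
  have "{hclass X (n - 1) x' |x' y'. x' \<in> carrier (cobj X (n - 1)) \<and> y' \<in> carrier (cobj Y n) \<and>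
      p n y' \<in> hclass Z n (p n y) \<and> i (n - 1) x' = cdiff Y n y'} = {hclass X (n - 1) x}"
    (is "?L = _")
  proof (rule equalityI)
    show "?L \<subseteq> {hclass X (n - 1) x}"
      using snake_unique[OF assms] by blast
    show "{hclass X (n - 1) x} \<subseteq> ?L"
      using assms p.Y.self_mem_hclass[of "p n y" n] by auto
  qed
  then show ?thesis
    by (simp add: homology_connecting_def connecting_def hclass_def)
qed

lemma connecting_hom:
  "homology_connecting X i Y p n \<in> hom (homology Z n) (homology X (n - 1))"
proof (rule homI)
  fix S assume "S \<in> carrier (homology Z n)"
  then obtain z where "z \<in> cycles Z n" "S = hclass Z n z"
    by (auto simp: p.Y.carrier_homology)
  then show "homology_connecting X i Y p n S \<in> carrier (homology X (n - 1))"
    by (metis snake_exists connecting_hclass snake(2) i.X.carrier_homology imageI)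
next
  fix S S' assume "S \<in> carrier (homology Z n)" "S' \<in> carrier (homology Z n)"
  then obtain z z' where z: "z \<in> cycles Z n" "S = hclass Z n z"
      "z' \<in> cycles Z n" "S' = hclass Z n z'"
    by (auto simp: p.Y.carrier_homology)
  obtain y x where yx: "y \<in> carrier (cobj Y n)" "x \<in> carrier (cobj X (n - 1))"
      "i (n - 1) x = cdiff Y n y" "p n y = z"
    using snake_exists z(1) by metis
  obtain y' x' where yx': "y' \<in> carrier (cobj Y n)" "x' \<in> carrier (cobj X (n - 1))"
      "i (n - 1) x' = cdiff Y n y'" "p n y' = z'"
    using snake_exists z(3) by metis
  have "S \<otimes>\<^bsub>homology Z n\<^esub> S' = hclass Z n (p n (y \<otimes>\<^bsub>cobj Y n\<^esub> y'))"
    using z yx yx' by (auto simp: p.Y.hclass_mult)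
  then have "homology_connecting X i Y p n (S \<otimes>\<^bsub>homology Z n\<^esub> S')
      = hclass X (n - 1) (x \<otimes>\<^bsub>cobj X (n - 1)\<^esub> x')"
    using yx yx'
      connecting_hclass[of "y \<otimes>\<^bsub>cobj Y n\<^esub> y'" n "x \<otimes>\<^bsub>cobj X (n - 1)\<^esub> x'"]
    by simp
  then show "homology_connecting X i Y p n (S \<otimes>\<^bsub>homology Z n\<^esub> S') =
      homology_connecting X i Y p n S \<otimes>\<^bsub>homology X (n - 1)\<^esub> homology_connecting X i Y p n S'"
    using z yx yx' connecting_hclass[OF yx(1-3)] connecting_hclass[OF yx'(1-3)]
    by (simp add: i.X.hclass_mult)
qed

section \<open>Exactness at the three places\<close>

lemma exact_at_Z:
  "kernel (homology Z n) (homology X (n - 1)) (homology_connecting X i Y p n)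
     = homology_map Z p n ` carrier (homology Y n)"
proof (intro equalityI subsetI)
  fix S assume "S \<in> kernel (homology Z n) (homology X (n - 1)) (homology_connecting X i Y p n)"
  then obtain z where z: "z \<in> cycles Z n" "S = hclass Z n z"
      "homology_connecting X i Y p n (hclass Z n z) = \<one>\<^bsub>homology X (n - 1)\<^esub>"
    by (auto simp: p.Y.carrier_homology kernel_def)
  obtain y x where yx: "y \<in> carrier (cobj Y n)" "x \<in> carrier (cobj X (n - 1))"
      "i (n - 1) x = cdiff Y n y" "p n y = z"
    using snake_exists z(1) by metis
  have "hclass X (n - 1) x = \<one>\<^bsub>homology X (n - 1)\<^esub>"
    using z yx connecting_hclass[OF yx(1-3)] by simp
  then obtain w where w: "w \<in> carrier (cobj X n)" "x = cdiff X n w"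
    using yx i.X.hclass_eq_one_iff[of x "n - 1"] by auto
  \<comment> \<open>Since d y = i x = i (d w) = d (i w), removing i w turns the lift y into a cycle
    without changing its image in Z.\<close>
  define y' where "y' = y \<otimes>\<^bsub>cobj Y n\<^esub> inv\<^bsub>cobj Y n\<^esub> i n w"
  have y': "y' \<in> cycles Y n"
    using w yx by (simp add: y'_def i.Y.cycles_iff i.u_cdiff)
  moreover have "p n y' = z"
    using w yx by (auto simp: y'_def)
  ultimately have "S = homology_map Z p n (hclass Y n y')"
    using z by (simp add: p.homology_map_hclass i.Y.cycles_iff)
  then show "S \<in> homology_map Z p n ` carrier (homology Y n)"
    using y' by (auto simp: i.Y.carrier_homology)
next
  fix S assume "S \<in> homology_map Z p n ` carrier (homology Y n)"
  then obtain y where y: "y \<in> cycles Y n" "S = hclass Z n (p n y)"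
    by (auto simp: i.Y.carrier_homology p.homology_map_hclass i.Y.cycles_iff)
  \<comment> \<open>A cycle y forms the pair (y, 1), because d y = 1 = i 1.\<close>
  have "homology_connecting X i Y p n S = hclass X (n - 1) \<one>\<^bsub>cobj X (n - 1)\<^esub>"
    unfolding y(2) using y(1) by (intro connecting_hclass) (auto simp: i.Y.cycles_iff)
  then show "S \<in> kernel (homology Z n) (homology X (n - 1)) (homology_connecting X i Y p n)"
    using y p.map_cycle[of y n]
    by (auto simp: kernel_def p.Y.carrier_homology i.X.one_homology)
qed

lemma exact_at_Y:
  "kernel (homology Y n) (homology Z n) (homology_map Z p n)
     = homology_map Y i n ` carrier (homology X n)"
proof (intro equalityI subsetI)
  fix S assume "S \<in> kernel (homology Y n) (homology Z n) (homology_map Z p n)"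
  then obtain y where y: "y \<in> cycles Y n" "S = hclass Y n y"
      "homology_map Z p n (hclass Y n y) = \<one>\<^bsub>homology Z n\<^esub>"
    by (auto simp: i.Y.carrier_homology kernel_def)
  then have yc: "y \<in> carrier (cobj Y n)" "cdiff Y n y = \<one>\<^bsub>cobj Y (n - 1)\<^esub>"
    by (auto simp: i.Y.cycles_iff)
  then obtain v where v: "v \<in> carrier (cobj Z (n + 1))" "p n y = cdiff Z (n + 1) v"
    using y by (auto simp: p.homology_map_hclass p.Y.hclass_eq_one_iff)
  then obtain t where t: "t \<in> carrier (cobj Y (n + 1))" "v = p (n + 1) t"
    using p_lift by blast
  \<comment> \<open>Removing the boundary of t, a lift of v, keeps the class of y and moves y into
    the kernel of p, that is, into the image of i.\<close>
  have "p n (y \<otimes>\<^bsub>cobj Y n\<^esub> inv\<^bsub>cobj Y n\<^esub> cdiff Y (n + 1) t) = \<one>\<^bsub>cobj Z n\<^esub>"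
    using t v yc p.u_cdiff[of t "n + 1"] by simp
  then obtain x where x: "x \<in> carrier (cobj X n)"
      "y \<otimes>\<^bsub>cobj Y n\<^esub> inv\<^bsub>cobj Y n\<^esub> cdiff Y (n + 1) t = i n x"
    using p_eq_one[of "y \<otimes>\<^bsub>cobj Y n\<^esub> inv\<^bsub>cobj Y n\<^esub> cdiff Y (n + 1) t" n] t yc
    by auto
  have "cdiff Y n (i n x) = \<one>\<^bsub>cobj Y (n - 1)\<^esub>"
    unfolding x(2)[symmetric] using t yc by simp
  then have xc: "x \<in> cycles X n"
    using x by (simp add: i.X.cycles_iff i.u_cdiff)
  have "y = i n x \<otimes>\<^bsub>cobj Y n\<^esub> cdiff Y (n + 1) t"
    using x t yc by (metis (no_types, lifting) i.Y.G.inv_solve_right' i.map_closed i.Y.cdiff_closed add_diff_cancel_right')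
  then have "y = cdiff Y (n + 1) t \<otimes>\<^bsub>cobj Y n\<^esub> i n x"
    using x t by (simp add: i.Y.G.m_comm)
  then have "hclass Y n y = hclass Y n (i n x)"
    using x t yc by (subst i.Y.hclass_eq_iff) auto
  then show "S \<in> homology_map Y i n ` carrier (homology X n)"
    using y x xc by (auto simp: i.X.carrier_homology i.homology_map_hclass intro!: rev_image_eqI)
next
  fix S assume "S \<in> homology_map Y i n ` carrier (homology X n)"
  then obtain x where x: "x \<in> cycles X n" "S = hclass Y n (i n x)"
    by (auto simp: i.X.carrier_homology i.homology_map_hclass i.X.cycles_iff)
  then show "S \<in> kernel (homology Y n) (homology Z n) (homology_map Z p n)"
    using i.map_cycle[of x n]
    by (auto simp: kernel_def i.Y.carrier_homology p.Y.one_homology p.homology_map_hclass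
        i.X.cycles_iff)
qed

text \<open>The class of i x vanishes exactly if i x = d y for some y, and this says that (y, x) is
  a snake pair, so that [x] is the image of [p y]. Both inclusions are this observation.\<close>

lemma exact_at_X:
  "kernel (homology X n) (homology Y n) (homology_map Y i n)
     = homology_connecting X i Y p (n + 1) ` carrier (homology Z (n + 1))"
proof (intro equalityI subsetI)
  fix S assume "S \<in> kernel (homology X n) (homology Y n) (homology_map Y i n)"
  then obtain x where x: "x \<in> cycles X n" "S = hclass X n x"
      "homology_map Y i n (hclass X n x) = \<one>\<^bsub>homology Y n\<^esub>"
    by (auto simp: i.X.carrier_homology kernel_def)
  then have xc: "x \<in> carrier (cobj X n)"
    by (auto simp: i.X.cycles_iff)
  then obtain y where y: "y \<in> carrier (cobj Y (n + 1))" "i n x = cdiff Y (n + 1) y"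
    using x by (auto simp: i.homology_map_hclass i.Y.hclass_eq_one_iff)
  have "p (n + 1) y \<in> cycles Z (n + 1)"
      "homology_connecting X i Y p (n + 1) (hclass Z (n + 1) (p (n + 1) y)) = S"
    using snake[of y "n + 1" x] connecting_hclass[of y "n + 1" x] xc x y by auto
  then show "S \<in> homology_connecting X i Y p (n + 1) ` carrier (homology Z (n + 1))"
    by (auto simp: p.Y.carrier_homology)
next
  fix S assume "S \<in> homology_connecting X i Y p (n + 1) ` carrier (homology Z (n + 1))"
  then obtain z where z: "z \<in> cycles Z (n + 1)"
      "S = homology_connecting X i Y p (n + 1) (hclass Z (n + 1) z)"
    by (auto simp: p.Y.carrier_homology)
  obtain y x where yx: "y \<in> carrier (cobj Y (n + 1))" "x \<in> carrier (cobj X n)"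
      "i n x = cdiff Y (n + 1) y" "p (n + 1) y = z"
    using snake_exists[OF z(1)] by auto
  then have "S = hclass X n x" "x \<in> cycles X n"
    using connecting_hclass[of y "n + 1" x] snake[of y "n + 1" x] z by auto
  moreover have "hclass Y n (i n x) = \<one>\<^bsub>homology Y n\<^esub>"
    using yx by (subst i.Y.hclass_eq_one_iff) auto
  ultimately show "S \<in> kernel (homology X n) (homology Y n) (homology_map Y i n)"
    using yx by (auto simp: kernel_def i.X.carrier_homology i.homology_map_hclass)
qed

lemma long_exact_homology_seq: "long_exact (homology_seq X i Y p Z)"
proof -
  have "group (homology X n)" "group (homology Y n)" "group (homology Z n)" for n
    using i.X.comm_group_homology i.Y.comm_group_homology p.Y.comm_group_homology
    by (auto simp: comm_group_def)
  moreover have "homology_connecting X i Y p (n + 1) \<in> hom (homology Z (n + 1)) (homology X n)"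
    for n using connecting_hom[of "n + 1"] by simp
  ultimately show ?thesis
    unfolding long_exact_def homology_seq_def
    by (simp add: i.X.comm_group_homology i.Y.comm_group_homology p.Y.comm_group_homology
        group_hom_def group_hom_axioms_def connecting_hom i.homology_map_hom p.homology_map_hom
        exact_at_X exact_at_Y exact_at_Z)
qed

end

text \<open>The connecting square commutes because chain maps carry the snake pair (y, x) to the
  snake pair (b y, a x).\<close>

lemma ladder_morphism_homology_seq:
  assumes "complex_ses X Y Z i p" "complex_ses X' Y' Z' i' p'"
    and "group_chain_map X X' a" "group_chain_map Y Y' b" "group_chain_map Z Z' c"
    and bi: "\<And>n x. x \<in> carrier (cobj X n) \<Longrightarrow> b n (i n x) = i' n (a n x)"
    and cp: "\<And>n y. y \<in> carrier (cobj Y n) \<Longrightarrow> c n (p n y) = p' n (b n y)"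
  shows "ladder_morphism (homology_seq X i Y p Z) (homology_seq X' i' Y' p' Z')
    \<lparr>onA = homology_map X' a, onB = homology_map Y' b, onC = homology_map Z' c\<rparr>"
proof -
  interpret S: complex_ses X Y Z i p by fact
  interpret S': complex_ses X' Y' Z' i' p' by fact
  interpret a: group_chain_map X X' a by fact
  interpret b: group_chain_map Y Y' b by fact
  interpret c: group_chain_map Z Z' c by fact
  have "homology_map X' a (n - 1) (homology_connecting X i Y p n S)
      = homology_connecting X' i' Y' p' n (homology_map Z' c n S)"
    if S: "S \<in> carrier (homology Z n)" for n S
  proof -
    obtain z where z: "z \<in> cycles Z n" "S = hclass Z n z"
      using S by (auto simp: S.p.Y.carrier_homology)
    obtain y x where yx: "y \<in> carrier (cobj Y n)" "x \<in> carrier (cobj X (n - 1))"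
        "i (n - 1) x = cdiff Y n y" "p n y = z"
      using S.snake_exists z(1) by metis
    have "i' (n - 1) (a (n - 1) x) = cdiff Y' n (b n y)"
      using yx by (simp add: bi[symmetric] b.u_cdiff)
    then have "homology_connecting X' i' Y' p' n (hclass Z' n (p' n (b n y)))
        = hclass X' (n - 1) (a (n - 1) x)"
      using yx by (intro S'.connecting_hclass) auto
    then show ?thesis
      using z yx S.connecting_hclass[OF yx(1-3)] cp[OF yx(1)]
      by (auto simp: a.homology_map_hclass c.homology_map_hclass S.p.Y.cycles_iff)
  qed
  moreover have "homology_map Y' b n (homology_map Y i n S)
      = homology_map Y' i' n (homology_map X' a n S)" if "S \<in> carrier (homology X n)" for n S
    using that by (auto simp: S.i.X.carrier_homology S.i.X.cycles_iff a.homology_map_hclass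
        b.homology_map_hclass S.i.homology_map_hclass S'.i.homology_map_hclass bi)
  moreover have "homology_map Z' c n (homology_map Z p n S)
      = homology_map Z' p' n (homology_map Y' b n S)" if "S \<in> carrier (homology Y n)" for n S
    using that by (auto simp: S.i.Y.carrier_homology S.i.Y.cycles_iff c.homology_map_hclass
        b.homology_map_hclass S.p.homology_map_hclass S'.p.homology_map_hclass cp)
  ultimately show ?thesis
    by (simp add: ladder_morphism_def homology_seq_def a.homology_map_hom b.homology_map_hom
        c.homology_map_hom)
qed

section \<open>Split exact sequences in abelian categories\<close>

lemma carrier_hom_group [simp]: "carrier (hom_group \<A> X Y) = hom_set \<A> X Y"
  and mult_hom_group [simp]: "mult (hom_group \<A> X Y) = Add \<A>"
  and one_hom_group [simp]: "one (hom_group \<A> X Y) = Zero \<A> X Y"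
  by (simp_all add: hom_group_def)

lemma hom_set_iff: "f \<in> hom_set \<A> X Y \<longleftrightarrow> f \<in> Arr \<A> \<and> Dom \<A> f = X \<and> Cod \<A> f = Y"
  by (simp add: hom_set_def)

context preadditive_category
begin

lemma hom_set_Obj: "f \<in> hom_set \<A> X Y \<Longrightarrow> X \<in> Obj \<A>" "f \<in> hom_set \<A> X Y \<Longrightarrow> Y \<in> Obj \<A>"
  by (auto simp: hom_set_def Dom_in_Obj Cod_in_Obj)

lemma Comp_left_hom:
  assumes "g \<in> hom_set \<A> Y Z" "X \<in> Obj \<A>"
  shows "(\<lambda>f. g \<cdot> f) \<in> hom (hom_group \<A> X Y) (hom_group \<A> X Z)"
  using assms by (auto intro!: homI Comp_in_hom Comp_Add_right)

lemma Comp_right_hom: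
  assumes "f \<in> hom_set \<A> X Y" "Z \<in> Obj \<A>"
  shows "(\<lambda>g. g \<cdot> f) \<in> hom (hom_group \<A> Y Z) (hom_group \<A> X Z)"
  using assms by (auto intro!: homI Comp_in_hom Comp_Add_left)

lemma group_hom_group: "X \<in> Obj \<A> \<Longrightarrow> Y \<in> Obj \<A> \<Longrightarrow> group (hom_group \<A> X Y)"
  using comm_group_hom_group by (simp add: comm_group_def)

lemma Comp_Zero_right:
  assumes "g \<in> hom_set \<A> Y Z" "X \<in> Obj \<A>"
  shows "g \<cdot> Zero \<A> X Y = Zero \<A> X Z"
  using hom_one[OF Comp_left_hom[OF assms]] group_hom_group assms hom_set_Obj by auto

lemma Comp_Zero_left:
  assumes "f \<in> hom_set \<A> X Y" "Z \<in> Obj \<A>"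
  shows "Zero \<A> Y Z \<cdot> f = Zero \<A> X Z"
  using hom_one[OF Comp_right_hom[OF assms]] group_hom_group assms hom_set_Obj by auto

lemma Zero_in_hom: "X \<in> Obj \<A> \<Longrightarrow> Y \<in> Obj \<A> \<Longrightarrow> Zero \<A> X Y \<in> hom_set \<A> X Y"
  using group.is_monoid[OF group_hom_group, THEN monoid.one_closed] by fastforce

lemma Add_in_hom:
  "f \<in> hom_set \<A> X Y \<Longrightarrow> g \<in> hom_set \<A> X Y \<Longrightarrow> Add \<A> f g \<in> hom_set \<A> X Y"
  using monoid.m_closed[OF group.is_monoid[OF group_hom_group], of X Y f g] hom_set_Obj by auto

lemma Add_Zero:
  assumes "f \<in> hom_set \<A> X Y"
  shows "Add \<A> f (Zero \<A> X Y) = f" "Add \<A> (Zero \<A> X Y) f = f"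
proof -
  interpret group "hom_group \<A> X Y"
    using assms group_hom_group hom_set_Obj by blast
  show "Add \<A> f (Zero \<A> X Y) = f" "Add \<A> (Zero \<A> X Y) f = f"
    using r_one[of f] l_one[of f] assms by auto
qed

lemma chain_complexD:
  assumes "chain_complex \<A> U"
  shows "cobj U n \<in> Obj \<A>" "m = n - 1 \<Longrightarrow> cdiff U n \<in> hom_set \<A> (cobj U n) (cobj U m)"
    and "m = n - 1 \<Longrightarrow> cdiff U m \<cdot> cdiff U n = Zero \<A> (cobj U n) (cobj U (m - 1))"
  using assms by (auto simp: chain_complex_def)

lemma chain_mapD:
  assumes "chain_map \<A> U V u"
  shows "u n \<in> hom_set \<A> (cobj U n) (cobj V n)"
    and "m = n - 1 \<Longrightarrow> cdiff V n \<cdot> u n = u m \<cdot> cdiff U n"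
  using assms by (auto simp: chain_map_def)

end

lemma is_kernel_factor:
  assumes "is_kernel \<A> f k" "f \<in> hom_set \<A> X Y" "g \<in> hom_set \<A> W X" "f \<cdot>\<^bsub>\<A>\<^esub> g = Zero \<A> W Y"
  obtains h where "h \<in> hom_set \<A> W (Dom \<A> k)" "k \<cdot>\<^bsub>\<A>\<^esub> h = g"
proof -
  have "\<exists>!h. h \<in> hom_set \<A> W (Dom \<A> k) \<and> k \<cdot>\<^bsub>\<A>\<^esub> h = g"
    using assms by (simp add: is_kernel_def hom_set_iff)
  then show thesis
    using that by blast
qed

lemma is_cokernel_factor:
  assumes "is_cokernel \<A> f q" "f \<in> hom_set \<A> X Y" "g \<in> hom_set \<A> Y W" "g \<cdot>\<^bsub>\<A>\<^esub> f = Zero \<A> X W"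
  obtains h where "h \<in> hom_set \<A> (Cod \<A> q) W" "h \<cdot>\<^bsub>\<A>\<^esub> q = g"
proof -
  have "\<exists>!h. h \<in> hom_set \<A> (Cod \<A> q) W \<and> h \<cdot>\<^bsub>\<A>\<^esub> q = g"
    using assms by (simp add: is_cokernel_def hom_set_iff)
  then show thesis
    using that by blast
qed

text \<open>Additive functors respect equations between arrows, so the split sequence is put into
  equational form. The retraction r of f is not given with the section s; it is extracted from the
  idempotent 1 - s g.\<close>

lemma (in abelian_category) split_short_exact_biproduct:
  assumes "short_exact \<A> f g" "s \<in> hom_set \<A> (Cod \<A> g) (Dom \<A> g)"
    "g \<cdot> s = Ident \<A> (Cod \<A> g)"
  shows "\<exists>r. is_biproduct \<A> (Dom \<A> f) (Cod \<A> g) (Dom \<A> g) f s r g"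
proof -
  define X P Y where "X = Dom \<A> f" and "P = Dom \<A> g" and "Y = Cod \<A> g"
  have f: "f \<in> hom_set \<A> X P" and g: "g \<in> hom_set \<A> P Y" and mono: "is_mono \<A> f"
    using assms(1) unfolding short_exact_def exact_at_def hom_set_iff X_def P_def Y_def by simp_all
  have s: "s \<in> hom_set \<A> Y P" "g \<cdot> s = Ident \<A> Y"
    using assms by (auto simp: P_def Y_def)
  have obj [simp]: "X \<in> Obj \<A>" "P \<in> Obj \<A>" "Y \<in> Obj \<A>"
    using f g hom_set_Obj by blast+
  obtain q k where q: "is_cokernel \<A> f q" and qk: "is_kernel \<A> q k" and gk: "is_kernel \<A> g k"
    using assms(1) unfolding short_exact_def exact_at_def by blast
  obtain h where h: "is_kernel \<A> h f"
    using mono_is_kernel[OF mono] by blast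
  define K Q where "K = Dom \<A> k" and "Q = Cod \<A> q"
  have k: "k \<in> hom_set \<A> K P" and qh: "q \<in> hom_set \<A> P Q"
    using gk q f by (auto simp: is_kernel_def is_cokernel_def hom_set_def K_def Q_def P_def)
  have obj' [simp]: "K \<in> Obj \<A>" "Q \<in> Obj \<A>"
    using k qh hom_set_Obj by blast+
  have qf: "q \<cdot> f = Zero \<A> X Q" and qk0: "q \<cdot> k = Zero \<A> K Q" and gk0: "g \<cdot> k = Zero \<A> K Y"
    using q qk gk f by (auto simp: is_kernel_def is_cokernel_def hom_set_def K_def Q_def P_def Y_def)
  \<comment> \<open>As q f = 0, f factors through the kernel k of q, which by exactness is also a
    kernel of g.\<close>
  have gf: "g \<cdot> f = Zero \<A> X Y"
  proof -
    obtain t where "t \<in> hom_set \<A> X K" "k \<cdot> t = f"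
      using is_kernel_factor[OF qk qh f qf] K_def by blast
    then show ?thesis
      using Comp_assoc[of t X K k P g Y] Comp_Zero_left[of t X K Y] k g gk0 by auto
  qed
  interpret PP: comm_group "hom_group \<A> P P"
    using comm_group_hom_group by simp
  have sg: "s \<cdot> g \<in> hom_set \<A> P P"
    using Comp_in_hom g s by blast
  \<comment> \<open>The complementary idempotent \<open>e = 1 - s g\<close> satisfies \<open>g e = 0\<close>, hence \<open>q e = 0\<close>, and so it factors
    through \<open>f\<close>, a kernel of some \<open>h\<close> that vanishes on \<open>f\<close> and hence factors through \<open>q\<close>.\<close>
  define e where "e = Ident \<A> P \<otimes>\<^bsub>hom_group \<A> P P\<^esub> inv\<^bsub>hom_group \<A> P P\<^esub> (s \<cdot> g)"
  have e: "e \<in> hom_set \<A> P P"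
    using PP.m_closed[of "Ident \<A> P" "inv\<^bsub>hom_group \<A> P P\<^esub> (s \<cdot> g)"] PP.inv_closed[of "s \<cdot> g"] sg
      Ident_in_hom[of P] by (simp add: e_def)
  have esg: "Add \<A> e (s \<cdot> g) = Ident \<A> P"
    using PP.inv_solve_right[of e "Ident \<A> P" "s \<cdot> g"] e sg Ident_in_hom[of P] by (simp add: e_def)
  have ge: "g \<cdot> e = Zero \<A> P Y"
  proof -
    interpret PY: comm_group "hom_group \<A> P Y"
      using comm_group_hom_group by simp
    have gsg: "g \<cdot> (s \<cdot> g) = g"
      using Comp_assoc[OF g s(1) g] s(2) Comp_Ident_left[OF g] by simp
    have "Add \<A> (g \<cdot> e) g = g \<cdot> Add \<A> e (s \<cdot> g)"
      using Comp_Add_right[OF e sg g] gsg by simp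
    then have "Add \<A> (g \<cdot> e) g = g"
      using esg Comp_Ident_right[OF g] by simp
    then show ?thesis
      using PY.r_cancel_one[of g "g \<cdot> e"] g Comp_in_hom[OF e g] by simp
  qed
  obtain t where t: "t \<in> hom_set \<A> P K" "k \<cdot> t = e"
    using is_kernel_factor[OF gk g e ge] K_def by blast
  have qe: "q \<cdot> e = Zero \<A> P Q"
    using Comp_assoc[OF t(1) k qh] t qk0 Comp_Zero_left[OF t(1), of Q] by simp
  have hh: "h \<in> hom_set \<A> P (Cod \<A> h)" "h \<cdot> f = Zero \<A> X (Cod \<A> h)"
    using h f by (auto simp: is_kernel_def hom_set_def X_def)
  have he: "h \<cdot> e = Zero \<A> P (Cod \<A> h)"
  proof -
    obtain v where v: "v \<in> hom_set \<A> Q (Cod \<A> h)" "v \<cdot> q = h"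
      using is_cokernel_factor[OF q f hh] Q_def by blast
    then show ?thesis
      using Comp_assoc[OF e qh v(1)] qe Comp_Zero_right[OF v(1), of P] by simp
  qed
  obtain r where r: "r \<in> hom_set \<A> P X" "f \<cdot> r = e"
    using is_kernel_factor[OF h hh(1) e he] X_def by blast
  \<comment> \<open>With f r = e, cancelling the mono f turns e f = f into r f = 1 and e s = 0 into
    r s = 0.\<close>
  have cancel: "a = b" if "f \<cdot> a = f \<cdot> b" "a \<in> hom_set \<A> W X" "b \<in> hom_set \<A> W X" for a b W
    using mono that by (auto simp: is_mono_def X_def)
  have ef: "e \<cdot> f = f"
  proof -
    have "Add \<A> (e \<cdot> f) (s \<cdot> g \<cdot> f) = Add \<A> e (s \<cdot> g) \<cdot> f"
      using Comp_Add_left[OF f e sg] Comp_assoc[OF f g s(1)] by simp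
    then show ?thesis
      using gf Comp_Zero_right[OF s(1), of X] esg Comp_Ident_left[OF f]
        Add_Zero(1)[OF Comp_in_hom[OF f e]] by simp
  qed
  have rf: "r \<cdot> f = Ident \<A> X"
  proof (rule cancel)
    show "f \<cdot> (r \<cdot> f) = f \<cdot> Ident \<A> X"
      using Comp_assoc[OF f r(1) f] r ef Comp_Ident_right[OF f] by simp
  qed (use Comp_in_hom[OF f r(1)] Ident_in_hom in auto)
  have es: "e \<cdot> s = Zero \<A> Y P"
  proof -
    interpret YP: comm_group "hom_group \<A> Y P"
      using comm_group_hom_group by simp
    have "Add \<A> (e \<cdot> s) s = Add \<A> e (s \<cdot> g) \<cdot> s"
      using Comp_Add_left[OF s(1) e sg] Comp_assoc[OF s(1) g s(1)] s(2) Comp_Ident_right[OF s(1)]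
      by simp
    then have "Add \<A> (e \<cdot> s) s = s"
      using esg Comp_Ident_left[OF s(1)] by simp
    then show ?thesis
      using YP.r_cancel_one[of s "e \<cdot> s"] s Comp_in_hom[OF s(1) e] by simp
  qed
  have rs: "r \<cdot> s = Zero \<A> Y X"
  proof (rule cancel)
    show "f \<cdot> (r \<cdot> s) = f \<cdot> Zero \<A> Y X"
      using Comp_assoc[OF s(1) r(1) f] r es Comp_Zero_right[OF f, of Y] by simp
  qed (use Comp_in_hom[OF s(1) r(1)] Zero_in_hom in auto)
  have "is_biproduct \<A> X Y P f s r g"
    using f g s r rf rs gf esg by (simp add: is_biproduct_def)
  then show ?thesis
    by (auto simp: X_def P_def Y_def)
qed

lemma (in abelian_category) termwise_split_biproduct:
  assumes "termwise_split_ses \<A> A \<alpha> B \<beta> C"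
  obtains s r where "is_biproduct \<A> (cobj A n) (cobj C n) (cobj B n) (\<alpha> n) s r (\<beta> n)"
proof -
  have hom: "\<alpha> n \<in> hom_set \<A> (cobj A n) (cobj B n)" "\<beta> n \<in> hom_set \<A> (cobj B n) (cobj C n)"
    using assms by (auto simp: termwise_split_ses_def chain_map_def)
  obtain s where "s \<in> hom_set \<A> (cobj C n) (cobj B n)" "\<beta> n \<cdot> s = Ident \<A> (cobj C n)"
    "short_exact \<A> (\<alpha> n) (\<beta> n)"
    using assms by (auto simp: termwise_split_ses_def)
  then show thesis
    using split_short_exact_biproduct[of "\<alpha> n" "\<beta> n" s] hom that by (auto simp: hom_set_iff)
qed

text \<open>Puts a cokernel into the form in which \<open>right_exact_functor\<close> can be
  applied: a kernel of q is at once the image of f and the kernel required by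
  \<open>exact_at\<close>.\<close>

lemma (in abelian_category) cokernel_exact_at:
  assumes "is_cokernel \<A> f q"
  shows "exact_at \<A> f q" "is_epi \<A> q"
proof -
  obtain k where "is_kernel \<A> q k"
    using kernels[of q] assms unfolding is_cokernel_def by blast
  then show "exact_at \<A> f q"
    using assms by (auto simp: exact_at_def is_cokernel_def)
  show "is_epi \<A> q"
    unfolding is_epi_def
  proof (intro conjI allI ballI impI)
    show q: "q \<in> Arr \<A>"
      using assms by (simp add: is_cokernel_def)
    fix W g h assume gh: "g \<in> hom_set \<A> (Cod \<A> q) W" "h \<in> hom_set \<A> (Cod \<A> q) W" "g \<cdot> q = h \<cdot> q"
    have f: "f \<in> hom_set \<A> (Dom \<A> f) (Cod \<A> f)" and qh: "q \<in> hom_set \<A> (Cod \<A> f) (Cod \<A> q)"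
      and qf: "q \<cdot> f = Zero \<A> (Dom \<A> f) (Cod \<A> q)"
      using assms by (auto simp: is_cokernel_def hom_set_iff)
    have "(g \<cdot> q) \<cdot> f = Zero \<A> (Dom \<A> f) W"
      using Comp_assoc[OF f qh gh(1)] qf Comp_Zero_right[OF gh(1)] hom_set_Obj(1)[OF f] by simp
    moreover have "g \<cdot> q \<in> hom_set \<A> (Cod \<A> f) W"
      using Comp_in_hom[OF qh gh(1)] .
    ultimately have "\<exists>!h. h \<in> hom_set \<A> (Cod \<A> q) W \<and> h \<cdot> q = g \<cdot> q"
      using assms by (simp add: is_cokernel_def)
    then show "g = h"
      using gh by metis
  qed
qed

section \<open>The complexes \<open>Hom(U, M)\<close>\<close>

text \<open>
  Reversing the grading turns cohomology into homology, so that nothing has to be proved twice.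
\<close>

definition rev_cplx :: "('o, 'm) cplx \<Rightarrow> ('o, 'm) cplx" where
  "rev_cplx X = \<lparr>cobj = (\<lambda>n. cobj X (- n)), cdiff = (\<lambda>n. cdiff X (- n))\<rparr>"

lemma cobj_rev [simp]: "cobj (rev_cplx X) n = cobj X (- n)"
  and cdiff_rev [simp]: "cdiff (rev_cplx X) n = cdiff X (- n)"
  by (simp_all add: rev_cplx_def)

lemma coboundaries_eq: "coboundaries X n = boundaries (rev_cplx X) (- n)"
  by (simp add: coboundaries_def boundaries_def)

lemma cohomology_eq: "cohomology X n = homology (rev_cplx X) (- n)"
  by (simp add: cohomology_def homology_def coboundaries_eq add.commute)

lemma cohomology_map_eq: "cohomology_map Y u n = homology_map (rev_cplx Y) (\<lambda>k. u (- k)) (- n)"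
  by (simp add: cohomology_map_def homology_map_def coboundaries_eq)

lemma cohomology_connecting_eq: "cohomology_connecting X i Y p n =
    homology_connecting (rev_cplx X) (\<lambda>k. i (- k)) (rev_cplx Y) (\<lambda>k. p (- k)) (1 - n)"
  by (simp add: cohomology_connecting_def homology_connecting_def coboundaries_eq)

text \<open>Degree - n of this chain complex is degree n of Hom(U,M), whence the arguments
  \<open>- n\<close> and \<open>1 - n\<close> below.\<close>

definition rev_Hom :: "('o, 'm) precat \<Rightarrow> ('o, 'm) cplx \<Rightarrow> 'o \<Rightarrow> ('m monoid, 'm \<Rightarrow> 'm) cplx" where
  "rev_Hom \<A> U M = rev_cplx (Hom_cplx \<A> U M)"

lemma cobj_rev_Hom [simp]: "cobj (rev_Hom \<A> U M) n = hom_group \<A> (cobj U (- n)) M"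
  and cdiff_rev_Hom [simp]: "cdiff (rev_Hom \<A> U M) n = (\<lambda>f. f \<cdot>\<^bsub>\<A>\<^esub> cdiff U (1 - n))"
  by (simp_all add: rev_Hom_def Hom_cplx_def)

definition cocycle :: "('o, 'm) precat \<Rightarrow> ('o, 'm) cplx \<Rightarrow> int \<Rightarrow> 'o \<Rightarrow> 'm \<Rightarrow> bool" where
  "cocycle \<A> U n M f \<longleftrightarrow>
     f \<in> hom_set \<A> (cobj U n) M \<and> f \<cdot>\<^bsub>\<A>\<^esub> cdiff U (n + 1) = Zero \<A> (cobj U (n + 1)) M"

text \<open>Spelled like the class of q inside \<open>Yoneda\<close>, so that the two agree by
  unfolding; \<open>coclass_eq\<close> links it to the homology classes of the reversed
  complex.\<close>

definition coclass :: "('o, 'm) precat \<Rightarrow> ('o, 'm) cplx \<Rightarrow> int \<Rightarrow> 'o \<Rightarrow> 'm \<Rightarrow> 'm set" where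
  "coclass \<A> U n M f = coboundaries (Hom_cplx \<A> U M) n #>\<^bsub>hom_group \<A> (cobj U n) M\<^esub> f"

lemma coclass_eq: "coclass \<A> U n M = hclass (rev_Hom \<A> U M) (- n)"
  by (auto simp: coclass_def hclass_def rev_Hom_def coboundaries_eq Hom_cplx_def)

lemma cocycle_hom: "cocycle \<A> U n M f \<Longrightarrow> f \<in> hom_set \<A> (cobj U n) M"
  by (simp add: cocycle_def)

context preadditive_category
begin

lemma group_complex_rev_Hom:
  assumes "chain_complex \<A> U" "M \<in> Obj \<A>"
  shows "group_complex (rev_Hom \<A> U M)"
proof (rule group_complex.intro)
  note U = chain_complexD[OF assms(1)]
  fix n
  show "comm_group (cobj (rev_Hom \<A> U M) n)"
    using assms U by (simp add: comm_group_hom_group)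
  have "(\<lambda>f. f \<cdot> cdiff U (1 - n)) \<in> hom (hom_group \<A> (cobj U (- n)) M) (hom_group \<A> (cobj U (1 - n)) M)"
    using assms(2) by (intro Comp_right_hom U) auto
  then show "cdiff (rev_Hom \<A> U M) n \<in> hom (cobj (rev_Hom \<A> U M) n) (cobj (rev_Hom \<A> U M) (n - 1))"
    by simp
  fix f assume "f \<in> carrier (cobj (rev_Hom \<A> U M) n)"
  then have f: "f \<in> hom_set \<A> (cobj U (- n)) M"
    by simp
  have "(f \<cdot> cdiff U (1 - n)) \<cdot> cdiff U (2 - n) = f \<cdot> (cdiff U (1 - n) \<cdot> cdiff U (2 - n))"
    by (rule Comp_assoc[OF U(2) U(2) f]) simp_all
  also have "\<dots> = f \<cdot> Zero \<A> (cobj U (2 - n)) (cobj U (- n))"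
    using U(3)[of "1 - n" "2 - n"] by simp
  also have "\<dots> = Zero \<A> (cobj U (2 - n)) M"
    by (rule Comp_Zero_right[OF f U(1)])
  finally show "cdiff (rev_Hom \<A> U M) (n - 1) (cdiff (rev_Hom \<A> U M) n f)
      = \<one>\<^bsub>cobj (rev_Hom \<A> U M) (n - 2)\<^esub>"
    by simp
qed

lemma cocycle_iff: "f \<in> cycles (rev_Hom \<A> U M) (- n) \<longleftrightarrow> cocycle \<A> U n M f"
  by (simp add: cycles_def kernel_def cocycle_def add.commute)

lemma carrier_HHom:
  assumes "chain_complex \<A> U" "M \<in> Obj \<A>"
  shows "carrier (FObj (HHom \<A> U n) M) = coclass \<A> U n M ` Collect (cocycle \<A> U n M)"
proof -
  interpret group_complex "rev_Hom \<A> U M"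
    using assms by (rule group_complex_rev_Hom)
  have "cycles (rev_Hom \<A> U M) (- n) = Collect (cocycle \<A> U n M)"
    using cocycle_iff by blast
  then show ?thesis
    using carrier_homology[of "- n"]
    by (simp add: HHom_def cohomology_eq coclass_eq flip: rev_Hom_def)
qed

lemma coclass_mult:
  assumes "chain_complex \<A> U" "f \<in> hom_set \<A> (cobj U n) M" "g \<in> hom_set \<A> (cobj U n) M"
  shows "coclass \<A> U n M f \<otimes>\<^bsub>FObj (HHom \<A> U n) M\<^esub> coclass \<A> U n M g = coclass \<A> U n M (Add \<A> f g)"
proof -
  interpret group_complex "rev_Hom \<A> U M"
    using assms(1) hom_set_Obj(2)[OF assms(2)] by (rule group_complex_rev_Hom)
  show ?thesis
    using assms hclass_mult[of f "- n" g]
    by (simp add: HHom_def cohomology_eq coclass_eq flip: rev_Hom_def)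
qed

lemma cocycle_Add:
  assumes "chain_complex \<A> U" "cocycle \<A> U n M f" "cocycle \<A> U n M g"
  shows "cocycle \<A> U n M (Add \<A> f g)"
proof -
  have d: "cdiff U (n + 1) \<in> hom_set \<A> (cobj U (n + 1)) (cobj U n)"
    by (rule chain_complexD(2)[OF assms(1)]) simp
  have M: "M \<in> Obj \<A>"
    using assms(2) hom_set_Obj by (auto simp: cocycle_def)
  show ?thesis
    using assms Comp_Add_left[OF d, of f M g] Add_in_hom Add_Zero[OF Zero_in_hom]
      chain_complexD[OF assms(1)] M by (simp add: cocycle_def)
qed

lemma cocycle_Comp:
  assumes "chain_complex \<A> U" "cocycle \<A> U n M f" "g \<in> hom_set \<A> M N"
  shows "cocycle \<A> U n N (g \<cdot> f)"
proof -
  note U = chain_complexD[OF assms(1)]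
  have d: "cdiff U (n + 1) \<in> hom_set \<A> (cobj U (n + 1)) (cobj U n)"
    by (rule U(2)) simp
  show ?thesis
    using assms Comp_assoc[OF d, of f M g N] Comp_Zero_right[of g M N] U Comp_in_hom
    by (auto simp: cocycle_def)
qed

lemma cocycle_chain_map:
  assumes "chain_complex \<A> U" "chain_complex \<A> V" "chain_map \<A> U V u" "cocycle \<A> V n M f"
  shows "cocycle \<A> U n M (f \<cdot> u n)"
proof -
  note U = chain_complexD[OF assms(1)] and V = chain_complexD[OF assms(2)]
    and u = chain_mapD[OF assms(3)]
  have f: "f \<in> hom_set \<A> (cobj V n) M" and M: "M \<in> Obj \<A>"
    using assms(4) hom_set_Obj by (auto simp: cocycle_def)
  have "(f \<cdot> u n) \<cdot> cdiff U (n + 1) = f \<cdot> (u n \<cdot> cdiff U (n + 1))"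
    by (rule Comp_assoc[OF U(2) u(1) f]) simp
  also have "\<dots> = f \<cdot> (cdiff V (n + 1) \<cdot> u (n + 1))"
    using u(2)[of "n" "n + 1"] by simp
  also have "\<dots> = (f \<cdot> cdiff V (n + 1)) \<cdot> u (n + 1)"
    by (rule Comp_assoc[OF u(1) V(2) f, symmetric]) simp
  also have "\<dots> = Zero \<A> (cobj U (n + 1)) M"
    using assms(4) Comp_Zero_left[OF u(1) M] by (simp add: cocycle_def)
  finally show ?thesis
    using Comp_in_hom[OF u(1) f] by (simp add: cocycle_def)
qed

lemma group_chain_map_rev_Hom_left:
  assumes "chain_complex \<A> U" "chain_complex \<A> V" "chain_map \<A> U V u" "M \<in> Obj \<A>"
  shows "group_chain_map (rev_Hom \<A> V M) (rev_Hom \<A> U M) (\<lambda>k f. f \<cdot> u (- k))"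
proof -
  note U = chain_complexD[OF assms(1)] and V = chain_complexD[OF assms(2)]
    and u = chain_mapD[OF assms(3)]
  interpret V: group_complex "rev_Hom \<A> V M"
    using assms by (intro group_complex_rev_Hom)
  interpret U: group_complex "rev_Hom \<A> U M"
    using assms by (intro group_complex_rev_Hom)
  show ?thesis
  proof
    fix n
    show "(\<lambda>f. f \<cdot> u (- n)) \<in> hom (cobj (rev_Hom \<A> V M) n) (cobj (rev_Hom \<A> U M) n)"
      using Comp_right_hom[OF u(1) assms(4)] by simp
    fix f assume "f \<in> carrier (cobj (rev_Hom \<A> V M) n)"
    then have f: "f \<in> hom_set \<A> (cobj V (- n)) M"
      by simp
    have "(f \<cdot> u (- n)) \<cdot> cdiff U (1 - n) = f \<cdot> (u (- n) \<cdot> cdiff U (1 - n))"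
      by (rule Comp_assoc[OF U(2) u(1) f]) simp
    also have "\<dots> = f \<cdot> (cdiff V (1 - n) \<cdot> u (1 - n))"
      using u(2)[of "- n" "1 - n"] by simp
    also have "\<dots> = (f \<cdot> cdiff V (1 - n)) \<cdot> u (1 - n)"
      by (rule Comp_assoc[OF u(1) V(2) f, symmetric]) simp
    finally show "cdiff (rev_Hom \<A> U M) n (f \<cdot> u (- n)) = cdiff (rev_Hom \<A> V M) n f \<cdot> u (- (n - 1))"
      by simp
  qed
qed

lemma group_chain_map_rev_Hom_right:
  assumes "chain_complex \<A> U" "g \<in> hom_set \<A> M N"
  shows "group_chain_map (rev_Hom \<A> U M) (rev_Hom \<A> U N) (\<lambda>_ f. g \<cdot> f)"
proof -
  note U = chain_complexD[OF assms(1)] and obj = hom_set_Obj[OF assms(2)]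
  interpret M: group_complex "rev_Hom \<A> U M"
    using assms(1) obj(1) by (rule group_complex_rev_Hom)
  interpret N: group_complex "rev_Hom \<A> U N"
    using assms(1) obj(2) by (rule group_complex_rev_Hom)
  show ?thesis
  proof
    fix n
    show "(\<lambda>f. g \<cdot> f) \<in> hom (cobj (rev_Hom \<A> U M) n) (cobj (rev_Hom \<A> U N) n)"
      using Comp_left_hom[OF assms(2) U(1)] by simp
    fix f assume f: "f \<in> carrier (cobj (rev_Hom \<A> U M) n)"
    show "cdiff (rev_Hom \<A> U N) n (g \<cdot> f) = g \<cdot> cdiff (rev_Hom \<A> U M) n f"
      using f by (simp add: Comp_assoc[OF U(2) _ assms(2)])
  qed
qed

section \<open>Induced maps on classes of cocycles\<close>

lemma HHom_FMap_coclass: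
  assumes "chain_complex \<A> U" "f \<in> hom_set \<A> (cobj U n) M" "g \<in> hom_set \<A> M N"
  shows "FMap (HHom \<A> U n) g (coclass \<A> U n M f) = coclass \<A> U n N (g \<cdot> f)"
proof -
  interpret group_chain_map "rev_Hom \<A> U M" "rev_Hom \<A> U N" "\<lambda>_ f. g \<cdot> f"
    using assms(1,3) by (rule group_chain_map_rev_Hom_right)
  have "Cod \<A> g = N"
    using assms(3) by (simp add: hom_set_iff)
  then show ?thesis
    using homology_map_hclass[of f "- n"] assms(2)
    by (simp add: HHom_def cohomology_map_eq coclass_eq flip: rev_Hom_def)
qed

lemma HHom_map_coclass:
  assumes "chain_complex \<A> U" "chain_complex \<A> V" "chain_map \<A> U V u"
    and "f \<in> hom_set \<A> (cobj V n) M"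
  shows "HHom_map \<A> U u n M (coclass \<A> V n M f) = coclass \<A> U n M (f \<cdot> u n)"
proof -
  interpret group_chain_map "rev_Hom \<A> V M" "rev_Hom \<A> U M" "\<lambda>k f. f \<cdot> u (- k)"
    using assms(1-3) hom_set_Obj(2)[OF assms(4)] by (rule group_chain_map_rev_Hom_left)
  show ?thesis
    using homology_map_hclass[of f "- n"] assms(4)
    by (simp add: HHom_map_def cohomology_map_eq coclass_eq flip: rev_Hom_def)
qed

lemma mem_coclassE:
  assumes "chain_complex \<A> U" "M \<in> Obj \<A>" "f' \<in> coclass \<A> U n M f"
  obtains g where "g \<in> hom_set \<A> (cobj U (n - 1)) M" "f' = Add \<A> (g \<cdot> cdiff U n) f"
proof -
  interpret group_complex "rev_Hom \<A> U M"
    using assms(1,2) by (rule group_complex_rev_Hom)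
  show thesis
    using assms(3) that unfolding coclass_eq mem_hclass_iff by auto
qed

lemma self_mem_coclass:
  assumes "chain_complex \<A> U" "f \<in> hom_set \<A> (cobj U n) M"
  shows "f \<in> coclass \<A> U n M f"
proof -
  interpret group_complex "rev_Hom \<A> U M"
    using assms(1) hom_set_Obj(2)[OF assms(2)] by (rule group_complex_rev_Hom)
  show ?thesis
    using assms self_mem_hclass[of f "- n"] by (simp add: coclass_eq)
qed

text \<open>The projection r has the section j. With \<beta> n as r this gives injectivity of
  Hom(C_n,M) \<rightarrow> Hom(B_n,M).\<close>

lemma is_biproduct_proj_cancel:
  assumes "is_biproduct \<A> X Y P i j p r" "f \<in> hom_set \<A> Y M" "g \<in> hom_set \<A> Y M" "f \<cdot> r = g \<cdot> r"
  shows "f = g"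
proof -
  have r: "r \<in> hom_set \<A> P Y" and j: "j \<in> hom_set \<A> Y P" and rj: "r \<cdot> j = Ident \<A> Y"
    using assms(1) by (auto simp: is_biproduct_def)
  have "(f \<cdot> r) \<cdot> j = f" "(g \<cdot> r) \<cdot> j = g"
    using Comp_assoc[OF j r] Comp_Ident_right rj assms(2,3) by auto
  then show ?thesis
    using assms(4) by metis
qed

end

lemma HHom_comm_group:
  assumes "preadditive_category \<A>" "chain_complex \<A> U" "M \<in> Obj \<A>"
  shows "comm_group (FObj (HHom \<A> U n) M)"
proof -
  interpret group_complex "rev_Hom \<A> U M"
    using assms by (rule preadditive_category.group_complex_rev_Hom)
  show ?thesis
    using comm_group_homology[of "- n"] by (simp add: HHom_def cohomology_eq flip: rev_Hom_def)
qed

lemma (in preadditive_category) coclass_coboundary: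
  assumes "chain_complex \<A> U" "g \<in> hom_set \<A> (cobj U (n - 1)) M"
  shows "coclass \<A> U n M (g \<cdot> cdiff U n) = \<one>\<^bsub>FObj (HHom \<A> U n) M\<^esub>"
proof -
  have M: "M \<in> Obj \<A>"
    using assms(2) by (rule hom_set_Obj)
  interpret group_complex "rev_Hom \<A> U M"
    using assms(1) M by (rule group_complex_rev_Hom)
  have "g \<cdot> cdiff U n \<in> hom_set \<A> (cobj U n) M"
    by (rule Comp_in_hom[OF chain_complexD(2)[OF assms(1)] assms(2)]) simp
  then show ?thesis
    using hclass_eq_one_iff[of "g \<cdot> cdiff U n" "- n"] assms(2)
    by (auto simp: HHom_def cohomology_eq coclass_eq simp flip: rev_Hom_def)
qed

section \<open>The short exact sequence of Hom complexes and its connecting map\<close>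

context abelian_category
begin

text \<open>Hom(-,M) is contravariant, so C takes the left place, with precomposition by \<beta> as
  injection, and A the right place. All three exactness conditions are read off from the biproduct
  equations.\<close>

lemma complex_ses_rev_Hom:
  assumes "termwise_split_ses \<A> A \<alpha> B \<beta> C" "M \<in> Obj \<A>"
  shows "complex_ses (rev_Hom \<A> C M) (rev_Hom \<A> B M) (rev_Hom \<A> A M)
    (\<lambda>k f. f \<cdot> \<beta> (- k)) (\<lambda>k f. f \<cdot> \<alpha> (- k))"
proof -
  have c: "chain_complex \<A> A" "chain_complex \<A> B" "chain_complex \<A> C"
    "chain_map \<A> A B \<alpha>" "chain_map \<A> B C \<beta>"
    using assms(1) by (auto simp: termwise_split_ses_def)
  interpret i: group_chain_map "rev_Hom \<A> C M" "rev_Hom \<A> B M" "\<lambda>k f. f \<cdot> \<beta> (- k)"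
    using c assms(2) by (intro group_chain_map_rev_Hom_left)
  interpret p: group_chain_map "rev_Hom \<A> B M" "rev_Hom \<A> A M" "\<lambda>k f. f \<cdot> \<alpha> (- k)"
    using c assms(2) by (intro group_chain_map_rev_Hom_left)
  show ?thesis
  proof
    fix n
    obtain s r where bp: "is_biproduct \<A> (cobj A (- n)) (cobj C (- n)) (cobj B (- n)) (\<alpha> (- n)) s r (\<beta> (- n))"
      using termwise_split_biproduct[OF assms(1)] by blast
    then have hom: "\<alpha> (- n) \<in> hom_set \<A> (cobj A (- n)) (cobj B (- n))"
      "\<beta> (- n) \<in> hom_set \<A> (cobj B (- n)) (cobj C (- n))"
      "s \<in> hom_set \<A> (cobj C (- n)) (cobj B (- n))"
      "r \<in> hom_set \<A> (cobj B (- n)) (cobj A (- n))"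
      and eqs: "r \<cdot> \<alpha> (- n) = Ident \<A> (cobj A (- n))"
      "\<beta> (- n) \<cdot> \<alpha> (- n) = Zero \<A> (cobj A (- n)) (cobj C (- n))"
      "Add \<A> (\<alpha> (- n) \<cdot> r) (s \<cdot> \<beta> (- n)) = Ident \<A> (cobj B (- n))"
      by (auto simp: is_biproduct_def)
    show "inj_on (\<lambda>f. f \<cdot> \<beta> (- n)) (carrier (cobj (rev_Hom \<A> C M) n))"
      using is_biproduct_proj_cancel[OF bp] by (auto intro!: inj_onI)
    \<comment> \<open>The retraction r extends every f from A_n to B_n, with -n as the index here;
      this is surjectivity of restriction along \<alpha>.\<close>
    have lift: "(f \<cdot> r) \<cdot> \<alpha> (- n) = f" if "f \<in> hom_set \<A> (cobj A (- n)) M" for f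
      using Comp_assoc[OF hom(1,4) that] eqs Comp_Ident_right[OF that] by simp
    show "(\<lambda>f. f \<cdot> \<alpha> (- n)) ` carrier (cobj (rev_Hom \<A> B M) n) = carrier (cobj (rev_Hom \<A> A M) n)"
    proof (intro equalityI subsetI)
      fix f assume "f \<in> carrier (cobj (rev_Hom \<A> A M) n)"
      then have "f \<in> hom_set \<A> (cobj A (- n)) M"
        by simp
      then show "f \<in> (\<lambda>f. f \<cdot> \<alpha> (- n)) ` carrier (cobj (rev_Hom \<A> B M) n)"
        using lift[of f] Comp_in_hom[OF hom(4), of f M] by (intro image_eqI[of _ _ "f \<cdot> r"]) auto
    qed (use Comp_in_hom[OF hom(1)] in auto)
    \<comment> \<open>Composing f with 1 = \<alpha> r + s \<beta> leaves f s \<beta> when f \<alpha>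
      = 0, so f s is the preimage of f.\<close>
    have ext: "f = (f \<cdot> s) \<cdot> \<beta> (- n)"
      if f: "f \<in> hom_set \<A> (cobj B (- n)) M" "f \<cdot> \<alpha> (- n) = Zero \<A> (cobj A (- n)) M" for f
    proof -
      have "f = f \<cdot> Add \<A> (\<alpha> (- n) \<cdot> r) (s \<cdot> \<beta> (- n))"
        using eqs(3) Comp_Ident_right[OF f(1)] by simp
      also have "\<dots> = Add \<A> (f \<cdot> \<alpha> (- n) \<cdot> r) (f \<cdot> s \<cdot> \<beta> (- n))"
        by (rule Comp_Add_right[OF Comp_in_hom[OF hom(4,1)] Comp_in_hom[OF hom(2,3)] f(1)])
      also have "f \<cdot> \<alpha> (- n) \<cdot> r = Zero \<A> (cobj B (- n)) M"
        using Comp_assoc[OF hom(4,1) f(1)] f(2) Comp_Zero_left[OF hom(4) assms(2)] by simp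
      also have "f \<cdot> s \<cdot> \<beta> (- n) = (f \<cdot> s) \<cdot> \<beta> (- n)"
        using Comp_assoc[OF hom(2,3) f(1)] by simp
      finally show ?thesis
        using Add_Zero(2) Comp_in_hom[OF hom(2) Comp_in_hom[OF hom(3) f(1)]] by simp
    qed
    have zero: "(g \<cdot> \<beta> (- n)) \<cdot> \<alpha> (- n) = Zero \<A> (cobj A (- n)) M"
      if "g \<in> hom_set \<A> (cobj C (- n)) M" for g
      using Comp_assoc[OF hom(1,2) that] eqs Comp_Zero_right[OF that] hom_set_Obj[OF hom(1)] by simp
    show "kernel (cobj (rev_Hom \<A> B M) n) (cobj (rev_Hom \<A> A M) n) (\<lambda>f. f \<cdot> \<alpha> (- n))
        = (\<lambda>f. f \<cdot> \<beta> (- n)) ` carrier (cobj (rev_Hom \<A> C M) n)"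
    proof (intro equalityI subsetI)
      fix f assume "f \<in> kernel (cobj (rev_Hom \<A> B M) n) (cobj (rev_Hom \<A> A M) n) (\<lambda>f. f \<cdot> \<alpha> (- n))"
      then have "f \<in> hom_set \<A> (cobj B (- n)) M" "f \<cdot> \<alpha> (- n) = Zero \<A> (cobj A (- n)) M"
        by (auto simp: kernel_def)
      then show "f \<in> (\<lambda>f. f \<cdot> \<beta> (- n)) ` carrier (cobj (rev_Hom \<A> C M) n)"
        using ext[of f] Comp_in_hom[OF hom(3), of f M] by (intro image_eqI[of _ _ "f \<cdot> s"]) auto
    next
      fix f assume "f \<in> (\<lambda>f. f \<cdot> \<beta> (- n)) ` carrier (cobj (rev_Hom \<A> C M) n)"
      then obtain g where "g \<in> hom_set \<A> (cobj C (- n)) M" "f = g \<cdot> \<beta> (- n)"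
        by auto
      then show "f \<in> kernel (cobj (rev_Hom \<A> B M) n) (cobj (rev_Hom \<A> A M) n) (\<lambda>f. f \<cdot> \<alpha> (- n))"
        using zero[of g] Comp_in_hom[OF hom(2), of g M] by (auto simp: kernel_def)
    qed
  qed
qed

text \<open>This is \<open>connecting_hclass\<close> in reversed degree \<open>1 - n\<close>, with
  the pair y = h and x = g: the condition i x = d y reads g \<beta> = h d.\<close>

lemma delta_coclass:
  assumes "termwise_split_ses \<A> A \<alpha> B \<beta> C"
    and "h \<in> hom_set \<A> (cobj B (n - 1)) M" "g \<in> hom_set \<A> (cobj C n) M"
    and "g \<cdot> \<beta> n = h \<cdot> cdiff B n"
  shows "delta \<A> \<alpha> B \<beta> C n M (coclass \<A> A (n - 1) M (h \<cdot> \<alpha> (n - 1))) = coclass \<A> C n M g"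
proof -
  interpret complex_ses "rev_Hom \<A> C M" "rev_Hom \<A> B M" "rev_Hom \<A> A M"
    "\<lambda>k f. f \<cdot> \<beta> (- k)" "\<lambda>k f. f \<cdot> \<alpha> (- k)"
    using complex_ses_rev_Hom[OF assms(1) hom_set_Obj(2)[OF assms(2)]] .
  show ?thesis
    using connecting_hclass[of h "1 - n" g] assms(2-)
    by (simp add: delta_def cohomology_connecting_eq coclass_eq flip: rev_Hom_def)
qed

text \<open>Supplies the h and g that \<open>delta_coclass\<close> asks for. That g is a cocycle is
  the second part of \<open>snake\<close> in the reversed complexes.\<close>

lemma delta_lift:
  assumes "termwise_split_ses \<A> A \<alpha> B \<beta> C" "cocycle \<A> A (n - 1) M f"
  obtains h g where "h \<in> hom_set \<A> (cobj B (n - 1)) M" "h \<cdot> \<alpha> (n - 1) = f"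
    "cocycle \<A> C n M g" "g \<cdot> \<beta> n = h \<cdot> cdiff B n"
proof -
  have M: "M \<in> Obj \<A>"
    using assms(2) hom_set_Obj by (auto simp: cocycle_def)
  interpret complex_ses "rev_Hom \<A> C M" "rev_Hom \<A> B M" "rev_Hom \<A> A M"
    "\<lambda>k f. f \<cdot> \<beta> (- k)" "\<lambda>k f. f \<cdot> \<alpha> (- k)"
    using complex_ses_rev_Hom[OF assms(1) M] .
  have "f \<in> cycles (rev_Hom \<A> A M) (1 - n)"
    using assms(2) cocycle_iff[of f A M "n - 1"] by simp
  then obtain h g where hg: "h \<in> hom_set \<A> (cobj B (n - 1)) M" "g \<in> hom_set \<A> (cobj C n) M"
      "g \<cdot> \<beta> n = h \<cdot> cdiff B n" "h \<cdot> \<alpha> (n - 1) = f"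
    by (elim snake_exists) auto
  moreover have "cocycle \<A> C n M g"
    using snake(2)[of h "1 - n" g] hg cocycle_iff[of g C M n] by simp
  ultimately show thesis
    using that by blast
qed

end

section \<open>Additive and right exact functors\<close>

locale additive_fun = preadditive_category \<A>
  for \<A> :: "('o, 'm) precat" (structure) and T :: "('o, 'm, 'b) ab_fun" +
  assumes additive: "additive_functor \<A> T"
begin

lemma FObj_comm_group: "X \<in> Obj \<A> \<Longrightarrow> comm_group (FObj T X)"
  using additive by (simp add: additive_functor_def ab_functor_def)

lemma FMap_hom: "f \<in> hom_set \<A> X Y \<Longrightarrow> FMap T f \<in> hom (FObj T X) (FObj T Y)"
  using additive by (auto simp: additive_functor_def ab_functor_def hom_set_iff)

lemma FMap_closed:
  "f \<in> hom_set \<A> X Y \<Longrightarrow> x \<in> carrier (FObj T X) \<Longrightarrow> FMap T f x \<in> carrier (FObj T Y)"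
  using FMap_hom by (auto simp: hom_def)

lemma FMap_mult:
  "\<lbrakk>f \<in> hom_set \<A> X Y; x \<in> carrier (FObj T X); y \<in> carrier (FObj T X)\<rbrakk> \<Longrightarrow>
     FMap T f (x \<otimes>\<^bsub>FObj T X\<^esub> y) = FMap T f x \<otimes>\<^bsub>FObj T Y\<^esub> FMap T f y"
  using FMap_hom by (auto simp: hom_def)

lemma FMap_one: "f \<in> hom_set \<A> X Y \<Longrightarrow> FMap T f \<one>\<^bsub>FObj T X\<^esub> = \<one>\<^bsub>FObj T Y\<^esub>"
  using hom_one[OF FMap_hom] FObj_comm_group hom_set_Obj by (auto simp: comm_group_def)

lemma FMap_Ident: "X \<in> Obj \<A> \<Longrightarrow> x \<in> carrier (FObj T X) \<Longrightarrow> FMap T (Ident \<A> X) x = x"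
  using additive by (simp add: additive_functor_def ab_functor_def)

lemma FMap_Comp:
  "\<lbrakk>f \<in> hom_set \<A> X Y; g \<in> hom_set \<A> Y Z; x \<in> carrier (FObj T X)\<rbrakk> \<Longrightarrow>
     FMap T (g \<cdot> f) x = FMap T g (FMap T f x)"
  using additive by (auto simp: additive_functor_def ab_functor_def hom_set_iff)

lemma FMap_Add:
  "\<lbrakk>f \<in> hom_set \<A> X Y; g \<in> hom_set \<A> X Y; x \<in> carrier (FObj T X)\<rbrakk> \<Longrightarrow>
     FMap T (Add \<A> f g) x = FMap T f x \<otimes>\<^bsub>FObj T Y\<^esub> FMap T g x"
  using additive by (auto simp: additive_functor_def)

lemma FMap_Zero:
  assumes "X \<in> Obj \<A>" "Y \<in> Obj \<A>" "x \<in> carrier (FObj T X)"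
  shows "FMap T (Zero \<A> X Y) x = \<one>\<^bsub>FObj T Y\<^esub>"
proof -
  interpret Y: comm_group "FObj T Y"
    using assms(2) by (rule FObj_comm_group)
  have z: "Zero \<A> X Y \<in> hom_set \<A> X Y"
    using assms by (intro Zero_in_hom)
  \<comment> \<open>Additivity of T at 0 + 0 = 0 makes the value an idempotent of a group.\<close>
  then have "FMap T (Zero \<A> X Y) x \<otimes>\<^bsub>FObj T Y\<^esub> FMap T (Zero \<A> X Y) x = FMap T (Zero \<A> X Y) x"
    using FMap_Add[OF z z assms(3)] Add_Zero[OF z] by simp
  then show ?thesis
    using FMap_closed[OF z assms(3)] by simp
qed

lemma cobj_app [simp]: "cobj (app_cplx T U) n = FObj T (cobj U n)"
  and cdiff_app [simp]: "cdiff (app_cplx T U) n = FMap T (cdiff U n)"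
  by (simp_all add: app_cplx_def)

lemma group_complex_app:
  assumes "chain_complex \<A> U" shows "group_complex (app_cplx T U)"
proof (rule group_complex.intro)
  note U = chain_complexD[OF assms]
  fix n
  show "comm_group (cobj (app_cplx T U) n)"
    using U by (simp add: FObj_comm_group)
  show "cdiff (app_cplx T U) n \<in> hom (cobj (app_cplx T U) n) (cobj (app_cplx T U) (n - 1))"
    using FMap_hom[OF U(2)] by simp
  fix x assume x: "x \<in> carrier (cobj (app_cplx T U) n)"
  have "FMap T (cdiff U (n - 1)) (FMap T (cdiff U n) x) = FMap T (cdiff U (n - 1) \<cdot> cdiff U n) x"
    by (rule FMap_Comp[OF U(2) U(2), symmetric]) (use x in simp_all)
  also have "\<dots> = \<one>\<^bsub>FObj T (cobj U (n - 2))\<^esub>"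
    using U(3)[of "n - 1" n] FMap_Zero[OF U(1) U(1)] x by simp
  finally show "cdiff (app_cplx T U) (n - 1) (cdiff (app_cplx T U) n x)
      = \<one>\<^bsub>cobj (app_cplx T U) (n - 2)\<^esub>"
    by simp
qed

lemma group_chain_map_app:
  assumes "chain_complex \<A> U" "chain_complex \<A> V" "chain_map \<A> U V u"
  shows "group_chain_map (app_cplx T U) (app_cplx T V) (\<lambda>n. FMap T (u n))"
proof -
  note U = chain_complexD[OF assms(1)] and V = chain_complexD[OF assms(2)]
    and u = chain_mapD[OF assms(3)]
  interpret U: group_complex "app_cplx T U"
    using assms(1) by (rule group_complex_app)
  interpret V: group_complex "app_cplx T V"
    using assms(2) by (rule group_complex_app)
  show ?thesis
  proof
    fix n
    show "FMap T (u n) \<in> hom (cobj (app_cplx T U) n) (cobj (app_cplx T V) n)"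
      using FMap_hom[OF u(1)] by simp
    fix x assume x: "x \<in> carrier (cobj (app_cplx T U) n)"
    show "cdiff (app_cplx T V) n (FMap T (u n) x) = FMap T (u (n - 1)) (cdiff (app_cplx T U) n x)"
      using FMap_Comp[OF u(1) V(2), of "n - 1" n x] FMap_Comp[OF U(2) u(1), of "n - 1" n x]
        u(2)[of "n - 1" n] x by simp
  qed
qed

end

section \<open>Right exact functors\<close>

locale right_exact_fun = abelian_category \<A>
  for \<A> :: "('o, 'm) precat" (structure) and T :: "('o, 'm, 'b) ab_fun" +
  assumes right_exact: "right_exact_functor \<A> T"
begin

sublocale additive_fun
  using right_exact by unfold_locales (simp add: right_exact_functor_def)

text \<open>The point where right exactness is used beyond additivity. Surjectivity of T q will give
  a lift z of the value at [q], and the kernel of T q will decide when two lifts have the same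
  class.\<close>

lemma FMap_cokernel:
  assumes "is_cokernel \<A> f q"
  shows "kernel (FObj T (Dom \<A> q)) (FObj T (Cod \<A> q)) (FMap T q)
      = FMap T f ` carrier (FObj T (Dom \<A> f))"
    and "FMap T q ` carrier (FObj T (Dom \<A> q)) = carrier (FObj T (Cod \<A> q))"
  using right_exact cokernel_exact_at[OF assms] by (auto simp: right_exact_functor_def)

text \<open>T preserves the biproduct equations: T r retracts T \<alpha>, T s is a section of T
  \<beta>, and 1 = \<alpha> r + s \<beta> moves the kernel of T \<beta> into the image of T
  \<alpha>.\<close>

lemma complex_ses_app:
  assumes "termwise_split_ses \<A> A \<alpha> B \<beta> C"
  shows "complex_ses (app_cplx T A) (app_cplx T B) (app_cplx T C)
    (\<lambda>n. FMap T (\<alpha> n)) (\<lambda>n. FMap T (\<beta> n))"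
proof -
  have c: "chain_complex \<A> A" "chain_complex \<A> B" "chain_complex \<A> C"
    "chain_map \<A> A B \<alpha>" "chain_map \<A> B C \<beta>"
    using assms(1) by (auto simp: termwise_split_ses_def)
  interpret i: group_chain_map "app_cplx T A" "app_cplx T B" "\<lambda>n. FMap T (\<alpha> n)"
    using c by (intro group_chain_map_app)
  interpret p: group_chain_map "app_cplx T B" "app_cplx T C" "\<lambda>n. FMap T (\<beta> n)"
    using c by (intro group_chain_map_app)
  show ?thesis
  proof
    fix n
    obtain s r where bp: "is_biproduct \<A> (cobj A n) (cobj C n) (cobj B n) (\<alpha> n) s r (\<beta> n)"
      using termwise_split_biproduct[OF assms] by blast
    then have hom: "\<alpha> n \<in> hom_set \<A> (cobj A n) (cobj B n)"
      "\<beta> n \<in> hom_set \<A> (cobj B n) (cobj C n)"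
      "s \<in> hom_set \<A> (cobj C n) (cobj B n)"
      "r \<in> hom_set \<A> (cobj B n) (cobj A n)"
      and eqs: "r \<cdot> \<alpha> n = Ident \<A> (cobj A n)" "\<beta> n \<cdot> s = Ident \<A> (cobj C n)"
      "\<beta> n \<cdot> \<alpha> n = Zero \<A> (cobj A n) (cobj C n)"
      "Add \<A> (\<alpha> n \<cdot> r) (s \<cdot> \<beta> n) = Ident \<A> (cobj B n)"
      by (auto simp: is_biproduct_def)
    note obj = hom_set_Obj[OF hom(1)] hom_set_Obj[OF hom(2)]
    interpret TB: comm_group "FObj T (cobj B n)"
      using obj by (intro FObj_comm_group)
    have r: "FMap T r (FMap T (\<alpha> n) x) = x" if "x \<in> carrier (FObj T (cobj A n))" for x
      using FMap_Comp[OF hom(1,4) that] eqs FMap_Ident obj that by simp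
    then show "inj_on (FMap T (\<alpha> n)) (carrier (cobj (app_cplx T A) n))"
      by (intro inj_on_inverseI) simp
    have s: "FMap T (\<beta> n) (FMap T s z) = z" if "z \<in> carrier (FObj T (cobj C n))" for z
      using FMap_Comp[OF hom(3,2) that] eqs FMap_Ident obj that by simp
    show "FMap T (\<beta> n) ` carrier (cobj (app_cplx T B) n) = carrier (cobj (app_cplx T C) n)"
    proof (intro equalityI subsetI)
      fix z assume "z \<in> carrier (cobj (app_cplx T C) n)"
      then have "z \<in> carrier (FObj T (cobj C n))"
        by simp
      then show "z \<in> FMap T (\<beta> n) ` carrier (cobj (app_cplx T B) n)"
        using s FMap_closed[OF hom(3)] by (intro image_eqI[of _ _ "FMap T s z"]) auto
    qed (use FMap_closed[OF hom(2)] in auto)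
    show "kernel (cobj (app_cplx T B) n) (cobj (app_cplx T C) n) (FMap T (\<beta> n))
        = FMap T (\<alpha> n) ` carrier (cobj (app_cplx T A) n)"
    proof (intro equalityI subsetI)
      fix y assume "y \<in> kernel (cobj (app_cplx T B) n) (cobj (app_cplx T C) n) (FMap T (\<beta> n))"
      then have y: "y \<in> carrier (FObj T (cobj B n))" "FMap T (\<beta> n) y = \<one>\<^bsub>FObj T (cobj C n)\<^esub>"
        by (auto simp: kernel_def)
      have "y = FMap T (Add \<A> (\<alpha> n \<cdot> r) (s \<cdot> \<beta> n)) y"
        using eqs(4) FMap_Ident obj y by simp
      also have "\<dots> = FMap T (\<alpha> n \<cdot> r) y \<otimes>\<^bsub>FObj T (cobj B n)\<^esub> FMap T (s \<cdot> \<beta> n) y"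
        by (rule FMap_Add[OF Comp_in_hom[OF hom(4,1)] Comp_in_hom[OF hom(2,3)] y(1)])
      also have "\<dots> = FMap T (\<alpha> n) (FMap T r y)"
        using FMap_Comp[OF hom(4,1) y(1)] FMap_Comp[OF hom(2,3) y(1)] y(2) FMap_one[OF hom(3)]
          FMap_closed[OF hom(1) FMap_closed[OF hom(4) y(1)]] by simp
      finally show "y \<in> FMap T (\<alpha> n) ` carrier (cobj (app_cplx T A) n)"
        using FMap_closed[OF hom(4) y(1)] by (intro image_eqI) auto
    next
      fix y assume "y \<in> FMap T (\<alpha> n) ` carrier (cobj (app_cplx T A) n)"
      then obtain x where x: "x \<in> carrier (FObj T (cobj A n))" "y = FMap T (\<alpha> n) x"
        by auto
      then show "y \<in> kernel (cobj (app_cplx T B) n) (cobj (app_cplx T C) n) (FMap T (\<beta> n))"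
        using FMap_closed[OF hom(1)] FMap_Comp[OF hom(1,2), of x] eqs(3) FMap_Zero obj
        by (auto simp: kernel_def)
    qed
  qed
qed

end

lemma group_chain_map_nat_trans:
  assumes "additive_fun \<A> T" "additive_fun \<A> T'" "\<theta> \<in> nat_trans \<A> T T'" "chain_complex \<A> U"
  shows "group_chain_map (app_cplx T U) (app_cplx T' U) (\<lambda>n. \<theta> (cobj U n))"
proof -
  interpret T: additive_fun \<A> T by fact
  interpret T': additive_fun \<A> T' by fact
  note U = T.chain_complexD[OF assms(4)]
  interpret TU: group_complex "app_cplx T U"
    using assms(4) by (rule T.group_complex_app)
  interpret T'U: group_complex "app_cplx T' U"
    using assms(4) by (rule T'.group_complex_app)
  show ?thesis
  proof
    fix n
    show "\<theta> (cobj U n) \<in> hom (cobj (app_cplx T U) n) (cobj (app_cplx T' U) n)"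
      using assms(3) U by (auto simp: nat_trans_def)
    fix x assume "x \<in> carrier (cobj (app_cplx T U) n)"
    then show "cdiff (app_cplx T' U) n (\<theta> (cobj U n) x) = \<theta> (cobj U (n - 1)) (cdiff (app_cplx T U) n x)"
      using assms(3) U(2)[of "n - 1" n] by (auto simp: nat_trans_def hom_set_iff)
  qed
qed

section \<open>Natural transformations out of \<open>H\<^sup>n Hom(U,-)\<close>\<close>

text \<open>
  The transformation \<open>[f] \<mapsto> T f z\<close>. The images \<open>T f z\<close> of the representatives \<open>f\<close> of one class coincide
  if \<open>z\<close> is a cycle; otherwise \<^const>\<open>the_elem\<close> may return a junk value.
\<close>

definition eval_nat ::
    "('o, 'm) precat \<Rightarrow> ('o, 'm, 'b) ab_fun \<Rightarrow> ('o, 'm) cplx \<Rightarrow> int \<Rightarrow> 'b \<Rightarrow> 'o \<Rightarrow> 'm set \<Rightarrow> 'b" where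
  "eval_nat \<A> T U n z = (\<lambda>M \<in> Obj \<A>. \<lambda>S \<in> carrier (FObj (HHom \<A> U n) M).
     the_elem ((\<lambda>f. FMap T f z) ` S))"

text \<open>As much of \<open>nat_trans\<close> as comparing families as functions requires.
  Composites built by \<open>nat_comp\<close> have this property by their form, before anything is
  known about their naturality.\<close>

definition extensional_family :: "('o, 'm) precat \<Rightarrow> ('o, 'm, 'x) ab_fun \<Rightarrow> ('o \<Rightarrow> 'x \<Rightarrow> 'y) \<Rightarrow> bool" where
  "extensional_family \<A> F \<tau> \<longleftrightarrow> \<tau> \<in> extensional (Obj \<A>) \<and>
     (\<forall>M \<in> Obj \<A>. \<tau> M \<in> extensional (carrier (FObj F M)))"

lemma extensional_family_nat_trans: "\<tau> \<in> nat_trans \<A> F G \<Longrightarrow> extensional_family \<A> F \<tau>"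
  by (simp add: nat_trans_def extensional_family_def)

lemma extensional_family_restrict:
  "extensional_family \<A> F (\<lambda>M \<in> Obj \<A>. \<lambda>x \<in> carrier (FObj F M). t M x)"
  by (simp add: extensional_family_def)

text \<open>Every element of H^n Hom(U,M) is the class of a cocycle, so agreement on these classes
  and the common value \<open>undefined\<close> elsewhere suffice.\<close>

lemma (in preadditive_category) HHom_family_eqI:
  assumes "chain_complex \<A> U"
    and "extensional_family \<A> (HHom \<A> U n) \<sigma>" "extensional_family \<A> (HHom \<A> U n) \<tau>"
    and "\<And>M f. cocycle \<A> U n M f \<Longrightarrow> \<sigma> M (coclass \<A> U n M f) = \<tau> M (coclass \<A> U n M f)"
  shows "\<sigma> = \<tau>"
proof (rule extensionalityI)
  show "\<sigma> \<in> extensional (Obj \<A>)" "\<tau> \<in> extensional (Obj \<A>)"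
    using assms(2,3) by (auto simp: extensional_family_def)
  fix M assume M: "M \<in> Obj \<A>"
  show "\<sigma> M = \<tau> M"
  proof (rule extensionalityI)
    show "\<sigma> M \<in> extensional (carrier (FObj (HHom \<A> U n) M))"
      "\<tau> M \<in> extensional (carrier (FObj (HHom \<A> U n) M))"
      using assms(2,3) M by (auto simp: extensional_family_def)
  qed (use assms(4) carrier_HHom[OF assms(1) M] in auto)
qed

context additive_fun
begin

lemma app_cycle_iff:
  "z \<in> cycles (app_cplx T U) n \<longleftrightarrow>
     z \<in> carrier (FObj T (cobj U n)) \<and> FMap T (cdiff U n) z = \<one>\<^bsub>FObj T (cobj U (n - 1))\<^esub>"
  by (simp add: cycles_def kernel_def)

text \<open>Another representative has the form g d + f, and T (g d) z = T g (T d z) is trivial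
  because z is a cycle.\<close>

lemma eval_nat_coclass:
  assumes "chain_complex \<A> U" "z \<in> cycles (app_cplx T U) n" "cocycle \<A> U n M f"
  shows "eval_nat \<A> T U n z M (coclass \<A> U n M f) = FMap T f z"
proof -
  note U = chain_complexD[OF assms(1)]
  have f: "f \<in> hom_set \<A> (cobj U n) M"
    using assms(3) by (rule cocycle_hom)
  then have M: "M \<in> Obj \<A>"
    by (rule hom_set_Obj)
  interpret TM: comm_group "FObj T M"
    using M by (rule FObj_comm_group)
  have z: "z \<in> carrier (FObj T (cobj U n))" "FMap T (cdiff U n) z = \<one>\<^bsub>FObj T (cobj U (n - 1))\<^esub>"
    using assms(2) by (auto simp: app_cycle_iff)
  have "FMap T f' z = FMap T f z" if f': "f' \<in> coclass \<A> U n M f" for f'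
  proof -
    obtain g where g: "g \<in> hom_set \<A> (cobj U (n - 1)) M" "f' = Add \<A> (g \<cdot> cdiff U n) f"
      using mem_coclassE[OF assms(1) M f'] .
    have d: "cdiff U n \<in> hom_set \<A> (cobj U n) (cobj U (n - 1))"
      by (rule U(2)) simp
    show ?thesis
      using FMap_Add[OF Comp_in_hom[OF d g(1)] f z(1)] FMap_Comp[OF d g(1) z(1)] z(2) g(2)
        FMap_one[OF g(1)] FMap_closed[OF f z(1)] by simp
  qed
  then have "(\<lambda>f. FMap T f z) ` coclass \<A> U n M f = {FMap T f z}"
    using self_mem_coclass[OF assms(1) f] by blast
  then show ?thesis
    using M assms carrier_HHom[OF assms(1) M] by (simp add: eval_nat_def)
qed

text \<open>Additivity of the components is additivity of T on arrows, and naturality is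
  functoriality of T.\<close>

lemma eval_nat_in_nat_trans:
  assumes "chain_complex \<A> U" "z \<in> cycles (app_cplx T U) n"
  shows "eval_nat \<A> T U n z \<in> nat_trans \<A> (HHom \<A> U n) T"
  unfolding nat_trans_def
proof (intro CollectI conjI ballI)
  note ev = eval_nat_coclass[OF assms]
  have z: "z \<in> carrier (FObj T (cobj U n))"
    using assms(2) by (simp add: app_cycle_iff)
  show "eval_nat \<A> T U n z \<in> extensional (Obj \<A>)"
    by (simp add: eval_nat_def)
  fix M assume M: "M \<in> Obj \<A>"
  then show "eval_nat \<A> T U n z M \<in> extensional (carrier (FObj (HHom \<A> U n) M))"
    by (simp add: eval_nat_def)
  show "eval_nat \<A> T U n z M \<in> hom (FObj (HHom \<A> U n) M) (FObj T M)"
  proof (rule homI)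
    fix S assume "S \<in> carrier (FObj (HHom \<A> U n) M)"
    then show "eval_nat \<A> T U n z M S \<in> carrier (FObj T M)"
      using carrier_HHom[OF assms(1) M] ev FMap_closed[OF cocycle_hom z] by auto
  next
    fix S S' assume "S \<in> carrier (FObj (HHom \<A> U n) M)" "S' \<in> carrier (FObj (HHom \<A> U n) M)"
    then obtain f g where fg: "cocycle \<A> U n M f" "S = coclass \<A> U n M f"
        "cocycle \<A> U n M g" "S' = coclass \<A> U n M g"
      using carrier_HHom[OF assms(1) M] by auto
    then show "eval_nat \<A> T U n z M (S \<otimes>\<^bsub>FObj (HHom \<A> U n) M\<^esub> S')
        = eval_nat \<A> T U n z M S \<otimes>\<^bsub>FObj T M\<^esub> eval_nat \<A> T U n z M S'"
      using coclass_mult[OF assms(1) cocycle_hom cocycle_hom] cocycle_Add[OF assms(1)] ev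
        FMap_Add[OF cocycle_hom cocycle_hom z] by simp
  qed
next
  note ev = eval_nat_coclass[OF assms]
  have z: "z \<in> carrier (FObj T (cobj U n))"
    using assms(2) by (simp add: app_cycle_iff)
  fix g S assume g: "g \<in> Arr \<A>" and "S \<in> carrier (FObj (HHom \<A> U n) (Dom \<A> g))"
  then have gh: "g \<in> hom_set \<A> (Dom \<A> g) (Cod \<A> g)" and obj: "Dom \<A> g \<in> Obj \<A>"
    by (auto simp: hom_set_iff Dom_in_Obj)
  obtain f where f: "cocycle \<A> U n (Dom \<A> g) f" "S = coclass \<A> U n (Dom \<A> g) f"
    using \<open>S \<in> _\<close> carrier_HHom[OF assms(1) obj] by auto
  show "eval_nat \<A> T U n z (Cod \<A> g) (FMap (HHom \<A> U n) g S)
      = FMap T g (eval_nat \<A> T U n z (Dom \<A> g) S)"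
    using f ev HHom_FMap_coclass[OF assms(1) cocycle_hom[OF f(1)] gh]
      cocycle_Comp[OF assms(1) f(1) gh] FMap_Comp[OF cocycle_hom[OF f(1)] gh z] by simp
qed

end

section \<open>Identities between evaluation transformations\<close>

context additive_fun
begin

lemma nat_trans_coclass:
  assumes "chain_complex \<A> U" "\<tau> \<in> nat_trans \<A> (HHom \<A> U n) T" "cocycle \<A> U n M f"
    "g \<in> hom_set \<A> M N"
  shows "\<tau> N (coclass \<A> U n N (g \<cdot> f)) = FMap T g (\<tau> M (coclass \<A> U n M f))"
proof -
  have g: "g \<in> Arr \<A>" "Dom \<A> g = M" "Cod \<A> g = N"
    using assms(4) by (auto simp: hom_set_iff)
  have "coclass \<A> U n M f \<in> carrier (FObj (HHom \<A> U n) M)"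
    using carrier_HHom[OF assms(1) hom_set_Obj(1)[OF assms(4)]] assms(3) by simp
  then have "\<tau> N (FMap (HHom \<A> U n) g (coclass \<A> U n M f)) = FMap T g (\<tau> M (coclass \<A> U n M f))"
    using assms(2) g unfolding nat_trans_def by blast
  then show ?thesis
    using HHom_FMap_coclass[OF assms(1) cocycle_hom[OF assms(3)] assms(4)] by simp
qed

text \<open>The principle behind all squares: a family with the values T f z on classes is
  \<open>eval_nat\<close> of z, and is thereby also natural. Composites with pullbacks and with
  \<open>delta\<close> are recognised as natural transformations in this way.\<close>

lemma eval_nat_eqI:
  assumes "chain_complex \<A> U" "z \<in> cycles (app_cplx T U) n"
    and "extensional_family \<A> (HHom \<A> U n) \<tau>"
    and "\<And>M f. cocycle \<A> U n M f \<Longrightarrow> \<tau> M (coclass \<A> U n M f) = FMap T f z"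
  shows "\<tau> = eval_nat \<A> T U n z"
  using assms(4) eval_nat_coclass[OF assms(1,2)]
    extensional_family_nat_trans[OF eval_nat_in_nat_trans[OF assms(1,2)]]
  by (intro HHom_family_eqI[OF assms(1,3)]) auto

lemma coclass_in_HHom:
  assumes "chain_complex \<A> U" "cocycle \<A> U n M f"
  shows "M \<in> Obj \<A>" "coclass \<A> U n M f \<in> carrier (FObj (HHom \<A> U n) M)"
proof -
  show "M \<in> Obj \<A>"
    using hom_set_Obj(2)[OF cocycle_hom[OF assms(2)]] .
  then show "coclass \<A> U n M f \<in> carrier (FObj (HHom \<A> U n) M)"
    using carrier_HHom[OF assms(1)] assms(2) by simp
qed

text \<open>Pullback along u sends [f] to [f u], and T (f u) z = T f (T u z).\<close>

lemma nat_comp_eval_HHom_map: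
  assumes "chain_complex \<A> U" "chain_complex \<A> V" "chain_map \<A> U V u"
    and z: "z \<in> cycles (app_cplx T U) n"
  shows "nat_comp \<A> (HHom \<A> V n) (eval_nat \<A> T U n z) (HHom_map \<A> U u n)
    = eval_nat \<A> T V n (FMap T (u n) z)"
proof (rule eval_nat_eqI[OF assms(2)])
  interpret u: group_chain_map "app_cplx T U" "app_cplx T V" "\<lambda>n. FMap T (u n)"
    using assms(1-3) by (rule group_chain_map_app)
  show "FMap T (u n) z \<in> cycles (app_cplx T V) n"
    using u.map_cycle[OF z] .
  show "extensional_family \<A> (HHom \<A> V n)
      (nat_comp \<A> (HHom \<A> V n) (eval_nat \<A> T U n z) (HHom_map \<A> U u n))"
    unfolding nat_comp_def by (rule extensional_family_restrict)
  fix M f assume f: "cocycle \<A> V n M f"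
  have "nat_comp \<A> (HHom \<A> V n) (eval_nat \<A> T U n z) (HHom_map \<A> U u n) M (coclass \<A> V n M f)
      = eval_nat \<A> T U n z M (coclass \<A> U n M (f \<cdot> u n))"
    using coclass_in_HHom[OF assms(2) f] HHom_map_coclass[OF assms(1-3) cocycle_hom[OF f]]
    by (simp add: nat_comp_def)
  also have "\<dots> = FMap T (f \<cdot> u n) z"
    using eval_nat_coclass[OF assms(1) z cocycle_chain_map[OF assms(1-3) f]] .
  also have "\<dots> = FMap T f (FMap T (u n) z)"
    using FMap_Comp[OF chain_mapD(1)[OF assms(3)] cocycle_hom[OF f]] z by (simp add: app_cycle_iff)
  finally show "nat_comp \<A> (HHom \<A> V n) (eval_nat \<A> T U n z) (HHom_map \<A> U u n) M (coclass \<A> V n M f)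
      = FMap T f (FMap T (u n) z)" .
qed

lemma eval_nat_mult:
  assumes "chain_complex \<A> U" "z \<in> cycles (app_cplx T U) n" "z' \<in> cycles (app_cplx T U) n"
  shows "eval_nat \<A> T U n z \<otimes>\<^bsub>Nat_group \<A> (HHom \<A> U n) T\<^esub> eval_nat \<A> T U n z'
    = eval_nat \<A> T U n (z \<otimes>\<^bsub>FObj T (cobj U n)\<^esub> z')"
proof (rule eval_nat_eqI[OF assms(1)])
  interpret TU: group_complex "app_cplx T U"
    using assms(1) by (rule group_complex_app)
  show "z \<otimes>\<^bsub>FObj T (cobj U n)\<^esub> z' \<in> cycles (app_cplx T U) n"
    using subgroup.m_closed[OF TU.subgroup_cycles assms(2,3)] by simp
  show "extensional_family \<A> (HHom \<A> U n)
      (eval_nat \<A> T U n z \<otimes>\<^bsub>Nat_group \<A> (HHom \<A> U n) T\<^esub> eval_nat \<A> T U n z')"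
    by (simp add: Nat_group_def extensional_family_restrict)
  fix M f assume f: "cocycle \<A> U n M f"
  then show "(eval_nat \<A> T U n z \<otimes>\<^bsub>Nat_group \<A> (HHom \<A> U n) T\<^esub> eval_nat \<A> T U n z') M
      (coclass \<A> U n M f) = FMap T f (z \<otimes>\<^bsub>FObj T (cobj U n)\<^esub> z')"
    using coclass_in_HHom[OF assms(1) f] eval_nat_coclass[OF assms(1,2) f]
      eval_nat_coclass[OF assms(1,3) f] FMap_mult[OF cocycle_hom[OF f]] assms(2,3)
    by (simp add: Nat_group_def app_cycle_iff)
qed

lemma eval_nat_one:
  assumes "chain_complex \<A> U"
  shows "\<one>\<^bsub>Nat_group \<A> (HHom \<A> U n) T\<^esub> = eval_nat \<A> T U n \<one>\<^bsub>FObj T (cobj U n)\<^esub>"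
proof (rule eval_nat_eqI[OF assms(1)])
  interpret TU: group_complex "app_cplx T U"
    using assms(1) by (rule group_complex_app)
  show "\<one>\<^bsub>FObj T (cobj U n)\<^esub> \<in> cycles (app_cplx T U) n"
    using subgroup.one_closed[OF TU.subgroup_cycles] by simp
  show "extensional_family \<A> (HHom \<A> U n) \<one>\<^bsub>Nat_group \<A> (HHom \<A> U n) T\<^esub>"
    by (simp add: Nat_group_def extensional_family_restrict)
  fix M f assume f: "cocycle \<A> U n M f"
  then show "\<one>\<^bsub>Nat_group \<A> (HHom \<A> U n) T\<^esub> M (coclass \<A> U n M f)
      = FMap T f \<one>\<^bsub>FObj T (cobj U n)\<^esub>"
    using coclass_in_HHom[OF assms(1) f] FMap_one[OF cocycle_hom[OF f]] by (simp add: Nat_group_def)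
qed

text \<open>The counterpart of \<open>eval_nat_coclass\<close>: there the cycle z absorbs
  coboundaries, here the cocycle f absorbs boundaries, since T f (T d w) = T (f d) w and f d =
  0.\<close>

lemma eval_nat_cong:
  assumes "chain_complex \<A> U" "z \<in> cycles (app_cplx T U) n" "z' \<in> cycles (app_cplx T U) n"
    and "hclass (app_cplx T U) n z = hclass (app_cplx T U) n z'"
  shows "eval_nat \<A> T U n z = eval_nat \<A> T U n z'"
proof (rule eval_nat_eqI[OF assms(1,3)])
  interpret TU: group_complex "app_cplx T U"
    using assms(1) by (rule group_complex_app)
  show "extensional_family \<A> (HHom \<A> U n) (eval_nat \<A> T U n z)"
    using extensional_family_nat_trans[OF eval_nat_in_nat_trans[OF assms(1,2)]] .
  fix M f assume f: "cocycle \<A> U n M f"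
  note fh = cocycle_hom[OF f]
  interpret TM: comm_group "FObj T M"
    using coclass_in_HHom[OF assms(1) f] by (intro FObj_comm_group)
  have z: "z \<in> carrier (FObj T (cobj U n))" "z' \<in> carrier (FObj T (cobj U n))"
    using assms(2,3) by (auto simp: app_cycle_iff)
  obtain w where w: "w \<in> carrier (FObj T (cobj U (n + 1)))"
      "z = FMap T (cdiff U (n + 1)) w \<otimes>\<^bsub>FObj T (cobj U n)\<^esub> z'"
    using assms(4) TU.hclass_eq_iff[of z n z'] z by auto
  have d: "cdiff U (n + 1) \<in> hom_set \<A> (cobj U (n + 1)) (cobj U n)"
    by (rule chain_complexD(2)[OF assms(1)]) simp
  have "FMap T f (FMap T (cdiff U (n + 1)) w) = FMap T (Zero \<A> (cobj U (n + 1)) M) w"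
    using FMap_Comp[OF d fh w(1)] f by (simp add: cocycle_def)
  then have "FMap T f z = FMap T f z'"
    using w(2) FMap_mult[OF fh FMap_closed[OF d w(1)] z(2)] FMap_Zero[OF _ _ w(1)] hom_set_Obj[OF fh]
      hom_set_Obj[OF d] FMap_closed[OF fh z(2)] by simp
  then show "eval_nat \<A> T U n z M (coclass \<A> U n M f) = FMap T f z'"
    using eval_nat_coclass[OF assms(1,2) f] by simp
qed

end

text \<open>This is naturality of \<theta> at the cocycle f, taken as an arrow U_n \<rightarrow>
  M.\<close>

lemma nat_comp_eval_nat:
  assumes "additive_fun \<A> T" "additive_fun \<A> T'" "\<theta> \<in> nat_trans \<A> T T'" "chain_complex \<A> U"
    and z: "z \<in> cycles (app_cplx T U) n"
  shows "nat_comp \<A> (HHom \<A> U n) \<theta> (eval_nat \<A> T U n z) = eval_nat \<A> T' U n (\<theta> (cobj U n) z)"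
proof -
  interpret T: additive_fun \<A> T by fact
  interpret T': additive_fun \<A> T' by fact
  interpret \<theta>: group_chain_map "app_cplx T U" "app_cplx T' U" "\<lambda>n. \<theta> (cobj U n)"
    using assms(1-4) by (rule group_chain_map_nat_trans)
  show ?thesis
  proof (rule T'.eval_nat_eqI[OF assms(4)])
    show "\<theta> (cobj U n) z \<in> cycles (app_cplx T' U) n"
      using \<theta>.map_cycle[OF z] .
    show "extensional_family \<A> (HHom \<A> U n) (nat_comp \<A> (HHom \<A> U n) \<theta> (eval_nat \<A> T U n z))"
      unfolding nat_comp_def by (rule extensional_family_restrict)
    fix M f assume f: "cocycle \<A> U n M f"
    then have "f \<in> Arr \<A>" "Dom \<A> f = cobj U n" "Cod \<A> f = M"
      by (auto simp: cocycle_def hom_set_iff)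
    then have "\<theta> M (FMap T f z) = FMap T' f (\<theta> (cobj U n) z)"
      using assms(3) z by (auto simp: nat_trans_def T.app_cycle_iff)
    then show "nat_comp \<A> (HHom \<A> U n) \<theta> (eval_nat \<A> T U n z) M (coclass \<A> U n M f)
        = FMap T' f (\<theta> (cobj U n) z)"
      using T.coclass_in_HHom[OF assms(4) f] T.eval_nat_coclass[OF assms(4) z f]
      by (simp add: nat_comp_def)
  qed
qed

context right_exact_fun
begin

text \<open>The pair (y, x) is fixed, while h and g are chosen anew for each cocycle f; hence a
  single x represents the composite at all objects M.\<close>

lemma nat_comp_eval_delta:
  assumes "termwise_split_ses \<A> A \<alpha> B \<beta> C"
    and y: "y \<in> carrier (FObj T (cobj B n))" and x: "x \<in> carrier (FObj T (cobj A (n - 1)))"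
    and xy: "FMap T (\<alpha> (n - 1)) x = FMap T (cdiff B n) y"
  shows "nat_comp \<A> (HHom \<A> A (n - 1)) (eval_nat \<A> T C n (FMap T (\<beta> n) y)) (delta \<A> \<alpha> B \<beta> C n)
    = eval_nat \<A> T A (n - 1) x"
proof -
  have c: "chain_complex \<A> A" "chain_complex \<A> B" "chain_complex \<A> C"
    "chain_map \<A> A B \<alpha>" "chain_map \<A> B C \<beta>"
    using assms(1) by (auto simp: termwise_split_ses_def)
  interpret S: complex_ses "app_cplx T A" "app_cplx T B" "app_cplx T C"
      "\<lambda>n. FMap T (\<alpha> n)" "\<lambda>n. FMap T (\<beta> n)"
    using assms(1) by (rule complex_ses_app)
  have cyc: "FMap T (\<beta> n) y \<in> cycles (app_cplx T C) n" "x \<in> cycles (app_cplx T A) (n - 1)"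
    using S.snake[of y n x] assms by auto
  show ?thesis
  proof (rule eval_nat_eqI[OF c(1) cyc(2)])
    show "extensional_family \<A> (HHom \<A> A (n - 1)) (nat_comp \<A> (HHom \<A> A (n - 1))
        (eval_nat \<A> T C n (FMap T (\<beta> n) y)) (delta \<A> \<alpha> B \<beta> C n))"
      unfolding nat_comp_def by (rule extensional_family_restrict)
    fix M f assume f: "cocycle \<A> A (n - 1) M f"
    obtain h g where hg: "h \<in> hom_set \<A> (cobj B (n - 1)) M" "h \<cdot> \<alpha> (n - 1) = f"
        "cocycle \<A> C n M g" "g \<cdot> \<beta> n = h \<cdot> cdiff B n"
      using delta_lift[OF assms(1) f] .
    have d: "cdiff B n \<in> hom_set \<A> (cobj B n) (cobj B (n - 1))"
      by (rule chain_complexD(2)[OF c(2)]) simp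
    have "nat_comp \<A> (HHom \<A> A (n - 1)) (eval_nat \<A> T C n (FMap T (\<beta> n) y)) (delta \<A> \<alpha> B \<beta> C n) M
        (coclass \<A> A (n - 1) M f) = FMap T g (FMap T (\<beta> n) y)"
      using coclass_in_HHom[OF c(1) f] delta_coclass[OF assms(1) hg(1) cocycle_hom[OF hg(3)] hg(4)]
        hg(2) eval_nat_coclass[OF c(3) cyc(1) hg(3)]
      by (simp add: nat_comp_def)
    also have "\<dots> = FMap T (g \<cdot> \<beta> n) y"
      using FMap_Comp[OF chain_mapD(1)[OF c(5)] cocycle_hom[OF hg(3)] y] by simp
    also have "\<dots> = FMap T h (FMap T (\<alpha> (n - 1)) x)"
      unfolding hg(4) xy by (rule FMap_Comp[OF d hg(1) y])
    also have "\<dots> = FMap T f x"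
      using FMap_Comp[OF chain_mapD(1)[OF c(4)] hg(1) x] hg(2) by simp
    finally show "nat_comp \<A> (HHom \<A> A (n - 1)) (eval_nat \<A> T C n (FMap T (\<beta> n) y))
        (delta \<A> \<alpha> B \<beta> C n) M (coclass \<A> A (n - 1) M f) = FMap T f x" .
  qed
qed

section \<open>From a transformation back to a cycle\<close>

lemma cokernel_cocycle:
  assumes "chain_complex \<A> U" "is_cokernel \<A> (cdiff U (n + 1)) q"
  shows "cocycle \<A> U n (Cod \<A> q) q"
    and "cocycle \<A> U n M f \<Longrightarrow> \<exists>h \<in> hom_set \<A> (Cod \<A> q) M. f = h \<cdot> q"
proof -
  have d: "cdiff U (n + 1) \<in> hom_set \<A> (cobj U (n + 1)) (cobj U n)"
    by (rule chain_complexD(2)[OF assms(1)]) simp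
  then show "cocycle \<A> U n (Cod \<A> q) q"
    using assms(2) by (auto simp: is_cokernel_def cocycle_def hom_set_iff)
  assume "cocycle \<A> U n M f"
  then show "\<exists>h \<in> hom_set \<A> (Cod \<A> q) M. f = h \<cdot> q"
    using is_cokernel_factor[OF assms(2) d] unfolding cocycle_def by blast
qed

text \<open>The two halves of the isomorphism Coker(T d_(n+1)) \<cong> TQ, written without quotient
  groups.\<close>

lemma FMap_cokernel_cdiff:
  assumes "chain_complex \<A> U" "is_cokernel \<A> (cdiff U (n + 1)) q"
  shows "kernel (FObj T (cobj U n)) (FObj T (Cod \<A> q)) (FMap T q) = boundaries (app_cplx T U) n"
    and "FMap T q ` carrier (FObj T (cobj U n)) = carrier (FObj T (Cod \<A> q))"
proof -
  have "cdiff U (n + 1) \<in> hom_set \<A> (cobj U (n + 1)) (cobj U n)"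
    by (rule chain_complexD(2)[OF assms(1)]) simp
  then have "Dom \<A> (cdiff U (n + 1)) = cobj U (n + 1)" "Dom \<A> q = cobj U n"
    using assms(2) by (auto simp: hom_set_iff is_cokernel_def)
  then show "kernel (FObj T (cobj U n)) (FObj T (Cod \<A> q)) (FMap T q) = boundaries (app_cplx T U) n"
    "FMap T q ` carrier (FObj T (cobj U n)) = carrier (FObj T (Cod \<A> q))"
    using FMap_cokernel[OF assms(2)] by (auto simp: boundaries_def)
qed

lemma nat_trans_eq_eval:
  assumes "chain_complex \<A> U" "\<tau> \<in> nat_trans \<A> (HHom \<A> U n) T"
  obtains z where "z \<in> cycles (app_cplx T U) n" "\<tau> = eval_nat \<A> T U n z"
proof -
  note U = chain_complexD[OF assms(1)]
  have d: "cdiff U (n + 1) \<in> hom_set \<A> (cobj U (n + 1)) (cobj U n)"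
      "cdiff U n \<in> hom_set \<A> (cobj U n) (cobj U (n - 1))"
    by (rule U(2); simp)+
  obtain q where q: "is_cokernel \<A> (cdiff U (n + 1)) q"
    using cokernels d(1) by (auto simp: hom_set_iff)
  define Q where "Q = Cod \<A> q"
  have qc: "cocycle \<A> U n Q q"
    using cokernel_cocycle(1)[OF assms(1) q] by (simp add: Q_def)
  note qQ = coclass_in_HHom[OF assms(1) qc] and qh = cocycle_hom[OF qc]
  have "\<tau> Q (coclass \<A> U n Q q) \<in> carrier (FObj T Q)"
    using assms(2) qQ by (auto simp: nat_trans_def hom_def)
  then obtain z where z: "z \<in> carrier (FObj T (cobj U n))" "FMap T q z = \<tau> Q (coclass \<A> U n Q q)"
    using FMap_cokernel_cdiff(2)[OF assms(1) q] unfolding Q_def by (metis imageE)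
  have \<tau>: "\<tau> M (coclass \<A> U n M f) = FMap T f z" if f: "cocycle \<A> U n M f" for M f
  proof -
    obtain h where h: "h \<in> hom_set \<A> Q M" "f = h \<cdot> q"
      using cokernel_cocycle(2)[OF assms(1) q f] by (auto simp: Q_def)
    then show ?thesis
      using nat_trans_coclass[OF assms qc h(1)] z(2) FMap_Comp[OF qh h(1) z(1)] by simp
  qed
  have dc: "cocycle \<A> U n (cobj U (n - 1)) (cdiff U n)"
    using d U(3)[of n "n + 1"] by (simp add: cocycle_def)
  have "\<tau> (cobj U (n - 1)) (coclass \<A> U n (cobj U (n - 1)) (cdiff U n)) = \<one>\<^bsub>FObj T (cobj U (n - 1))\<^esub>"
  proof -
    \<comment> \<open>The differential d_n is the coboundary of the identity of U_(n-1).\<close>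
    have "coclass \<A> U n (cobj U (n - 1)) (cdiff U n) = \<one>\<^bsub>FObj (HHom \<A> U n) (cobj U (n - 1))\<^esub>"
      using coclass_coboundary[OF assms(1) Ident_in_hom[OF U(1)], of n] Comp_Ident_left[OF d(2)] by simp
    moreover have "\<tau> (cobj U (n - 1)) \<in> hom (FObj (HHom \<A> U n) (cobj U (n - 1))) (FObj T (cobj U (n - 1)))"
      using assms(2) U(1) by (auto simp: nat_trans_def)
    ultimately show ?thesis
      using hom_one HHom_comm_group[OF preadditive_category_axioms assms(1) U(1)]
        FObj_comm_group[OF U(1)] by (metis comm_group_def)
  qed
  then have "z \<in> cycles (app_cplx T U) n"
    using \<tau>[OF dc] z by (simp add: app_cycle_iff)
  moreover from this have "\<tau> = eval_nat \<A> T U n z"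
    using \<tau> extensional_family_nat_trans[OF assms(2)] by (intro eval_nat_eqI[OF assms(1)])
  ultimately show thesis
    using that by blast
qed

text \<open>The value of \<open>eval_nat\<close> at [q] is T q z, and the comparison map also sends
  the class of z to T q z. This map is injective, so \<open>inv_into\<close> returns exactly that
  class.\<close>

lemma Yoneda_eval_nat:
  assumes "cokernel_choice \<A> \<kappa>" "chain_complex \<A> U" and z: "z \<in> cycles (app_cplx T U) n"
  shows "Yoneda \<A> \<kappa> T U n (eval_nat \<A> T U n z) = hclass (app_cplx T U) n z"
proof -
  interpret TU: group_complex "app_cplx T U"
    using assms(2) by (rule group_complex_app)
  define q where "q = \<kappa> (cdiff U (n + 1))"
  define Q where "Q = Cod \<A> q"
  have d: "cdiff U (n + 1) \<in> hom_set \<A> (cobj U (n + 1)) (cobj U n)"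
    by (rule chain_complexD(2)[OF assms(2)]) simp
  have q: "is_cokernel \<A> (cdiff U (n + 1)) q"
    using assms(1) d by (simp add: q_def cokernel_choice_def hom_set_iff)
  have qc: "cocycle \<A> U n Q q"
    using cokernel_cocycle(1)[OF assms(2) q] by (simp add: Q_def)
  note qh = cocycle_hom[OF qc]
  interpret Tq: group_hom "FObj T (cobj U n)" "FObj T Q" "FMap T q"
    using FMap_hom[OF qh] FObj_comm_group hom_set_Obj[OF qh]
    by (simp add: group_hom_def group_hom_axioms_def comm_group_def)
  \<comment> \<open>One direction makes the comparison map well defined on cosets, the other makes
    it injective. It is proved for all elements of T U_n, since \<open>inv_into\<close> searches the
    whole cokernel.\<close>
  have eq_iff: "FMap T q x = FMap T q y \<longleftrightarrow> hclass (app_cplx T U) n x = hclass (app_cplx T U) n y"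
    if x: "x \<in> carrier (FObj T (cobj U n))" and y: "y \<in> carrier (FObj T (cobj U n))" for x y
  proof -
    let ?u = "x \<otimes>\<^bsub>FObj T (cobj U n)\<^esub> inv\<^bsub>FObj T (cobj U n)\<^esub> y"
    have "FMap T q x = FMap T q y \<longleftrightarrow> FMap T q x \<otimes>\<^bsub>FObj T Q\<^esub> inv\<^bsub>FObj T Q\<^esub> FMap T q y = \<one>\<^bsub>FObj T Q\<^esub>"
      using x y by (subst Tq.H.inv_solve_right') auto
    also have "\<dots> \<longleftrightarrow> ?u \<in> boundaries (app_cplx T U) n"
      unfolding FMap_cokernel_cdiff(1)[OF assms(2) q, symmetric] using x y
      by (simp add: kernel_def Q_def[symmetric])
    also have "\<dots> \<longleftrightarrow> (\<exists>w \<in> carrier (FObj T (cobj U (n + 1))).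
        x = FMap T (cdiff U (n + 1)) w \<otimes>\<^bsub>FObj T (cobj U n)\<^esub> y)"
      unfolding TU.boundaries_iff using x y FMap_closed[OF d]
      by (intro bex_cong) (auto simp: Tq.G.inv_solve_right')
    also have "\<dots> \<longleftrightarrow> hclass (app_cplx T U) n x = hclass (app_cplx T U) n y"
      using x y by (simp add: TU.hclass_eq_iff)
    finally show ?thesis .
  qed
  have comparison: "Coker_comparison \<kappa> T U n (hclass (app_cplx T U) n x) = FMap T q x"
    if x: "x \<in> carrier (FObj T (cobj U n))" for x
  proof -
    have "FMap T q y = FMap T q x" if "y \<in> hclass (app_cplx T U) n x" for y
    proof -
      have y: "y \<in> carrier (FObj T (cobj U n))"
        using that x TU.mem_hclass_iff[of y n x] FMap_closed[OF d] by auto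
      have "hclass (app_cplx T U) n y = hclass (app_cplx T U) n x"
        using that x y TU.mem_hclass_iff[of y n x] TU.hclass_eq_iff[of y n x] by simp
      then show ?thesis
        using eq_iff x y by simp
    qed
    moreover have "x \<in> hclass (app_cplx T U) n x"
      using x by (simp add: TU.self_mem_hclass)
    ultimately have "FMap T q ` hclass (app_cplx T U) n x = {FMap T q x}"
      by blast
    then show ?thesis
      by (simp add: Coker_comparison_def q_def)
  qed
  have carr: "carrier (FObj T (cobj U n) Mod boundaries (app_cplx T U) n)
      = hclass (app_cplx T U) n ` carrier (FObj T (cobj U n))"
    by (auto simp: carrier_FactGroup hclass_def)
  have zc: "z \<in> carrier (FObj T (cobj U n))"
    using z by (simp add: app_cycle_iff)
  have "inj_on (Coker_comparison \<kappa> T U n) (carrier (FObj T (cobj U n) Mod boundaries (app_cplx T U) n))"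
    unfolding carr by (auto intro!: inj_onI simp: comparison eq_iff)
  then have "inv_into (carrier (FObj T (cobj U n) Mod boundaries (app_cplx T U) n))
      (Coker_comparison \<kappa> T U n) (FMap T q z) = hclass (app_cplx T U) n z"
    using comparison[OF zc] by (metis carr imageI inv_into_f_f zc)
  moreover have "coboundaries (Hom_cplx \<A> U Q) n #>\<^bsub>hom_group \<A> (cobj U n) Q\<^esub> q = coclass \<A> U n Q q"
    by (simp add: coclass_def)
  ultimately show ?thesis
    using eval_nat_coclass[OF assms(2) z qc] by (simp add: Yoneda_def Let_def q_def Q_def)
qed

end

section \<open>Transport of exactness and naturality along isomorphisms\<close>

text \<open>Applied with \<open>Nat_group\<close> as G: associativity, commutativity and inverses
  are inherited from homology through the bijection instead of being checked on components.\<close>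

lemma comm_group_transport:
  assumes "comm_group H" and \<phi>: "bij_betw \<phi> (carrier G) (carrier H)"
    and closed: "\<And>x y. x \<in> carrier G \<Longrightarrow> y \<in> carrier G \<Longrightarrow> x \<otimes>\<^bsub>G\<^esub> y \<in> carrier G"
    and mult: "\<And>x y. x \<in> carrier G \<Longrightarrow> y \<in> carrier G \<Longrightarrow> \<phi> (x \<otimes>\<^bsub>G\<^esub> y) = \<phi> x \<otimes>\<^bsub>H\<^esub> \<phi> y"
    and one: "\<one>\<^bsub>G\<^esub> \<in> carrier G" "\<phi> \<one>\<^bsub>G\<^esub> = \<one>\<^bsub>H\<^esub>"
  shows "comm_group G"
proof (rule comm_groupI)
  interpret H: comm_group H by fact
  note eqI = inj_onD[OF bij_betw_imp_inj_on[OF \<phi>]] and in_H = bij_betwE[OF \<phi>, rule_format]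
  show "x \<otimes>\<^bsub>G\<^esub> y \<otimes>\<^bsub>G\<^esub> z = x \<otimes>\<^bsub>G\<^esub> (y \<otimes>\<^bsub>G\<^esub> z)"
    if "x \<in> carrier G" "y \<in> carrier G" "z \<in> carrier G" for x y z
    by (rule eqI) (use that in \<open>simp_all add: closed mult in_H H.m_assoc\<close>)
  show "x \<otimes>\<^bsub>G\<^esub> y = y \<otimes>\<^bsub>G\<^esub> x" if "x \<in> carrier G" "y \<in> carrier G" for x y
    by (rule eqI) (use that in \<open>simp_all add: closed mult in_H H.m_comm\<close>)
  show "\<one>\<^bsub>G\<^esub> \<otimes>\<^bsub>G\<^esub> x = x" if "x \<in> carrier G" for x
    by (rule eqI) (use that one in \<open>simp_all add: closed mult in_H\<close>)
  show "\<exists>y \<in> carrier G. y \<otimes>\<^bsub>G\<^esub> x = \<one>\<^bsub>G\<^esub>" if x: "x \<in> carrier G" for x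
  proof -
    have "inv\<^bsub>H\<^esub> \<phi> x \<in> \<phi> ` carrier G"
      using in_H[OF x] bij_betw_imp_surj_on[OF \<phi>] by simp
    then obtain y where y: "y \<in> carrier G" "\<phi> y = inv\<^bsub>H\<^esub> \<phi> x"
      by (metis imageE)
    then have "\<phi> (y \<otimes>\<^bsub>G\<^esub> x) = \<phi> \<one>\<^bsub>G\<^esub>"
      using x in_H[OF x] one by (simp add: mult)
    then have "y \<otimes>\<^bsub>G\<^esub> x = \<one>\<^bsub>G\<^esub>"
      using y x one closed by (intro eqI) auto
    then show ?thesis
      using y by blast
  qed
qed (use closed one in auto)

lemma iso_inj: "\<phi> \<in> iso G H \<Longrightarrow> x \<in> carrier G \<Longrightarrow> y \<in> carrier G \<Longrightarrow> \<phi> x = \<phi> y \<Longrightarrow> x = y"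
  by (auto simp: iso_def bij_betw_def dest: inj_onD)

lemma iso_in_carrier: "\<phi> \<in> iso G H \<Longrightarrow> x \<in> carrier G \<Longrightarrow> \<phi> x \<in> carrier H"
  by (auto simp: iso_def hom_def)

lemma iso_mult:
  "\<phi> \<in> iso G H \<Longrightarrow> x \<in> carrier G \<Longrightarrow> y \<in> carrier G \<Longrightarrow> \<phi> (x \<otimes>\<^bsub>G\<^esub> y) = \<phi> x \<otimes>\<^bsub>H\<^esub> \<phi> y"
  by (auto simp: iso_def hom_def)

lemma hom_transport:
  assumes "group G" "group H" "\<phi> \<in> iso G G'" "\<psi> \<in> iso H H'" "f' \<in> hom G' H'"
    and closed: "\<And>x. x \<in> carrier G \<Longrightarrow> f x \<in> carrier H"
    and sq: "\<And>x. x \<in> carrier G \<Longrightarrow> \<psi> (f x) = f' (\<phi> x)"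
  shows "f \<in> hom G H"
proof (rule homI)
  interpret G: group G by fact
  interpret H: group H by fact
  fix x y assume xy: "x \<in> carrier G" "y \<in> carrier G"
  have "\<psi> (f (x \<otimes>\<^bsub>G\<^esub> y)) = \<psi> (f x \<otimes>\<^bsub>H\<^esub> f y)"
    using xy assms(5) by (simp add: sq iso_mult[OF assms(3)] iso_mult[OF assms(4)] closed hom_mult
        iso_in_carrier[OF assms(3)])
  then show "f (x \<otimes>\<^bsub>G\<^esub> y) = f x \<otimes>\<^bsub>H\<^esub> f y"
    by (rule iso_inj[OF assms(4), rotated 2]) (use xy in \<open>simp_all add: closed\<close>)
qed (rule closed)

text \<open>Membership in kernel and image is tested after applying \<psi>. The kernel uses
  injectivity of \<chi>, the image surjectivity of \<phi> and injectivity of \<psi>.\<close>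

lemma exact_transport:
  assumes "group F" "group G" "group H" "group H'"
    and iso: "\<phi> \<in> iso F F'" "\<psi> \<in> iso G G'" "\<chi> \<in> iso H H'"
    and closed: "\<And>x. x \<in> carrier F \<Longrightarrow> g x \<in> carrier G" "\<And>y. y \<in> carrier G \<Longrightarrow> h y \<in> carrier H"
    and sq: "\<And>x. x \<in> carrier F \<Longrightarrow> \<psi> (g x) = g' (\<phi> x)" "\<And>y. y \<in> carrier G \<Longrightarrow> \<chi> (h y) = h' (\<psi> y)"
    and exact: "kernel G' H' h' = g' ` carrier F'"
  shows "kernel G H h = g ` carrier F"
proof -
  have \<phi>: "\<phi> ` carrier F = carrier F'"
    using iso(1) by (simp add: iso_def bij_betw_def)
  have \<chi>: "\<chi> \<one>\<^bsub>H\<^esub> = \<one>\<^bsub>H'\<^esub>"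
    using iso(3) assms(3,4) by (auto simp: iso_def hom_one)
  have one: "\<one>\<^bsub>H\<^esub> \<in> carrier H"
    using assms(3) by (simp add: group.is_monoid monoid.one_closed)
  have "y \<in> kernel G H h \<longleftrightarrow> \<psi> y \<in> kernel G' H' h'" if y: "y \<in> carrier G" for y
  proof -
    have "h y = \<one>\<^bsub>H\<^esub> \<longleftrightarrow> h' (\<psi> y) = \<one>\<^bsub>H'\<^esub>"
      using iso_inj[OF iso(3) closed(2)[OF y] one] sq(2)[OF y] \<chi> by metis
    then show ?thesis
      using y iso_in_carrier[OF iso(2)] by (simp add: kernel_def)
  qed
  moreover have "\<psi> y \<in> g' ` carrier F' \<longleftrightarrow> y \<in> g ` carrier F" if y: "y \<in> carrier G" for y
  proof
    assume "\<psi> y \<in> g' ` carrier F'"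
    then obtain x where "x \<in> carrier F" "\<psi> y = \<psi> (g x)"
      unfolding \<phi>[symmetric] using sq(1) by auto
    then show "y \<in> g ` carrier F"
      using iso_inj[OF iso(2) y] closed(1) by blast
  next
    assume "y \<in> g ` carrier F"
    then show "\<psi> y \<in> g' ` carrier F'"
      using sq(1) unfolding \<phi>[symmetric] by auto
  qed
  moreover have "kernel G H h \<subseteq> carrier G" "g ` carrier F \<subseteq> carrier G"
    using closed(1) by (auto simp: kernel_def)
  ultimately show ?thesis
    unfolding exact by blast
qed

text \<open>The input that the transport of exactness asks of the source sequence itself; homomorphy
  of its maps and exactness are then deduced from the target.\<close>

definition closed_seq :: "'x long_seq \<Rightarrow> bool" where
  "closed_seq S \<longleftrightarrow> (\<forall>n. comm_group (grpA S n) \<and> comm_group (grpB S n) \<and> comm_group (grpC S n) \<and>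
     (\<forall>x \<in> carrier (grpA S n). mapAB S n x \<in> carrier (grpB S n)) \<and>
     (\<forall>x \<in> carrier (grpB S n). mapBC S n x \<in> carrier (grpC S n)) \<and>
     (\<forall>x \<in> carrier (grpC S n). conn S n x \<in> carrier (grpA S (n - 1))))"

definition closed_ladder :: "'x long_seq \<Rightarrow> 'y long_seq \<Rightarrow> ('x, 'y) ladder \<Rightarrow> bool" where
  "closed_ladder S S' \<phi> \<longleftrightarrow> (\<forall>n.
     (\<forall>x \<in> carrier (grpA S n). onA \<phi> n x \<in> carrier (grpA S' n)) \<and>
     (\<forall>x \<in> carrier (grpB S n). onB \<phi> n x \<in> carrier (grpB S' n)) \<and>
     (\<forall>x \<in> carrier (grpC S n). onC \<phi> n x \<in> carrier (grpC S' n)))"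

lemma long_exactD:
  assumes "long_exact S"
  shows "comm_group (grpA S n)" "comm_group (grpB S n)" "comm_group (grpC S n)"
    and "mapAB S n \<in> hom (grpA S n) (grpB S n)" "mapBC S n \<in> hom (grpB S n) (grpC S n)"
    and "conn S n \<in> hom (grpC S n) (grpA S (n - 1))"
    and "kernel (grpC S n) (grpA S (n - 1)) (conn S n) = mapBC S n ` carrier (grpB S n)"
    and "kernel (grpB S n) (grpC S n) (mapBC S n) = mapAB S n ` carrier (grpA S n)"
    and "kernel (grpA S n) (grpB S n) (mapAB S n) = conn S (n + 1) ` carrier (grpC S (n + 1))"
  using assms by (auto simp: long_exact_def)

lemma long_exact_closed_seq: "long_exact S \<Longrightarrow> closed_seq S"
  by (simp add: closed_seq_def long_exactD(1-3) hom_in_carrier[OF long_exactD(4)]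
      hom_in_carrier[OF long_exactD(5)] hom_in_carrier[OF long_exactD(6)])

lemma long_exact_transport:
  assumes S: "closed_seq S" and S': "long_exact S'" and \<phi>: "ladder_iso S S' \<phi>"
  shows "long_exact S"
proof -
  have grp: "group (grpA S n)" "group (grpB S n)" "group (grpC S n)"
    "group (grpA S' n)" "group (grpB S' n)" "group (grpC S' n)" for n
    using S long_exactD(1-3)[OF S'] by (auto simp: closed_seq_def comm_group_def)
  have closed: "\<And>n x. x \<in> carrier (grpA S n) \<Longrightarrow> mapAB S n x \<in> carrier (grpB S n)"
    "\<And>n x. x \<in> carrier (grpB S n) \<Longrightarrow> mapBC S n x \<in> carrier (grpC S n)"
    "\<And>n x. x \<in> carrier (grpC S n) \<Longrightarrow> conn S n x \<in> carrier (grpA S (n - 1))"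
    using S by (auto simp: closed_seq_def)
  have iso: "onA \<phi> n \<in> iso (grpA S n) (grpA S' n)" "onB \<phi> n \<in> iso (grpB S n) (grpB S' n)"
    "onC \<phi> n \<in> iso (grpC S n) (grpC S' n)" for n
    using \<phi> by (auto simp: ladder_iso_def)
  have sq: "\<And>n x. x \<in> carrier (grpA S n) \<Longrightarrow> onB \<phi> n (mapAB S n x) = mapAB S' n (onA \<phi> n x)"
    "\<And>n x. x \<in> carrier (grpB S n) \<Longrightarrow> onC \<phi> n (mapBC S n x) = mapBC S' n (onB \<phi> n x)"
    "\<And>n x. x \<in> carrier (grpC S n) \<Longrightarrow> onA \<phi> (n - 1) (conn S n x) = conn S' n (onC \<phi> n x)"
    using \<phi> by (auto simp: ladder_iso_def ladder_morphism_def)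
  \<comment> \<open>Index shift: the map out of degree n + 1 lands in degree n + 1 - 1, which has to
    be written as n to match exactness at \<open>grpA S n\<close>.\<close>
  have conn: "\<And>n x. x \<in> carrier (grpC S (n + 1)) \<Longrightarrow> conn S (n + 1) x \<in> carrier (grpA S n)"
    "\<And>n x. x \<in> carrier (grpC S (n + 1)) \<Longrightarrow> onA \<phi> n (conn S (n + 1) x) = conn S' (n + 1) (onC \<phi> (n + 1) x)"
    using closed(3)[of _ "n + 1" for n] sq(3)[of _ "n + 1" for n] by auto
  have homs: "mapAB S n \<in> hom (grpA S n) (grpB S n)" "mapBC S n \<in> hom (grpB S n) (grpC S n)"
    "conn S n \<in> hom (grpC S n) (grpA S (n - 1))" for n
    by (rule hom_transport[OF _ _ iso(1,2) long_exactD(4)[OF S'] closed(1) sq(1)]; simp add: grp)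
      (rule hom_transport[OF _ _ iso(2,3) long_exactD(5)[OF S'] closed(2) sq(2)]
        hom_transport[OF _ _ iso(3,1) long_exactD(6)[OF S'] closed(3) sq(3)]; simp add: grp)+
  have ex: "kernel (grpC S n) (grpA S (n - 1)) (conn S n) = mapBC S n ` carrier (grpB S n)"
    "kernel (grpB S n) (grpC S n) (mapBC S n) = mapAB S n ` carrier (grpA S n)"
    "kernel (grpA S n) (grpB S n) (mapAB S n) = conn S (n + 1) ` carrier (grpC S (n + 1))" for n
    by (rule exact_transport[OF grp(2) grp(3) grp(1) grp(4) iso(2) iso(3) iso(1) closed(2,3) sq(2,3)
          long_exactD(7)[OF S']]
        exact_transport[OF grp(1) grp(2) grp(3) grp(6) iso closed(1,2) sq(1,2) long_exactD(8)[OF S']]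
        exact_transport[OF grp(3) grp(1) grp(2) grp(5) iso(3) iso(1) iso(2) conn(1) closed(1) conn(2)
          sq(1) long_exactD(9)[OF S']]; assumption)+
  have "conn S (n + 1) \<in> hom (grpC S (n + 1)) (grpA S n)" for n
    using homs(3)[of "n + 1"] by simp
  then show ?thesis
    using S grp homs ex unfolding long_exact_def closed_seq_def
    by (simp add: group_hom_def group_hom_axioms_def)
qed

text \<open>A cube argument: composed with the isomorphism Y', each square for \<phi> becomes the
  corresponding square for \<psi>, and Y' is injective, so it can be cancelled.\<close>

lemma ladder_morphism_transport:
  assumes S: "long_exact S" "long_exact S'" and H: "ladder_morphism H H' \<psi>"
    and Y: "ladder_iso S H Y" "ladder_iso S' H' Y'"
    and \<phi>: "closed_ladder S S' \<phi>" "ladder_square S \<phi> Y' Y \<psi>"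
  shows "ladder_morphism S S' \<phi>"
proof -
  have grp: "group (grpA S n)" "group (grpB S n)" "group (grpC S n)"
    "group (grpA S' n)" "group (grpB S' n)" "group (grpC S' n)" for n
    using long_exactD(1-3)[OF S(1)] long_exactD(1-3)[OF S(2)] by (auto simp: comm_group_def)
  have closed: "\<And>n x. x \<in> carrier (grpA S n) \<Longrightarrow> onA \<phi> n x \<in> carrier (grpA S' n)"
    "\<And>n x. x \<in> carrier (grpB S n) \<Longrightarrow> onB \<phi> n x \<in> carrier (grpB S' n)"
    "\<And>n x. x \<in> carrier (grpC S n) \<Longrightarrow> onC \<phi> n x \<in> carrier (grpC S' n)"
    using \<phi>(1) by (auto simp: closed_ladder_def)
  have sq: "\<And>n x. x \<in> carrier (grpA S n) \<Longrightarrow> onA Y' n (onA \<phi> n x) = onA \<psi> n (onA Y n x)"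
    "\<And>n x. x \<in> carrier (grpB S n) \<Longrightarrow> onB Y' n (onB \<phi> n x) = onB \<psi> n (onB Y n x)"
    "\<And>n x. x \<in> carrier (grpC S n) \<Longrightarrow> onC Y' n (onC \<phi> n x) = onC \<psi> n (onC Y n x)"
    using \<phi>(2) by (auto simp: ladder_square_def)
  have iso: "onA Y n \<in> iso (grpA S n) (grpA H n)" "onB Y n \<in> iso (grpB S n) (grpB H n)"
    "onC Y n \<in> iso (grpC S n) (grpC H n)" for n
    using Y(1) by (auto simp: ladder_iso_def)
  have iso': "onA Y' n \<in> iso (grpA S' n) (grpA H' n)" "onB Y' n \<in> iso (grpB S' n) (grpB H' n)"
    "onC Y' n \<in> iso (grpC S' n) (grpC H' n)" for n
    using Y(2) by (auto simp: ladder_iso_def)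
  have \<psi>: "onA \<psi> n \<in> hom (grpA H n) (grpA H' n)" "onB \<psi> n \<in> hom (grpB H n) (grpB H' n)"
    "onC \<psi> n \<in> hom (grpC H n) (grpC H' n)" for n
    using H by (auto simp: ladder_morphism_def)
  note cS = long_exact_closed_seq[OF S(1), unfolded closed_seq_def, rule_format]
    and cS' = long_exact_closed_seq[OF S(2), unfolded closed_seq_def, rule_format]
  have homs: "onA \<phi> n \<in> hom (grpA S n) (grpA S' n)" "onB \<phi> n \<in> hom (grpB S n) (grpB S' n)"
    "onC \<phi> n \<in> hom (grpC S n) (grpC S' n)" for n
    by (rule hom_transport[OF grp(1) grp(4) iso(1) iso'(1) \<psi>(1) closed(1) sq(1)]
        hom_transport[OF grp(2) grp(5) iso(2) iso'(2) \<psi>(2) closed(2) sq(2)]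
        hom_transport[OF grp(3) grp(6) iso(3) iso'(3) \<psi>(3) closed(3) sq(3)]; assumption)+
  have "onB \<phi> n (mapAB S n x) = mapAB S' n (onA \<phi> n x)" if x: "x \<in> carrier (grpA S n)" for n x
  proof (rule iso_inj[OF iso'(2)])
    show "onB Y' n (onB \<phi> n (mapAB S n x)) = onB Y' n (mapAB S' n (onA \<phi> n x))"
      using x cS[of n] closed H Y sq iso_in_carrier[OF iso(1)[of n]]
      by (simp add: ladder_iso_def ladder_morphism_def)
  qed (use x cS[of n] cS'[of n] closed in auto)
  moreover have "onC \<phi> n (mapBC S n x) = mapBC S' n (onB \<phi> n x)" if x: "x \<in> carrier (grpB S n)" for n x
  proof (rule iso_inj[OF iso'(3)])
    show "onC Y' n (onC \<phi> n (mapBC S n x)) = onC Y' n (mapBC S' n (onB \<phi> n x))"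
      using x cS[of n] closed H Y sq iso_in_carrier[OF iso(2)[of n]]
      by (simp add: ladder_iso_def ladder_morphism_def)
  qed (use x cS[of n] cS'[of n] closed in auto)
  moreover have "onA \<phi> (n - 1) (conn S n x) = conn S' n (onC \<phi> n x)"
    if x: "x \<in> carrier (grpC S n)" for n x
  proof (rule iso_inj[OF iso'(1)])
    show "onA Y' (n - 1) (onA \<phi> (n - 1) (conn S n x)) = onA Y' (n - 1) (conn S' n (onC \<phi> n x))"
      using x cS[of n] closed H Y sq iso_in_carrier[OF iso(3)[of n]]
      by (simp add: ladder_iso_def ladder_morphism_def)
  qed (use x cS[of n] cS'[of n] closed in auto)
  ultimately show ?thesis
    using homs by (simp add: ladder_morphism_def)
qed

section \<open>The Yoneda ladder\<close>

context right_exact_fun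
begin

text \<open>From here on every transformation is represented by a cycle.\<close>

lemma carrier_Nat_group:
  assumes "chain_complex \<A> U"
  shows "carrier (Nat_group \<A> (HHom \<A> U n) T) = eval_nat \<A> T U n ` cycles (app_cplx T U) n"
proof (intro equalityI subsetI)
  fix \<tau> assume "\<tau> \<in> carrier (Nat_group \<A> (HHom \<A> U n) T)"
  then show "\<tau> \<in> eval_nat \<A> T U n ` cycles (app_cplx T U) n"
    using nat_trans_eq_eval[OF assms, of \<tau> n] by (auto simp: Nat_group_def)
qed (use eval_nat_in_nat_trans[OF assms] in \<open>auto simp: Nat_group_def\<close>)

text \<open>On \<open>eval_nat\<close> of z the map returns the class of z. This gives surjectivity
  at once, and injectivity because the transformation depends on the class only. The group axioms
  and the isomorphism appear together since both rest on this bijection.\<close>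

lemma Yoneda_iso:
  assumes "cokernel_choice \<A> \<kappa>" "chain_complex \<A> U"
  shows "comm_group (Nat_group \<A> (HHom \<A> U n) T)"
    and "Yoneda \<A> \<kappa> T U n \<in> iso (Nat_group \<A> (HHom \<A> U n) T) (homology (app_cplx T U) n)"
proof -
  interpret TU: group_complex "app_cplx T U"
    using assms(2) by (rule group_complex_app)
  let ?N = "Nat_group \<A> (HHom \<A> U n) T" and ?Y = "Yoneda \<A> \<kappa> T U n"
  note carr = carrier_Nat_group[OF assms(2)] and Y = Yoneda_eval_nat[OF assms]
    and cyc_mult = subgroup.m_closed[OF TU.subgroup_cycles, unfolded cobj_app]
    and cyc_one = subgroup.one_closed[OF TU.subgroup_cycles, unfolded cobj_app]
  have bij: "bij_betw ?Y (carrier ?N) (carrier (homology (app_cplx T U) n))"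
  proof (rule bij_betw_imageI)
    show "inj_on ?Y (carrier ?N)"
    proof (rule inj_onI)
      fix \<sigma> \<tau> assume "\<sigma> \<in> carrier ?N" "\<tau> \<in> carrier ?N" and eq: "?Y \<sigma> = ?Y \<tau>"
      then obtain z z' where z: "z \<in> cycles (app_cplx T U) n" "z' \<in> cycles (app_cplx T U) n"
          "\<sigma> = eval_nat \<A> T U n z" "\<tau> = eval_nat \<A> T U n z'"
        by (auto simp: carr)
      show "\<sigma> = \<tau>"
        using eq unfolding z(3,4) Y[OF z(1)] Y[OF z(2)] by (rule eval_nat_cong[OF assms(2) z(1,2)])
    qed
    show "?Y ` carrier ?N = carrier (homology (app_cplx T U) n)"
      unfolding carr TU.carrier_homology image_image by (rule image_cong) (auto simp: Y)
  qed
  have closed: "x \<otimes>\<^bsub>?N\<^esub> y \<in> carrier ?N" if "x \<in> carrier ?N" "y \<in> carrier ?N" for x y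
    using that by (auto simp: carr eval_nat_mult[OF assms(2)] cyc_mult)
  have mult: "?Y (x \<otimes>\<^bsub>?N\<^esub> y) = ?Y x \<otimes>\<^bsub>homology (app_cplx T U) n\<^esub> ?Y y"
    if "x \<in> carrier ?N" "y \<in> carrier ?N" for x y
  proof -
    obtain z z' where "z \<in> cycles (app_cplx T U) n" "z' \<in> cycles (app_cplx T U) n"
      "x = eval_nat \<A> T U n z" "y = eval_nat \<A> T U n z'"
      using \<open>x \<in> carrier ?N\<close> \<open>y \<in> carrier ?N\<close> by (auto simp: carr)
    moreover from this have "z \<in> carrier (FObj T (cobj U n))" "z' \<in> carrier (FObj T (cobj U n))"
      by (auto simp: app_cycle_iff)
    ultimately show ?thesis
      using TU.hclass_mult[of z n z'] by (simp add: eval_nat_mult[OF assms(2)] cyc_mult Y)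
  qed
  have one: "\<one>\<^bsub>?N\<^esub> \<in> carrier ?N" "?Y \<one>\<^bsub>?N\<^esub> = \<one>\<^bsub>homology (app_cplx T U) n\<^esub>"
    unfolding eval_nat_one[OF assms(2)] carr Y[OF cyc_one] TU.one_homology cobj_app
    by (rule imageI[OF cyc_one]) (rule refl)
  show "comm_group ?N"
    by (rule comm_group_transport[where \<phi> = ?Y and H = "homology (app_cplx T U) n"])
      (fact TU.comm_group_homology bij closed mult one)+
  show "?Y \<in> iso ?N (homology (app_cplx T U) n)"
    using bij mult bij_betwE[OF bij] by (simp add: iso_def hom_def Pi_iff)
qed

text \<open>Stated for an arbitrary chain map, so that it serves for \<alpha> and \<beta> in the
  ladder as well as for the components a, b, c of a morphism of sequences.\<close>

lemma HHom_map_square: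
  assumes "cokernel_choice \<A> \<kappa>" "chain_complex \<A> U" "chain_complex \<A> V" "chain_map \<A> U V u"
    and "\<tau> \<in> carrier (Nat_group \<A> (HHom \<A> U n) T)"
  shows "nat_comp \<A> (HHom \<A> V n) \<tau> (HHom_map \<A> U u n) \<in> carrier (Nat_group \<A> (HHom \<A> V n) T)"
    and "Yoneda \<A> \<kappa> T V n (nat_comp \<A> (HHom \<A> V n) \<tau> (HHom_map \<A> U u n))
      = homology_map (app_cplx T V) (\<lambda>n. FMap T (u n)) n (Yoneda \<A> \<kappa> T U n \<tau>)"
proof -
  interpret u: group_chain_map "app_cplx T U" "app_cplx T V" "\<lambda>n. FMap T (u n)"
    using assms(2-4) by (rule group_chain_map_app)
  obtain z where z: "z \<in> cycles (app_cplx T U) n" "\<tau> = eval_nat \<A> T U n z"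
    using assms(5) by (auto simp: carrier_Nat_group[OF assms(2)])
  note eq = nat_comp_eval_HHom_map[OF assms(2-4) z(1)]
  show "nat_comp \<A> (HHom \<A> V n) \<tau> (HHom_map \<A> U u n) \<in> carrier (Nat_group \<A> (HHom \<A> V n) T)"
    using u.map_cycle[OF z(1)] by (simp add: z eq carrier_Nat_group[OF assms(3)])
  show "Yoneda \<A> \<kappa> T V n (nat_comp \<A> (HHom \<A> V n) \<tau> (HHom_map \<A> U u n))
      = homology_map (app_cplx T V) (\<lambda>n. FMap T (u n)) n (Yoneda \<A> \<kappa> T U n \<tau>)"
    using u.map_cycle[OF z(1)] z(1) u.homology_map_hclass[of z n]
    by (simp add: z eq Yoneda_eval_nat[OF assms(1)] assms(2,3) app_cycle_iff)
qed

text \<open>One snake pair (y, x) over z computes both sides: the composite is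
  \<open>eval_nat\<close> of x, and the connecting map sends [z] to [x].\<close>

lemma delta_square:
  assumes "cokernel_choice \<A> \<kappa>" "termwise_split_ses \<A> A \<alpha> B \<beta> C"
    and "\<tau> \<in> carrier (Nat_group \<A> (HHom \<A> C n) T)"
  shows "nat_comp \<A> (HHom \<A> A (n - 1)) \<tau> (delta \<A> \<alpha> B \<beta> C n)
      \<in> carrier (Nat_group \<A> (HHom \<A> A (n - 1)) T)"
    and "Yoneda \<A> \<kappa> T A (n - 1) (nat_comp \<A> (HHom \<A> A (n - 1)) \<tau> (delta \<A> \<alpha> B \<beta> C n))
      = homology_connecting (app_cplx T A) (\<lambda>n. FMap T (\<alpha> n)) (app_cplx T B) (\<lambda>n. FMap T (\<beta> n)) n
          (Yoneda \<A> \<kappa> T C n \<tau>)"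
proof -
  have c: "chain_complex \<A> A" "chain_complex \<A> C"
    using assms(2) by (auto simp: termwise_split_ses_def)
  interpret S: complex_ses "app_cplx T A" "app_cplx T B" "app_cplx T C"
      "\<lambda>n. FMap T (\<alpha> n)" "\<lambda>n. FMap T (\<beta> n)"
    using assms(2) by (rule complex_ses_app)
  obtain z where z: "z \<in> cycles (app_cplx T C) n" "\<tau> = eval_nat \<A> T C n z"
    using assms(3) by (auto simp: carrier_Nat_group[OF c(2)])
  obtain y x where yx: "y \<in> carrier (cobj (app_cplx T B) n)" "x \<in> carrier (cobj (app_cplx T A) (n - 1))"
      "FMap T (\<alpha> (n - 1)) x = cdiff (app_cplx T B) n y" "FMap T (\<beta> n) y = z"
    using S.snake_exists[OF z(1)] .
  have eq: "nat_comp \<A> (HHom \<A> A (n - 1)) (eval_nat \<A> T C n z) (delta \<A> \<alpha> B \<beta> C n)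
      = eval_nat \<A> T A (n - 1) x"
    using nat_comp_eval_delta[OF assms(2), of y n x] yx by simp
  have x: "x \<in> cycles (app_cplx T A) (n - 1)"
    using S.snake(2)[OF yx(1-3)] .
  show "nat_comp \<A> (HHom \<A> A (n - 1)) \<tau> (delta \<A> \<alpha> B \<beta> C n)
      \<in> carrier (Nat_group \<A> (HHom \<A> A (n - 1)) T)"
    using x by (simp add: z(2) eq carrier_Nat_group[OF c(1)])
  show "Yoneda \<A> \<kappa> T A (n - 1) (nat_comp \<A> (HHom \<A> A (n - 1)) \<tau> (delta \<A> \<alpha> B \<beta> C n))
      = homology_connecting (app_cplx T A) (\<lambda>n. FMap T (\<alpha> n)) (app_cplx T B) (\<lambda>n. FMap T (\<beta> n)) n
          (Yoneda \<A> \<kappa> T C n \<tau>)"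
    unfolding z(2) eq Yoneda_eval_nat[OF assms(1) c(1) x] Yoneda_eval_nat[OF assms(1) c(2) z(1)]
    using S.connecting_hclass[OF yx(1-3)] yx(4) by simp
qed

lemma H_seq_eq: "H_seq T A \<alpha> B \<beta> C = homology_seq (app_cplx T A) (\<lambda>n. FMap T (\<alpha> n))
    (app_cplx T B) (\<lambda>n. FMap T (\<beta> n)) (app_cplx T C)"
  by (simp add: H_seq_def homology_seq_def)

lemma long_exact_H_seq:
  assumes "termwise_split_ses \<A> A \<alpha> B \<beta> C"
  shows "long_exact (H_seq T A \<alpha> B \<beta> C)"
  unfolding H_seq_eq using complex_ses_app[OF assms] by (rule complex_ses.long_exact_homology_seq)

lemma Yoneda_ladder_iso:
  assumes "cokernel_choice \<A> \<kappa>" "termwise_split_ses \<A> A \<alpha> B \<beta> C"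
  shows "ladder_iso (Nat_seq \<A> T A \<alpha> B \<beta> C) (H_seq T A \<alpha> B \<beta> C) (Yoneda_ladder \<A> \<kappa> T A B C)"
    and "long_exact (Nat_seq \<A> T A \<alpha> B \<beta> C)"
proof -
  have c: "chain_complex \<A> A" "chain_complex \<A> B" "chain_complex \<A> C"
    "chain_map \<A> A B \<alpha>" "chain_map \<A> B C \<beta>"
    using assms(2) by (auto simp: termwise_split_ses_def)
  have hom: "Yoneda \<A> \<kappa> T U n \<in> hom (Nat_group \<A> (HHom \<A> U n) T) (homology (app_cplx T U) n)"
    if "chain_complex \<A> U" for U n
    using Yoneda_iso(2)[OF assms(1) that] by (simp add: iso_def)
  show iso: "ladder_iso (Nat_seq \<A> T A \<alpha> B \<beta> C) (H_seq T A \<alpha> B \<beta> C) (Yoneda_ladder \<A> \<kappa> T A B C)"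
    unfolding ladder_iso_def ladder_morphism_def
    by (simp add: Nat_seq_def H_seq_def Yoneda_ladder_def hom Yoneda_iso(2)[OF assms(1)] c
        HHom_map_square(2)[OF assms(1) c(1,2,4)] HHom_map_square(2)[OF assms(1) c(2,3,5)]
        delta_square(2)[OF assms])
  have "closed_seq (Nat_seq \<A> T A \<alpha> B \<beta> C)"
    unfolding closed_seq_def
    by (simp add: Nat_seq_def Yoneda_iso(1)[OF assms(1)] c delta_square(1)[OF assms]
        HHom_map_square(1)[OF assms(1) c(1,2,4)] HHom_map_square(1)[OF assms(1) c(2,3,5)])
  then show "long_exact (Nat_seq \<A> T A \<alpha> B \<beta> C)"
    using long_exact_H_seq[OF assms(2)] iso by (rule long_exact_transport)
qed

lemma Yoneda_natural_ses:
  assumes "cokernel_choice \<A> \<kappa>"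
    and S: "termwise_split_ses \<A> A \<alpha> B \<beta> C" and S': "termwise_split_ses \<A> A' \<alpha>' B' \<beta>' C'"
    and m: "ses_morphism \<A> A \<alpha> B \<beta> C A' \<alpha>' B' \<beta>' C' a b c"
  shows "ladder_morphism (Nat_seq \<A> T A \<alpha> B \<beta> C) (Nat_seq \<A> T A' \<alpha>' B' \<beta>' C')
      (Nat_ladder_ses \<A> A B C A' B' C' a b c)" (is ?Nat)
    and "ladder_morphism (H_seq T A \<alpha> B \<beta> C) (H_seq T A' \<alpha>' B' \<beta>' C')
      (H_ladder_ses T A' B' C' a b c)" (is ?H)
    and "ladder_square (Nat_seq \<A> T A \<alpha> B \<beta> C)
      (Nat_ladder_ses \<A> A B C A' B' C' a b c) (Yoneda_ladder \<A> \<kappa> T A' B' C')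
      (Yoneda_ladder \<A> \<kappa> T A B C) (H_ladder_ses T A' B' C' a b c)" (is ?sq)
proof -
  have c: "chain_complex \<A> A" "chain_complex \<A> B" "chain_complex \<A> C"
    "chain_map \<A> A B \<alpha>" "chain_map \<A> B C \<beta>"
    and c': "chain_complex \<A> A'" "chain_complex \<A> B'" "chain_complex \<A> C'"
    "chain_map \<A> A' B' \<alpha>'" "chain_map \<A> B' C' \<beta>'"
    using S S' by (auto simp: termwise_split_ses_def)
  have abc: "chain_map \<A> A A' a" "chain_map \<A> B B' b" "chain_map \<A> C C' c"
    and sq: "b n \<cdot> \<alpha> n = \<alpha>' n \<cdot> a n" "c n \<cdot> \<beta> n = \<beta>' n \<cdot> b n" for n
    using m by (auto simp: ses_morphism_def)
  note homs = chain_mapD(1)[OF c(4)] chain_mapD(1)[OF c(5)] chain_mapD(1)[OF c'(4)]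
    chain_mapD(1)[OF c'(5)] chain_mapD(1)[OF abc(1)] chain_mapD(1)[OF abc(2)] chain_mapD(1)[OF abc(3)]
  show H: ?H
    unfolding H_seq_eq H_ladder_ses_def
  proof (rule ladder_morphism_homology_seq)
    show "FMap T (b n) (FMap T (\<alpha> n) x) = FMap T (\<alpha>' n) (FMap T (a n) x)"
      if "x \<in> carrier (cobj (app_cplx T A) n)" for n x
      using that FMap_Comp[OF homs(1,6)] FMap_Comp[OF homs(5,3)] sq(1) by (metis cobj_app)
    show "FMap T (c n) (FMap T (\<beta> n) y) = FMap T (\<beta>' n) (FMap T (b n) y)"
      if "y \<in> carrier (cobj (app_cplx T B) n)" for n y
      using that FMap_Comp[OF homs(2,7)] FMap_Comp[OF homs(6,4)] sq(2) by (metis cobj_app)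
  qed (use S S' c c' abc in \<open>auto intro: complex_ses_app group_chain_map_app\<close>)
  note HHom_squares = HHom_map_square[OF assms(1) c(1) c'(1) abc(1)]
    HHom_map_square[OF assms(1) c(2) c'(2) abc(2)] HHom_map_square[OF assms(1) c(3) c'(3) abc(3)]
  show sq: ?sq
    unfolding ladder_square_def
    by (simp add: Nat_seq_def Nat_ladder_ses_def H_ladder_ses_def Yoneda_ladder_def HHom_squares)
  show ?Nat
  \<comment> \<open>Compatibility with \<open>delta\<close> is contained here: it is read off from
    that of the connecting maps in homology through the Yoneda isomorphisms.\<close>
  proof (rule ladder_morphism_transport[OF _ _ H _ _ _ sq])
    show "closed_ladder (Nat_seq \<A> T A \<alpha> B \<beta> C) (Nat_seq \<A> T A' \<alpha>' B' \<beta>' C')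
        (Nat_ladder_ses \<A> A B C A' B' C' a b c)"
      unfolding closed_ladder_def by (simp add: Nat_seq_def Nat_ladder_ses_def HHom_squares)
  qed (intro Yoneda_ladder_iso[OF assms(1)] S S')+
qed

end

text \<open>Both sides are the class of the cycle \<open>\<theta> (cobj U n) z\<close>, where z
  represents the given transformation.\<close>

lemma nat_trans_square:
  assumes "right_exact_fun \<A> T" "right_exact_fun \<A> T'" "\<theta> \<in> nat_trans \<A> T T'"
    and "cokernel_choice \<A> \<kappa>" "chain_complex \<A> U" "\<tau> \<in> carrier (Nat_group \<A> (HHom \<A> U n) T)"
  shows "nat_comp \<A> (HHom \<A> U n) \<theta> \<tau> \<in> carrier (Nat_group \<A> (HHom \<A> U n) T')"
    and "Yoneda \<A> \<kappa> T' U n (nat_comp \<A> (HHom \<A> U n) \<theta> \<tau>)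
      = homology_map (app_cplx T' U) (\<lambda>n. \<theta> (cobj U n)) n (Yoneda \<A> \<kappa> T U n \<tau>)"
proof -
  interpret T: right_exact_fun \<A> T by fact
  interpret T': right_exact_fun \<A> T' by fact
  note add = T.additive_fun_axioms T'.additive_fun_axioms
  interpret \<theta>: group_chain_map "app_cplx T U" "app_cplx T' U" "\<lambda>n. \<theta> (cobj U n)"
    using add assms(3,5) by (rule group_chain_map_nat_trans)
  obtain z where z: "z \<in> cycles (app_cplx T U) n" "\<tau> = eval_nat \<A> T U n z"
    using assms(6) by (auto simp: T.carrier_Nat_group[OF assms(5)])
  note eq = nat_comp_eval_nat[OF add assms(3,5) z(1)]
  show "nat_comp \<A> (HHom \<A> U n) \<theta> \<tau> \<in> carrier (Nat_group \<A> (HHom \<A> U n) T')"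
    using \<theta>.map_cycle[OF z(1)] by (simp add: z eq T'.carrier_Nat_group[OF assms(5)])
  show "Yoneda \<A> \<kappa> T' U n (nat_comp \<A> (HHom \<A> U n) \<theta> \<tau>)
      = homology_map (app_cplx T' U) (\<lambda>n. \<theta> (cobj U n)) n (Yoneda \<A> \<kappa> T U n \<tau>)"
    using \<theta>.map_cycle[OF z(1)] z(1) \<theta>.homology_map_hclass[of z n]
    by (simp add: z eq T.Yoneda_eval_nat[OF assms(4)] T'.Yoneda_eval_nat[OF assms(4)] assms(5)
        T.app_cycle_iff)
qed

lemma Yoneda_natural_functor:
  assumes T: "right_exact_fun \<A> T" and T': "right_exact_fun \<A> T'" and \<theta>: "\<theta> \<in> nat_trans \<A> T T'"
    and \<kappa>: "cokernel_choice \<A> \<kappa>" and S: "termwise_split_ses \<A> A \<alpha> B \<beta> C"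
  shows "ladder_morphism (Nat_seq \<A> T A \<alpha> B \<beta> C) (Nat_seq \<A> T' A \<alpha> B \<beta> C)
      (Nat_ladder_T \<A> \<theta> A B C)" (is ?Nat)
    and "ladder_morphism (H_seq T A \<alpha> B \<beta> C) (H_seq T' A \<alpha> B \<beta> C)
      (H_ladder_T T' \<theta> A B C)" (is ?H)
    and "ladder_square (Nat_seq \<A> T A \<alpha> B \<beta> C)
      (Nat_ladder_T \<A> \<theta> A B C) (Yoneda_ladder \<A> \<kappa> T' A B C)
      (Yoneda_ladder \<A> \<kappa> T A B C) (H_ladder_T T' \<theta> A B C)" (is ?sq)
proof -
  interpret T: right_exact_fun \<A> T by fact
  interpret T': right_exact_fun \<A> T' by fact
  note add = T.additive_fun_axioms T'.additive_fun_axioms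
  have c: "chain_complex \<A> A" "chain_complex \<A> B" "chain_complex \<A> C"
    "chain_map \<A> A B \<alpha>" "chain_map \<A> B C \<beta>"
    using S by (auto simp: termwise_split_ses_def)
  have nat: "\<theta> Y (FMap T f x) = FMap T' f (\<theta> X x)"
    if "f \<in> hom_set \<A> X Y" "x \<in> carrier (FObj T X)" for f X Y x
    using \<theta> that by (auto simp: nat_trans_def hom_set_iff)
  show H: ?H
    unfolding T.H_seq_eq T'.H_seq_eq H_ladder_T_def
  proof (rule ladder_morphism_homology_seq)
    show "\<theta> (cobj B n) (FMap T (\<alpha> n) x) = FMap T' (\<alpha> n) (\<theta> (cobj A n) x)"
      if "x \<in> carrier (cobj (app_cplx T A) n)" for n x
      using that by (intro nat[OF T.chain_mapD(1)[OF c(4)]]) simp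
    show "\<theta> (cobj C n) (FMap T (\<beta> n) x) = FMap T' (\<beta> n) (\<theta> (cobj B n) x)"
      if "x \<in> carrier (cobj (app_cplx T B) n)" for n x
      using that by (intro nat[OF T.chain_mapD(1)[OF c(5)]]) simp
  qed (use S c in \<open>auto intro: T.complex_ses_app T'.complex_ses_app group_chain_map_nat_trans[OF add \<theta>]\<close>)
  note squares = nat_trans_square[OF T T' \<theta> \<kappa> c(1)] nat_trans_square[OF T T' \<theta> \<kappa> c(2)]
    nat_trans_square[OF T T' \<theta> \<kappa> c(3)]
  show sq: ?sq
    unfolding ladder_square_def
    by (simp add: Nat_seq_def Nat_ladder_T_def H_ladder_T_def Yoneda_ladder_def squares)
  show ?Nat
  proof (rule ladder_morphism_transport[OF _ _ H _ _ _ sq])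
    show "closed_ladder (Nat_seq \<A> T A \<alpha> B \<beta> C) (Nat_seq \<A> T' A \<alpha> B \<beta> C) (Nat_ladder_T \<A> \<theta> A B C)"
      unfolding closed_ladder_def by (simp add: Nat_seq_def Nat_ladder_T_def squares)
  qed (intro T.Yoneda_ladder_iso[OF \<kappa> S] T'.Yoneda_ladder_iso[OF \<kappa> S])+
qed

theorem theorem1p3:
  fixes \<A> :: "('o, 'm) precat"
    and \<kappa> :: "'m \<Rightarrow> 'm"
    and T :: "('o, 'm, 'b) ab_fun"
    and A B C :: "('o, 'm) cplx"
    and \<alpha> \<beta> :: "int \<Rightarrow> 'm"
  assumes "abelian_category \<A>"
    and "cokernel_choice \<A> \<kappa>"
    and "right_exact_functor \<A> T"
    and "termwise_split_ses \<A> A \<alpha> B \<beta> C"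
  shows "long_exact (Nat_seq \<A> T A \<alpha> B \<beta> C)
       \<and> long_exact (H_seq T A \<alpha> B \<beta> C)
       \<and> ladder_iso (Nat_seq \<A> T A \<alpha> B \<beta> C) (H_seq T A \<alpha> B \<beta> C) (Yoneda_ladder \<A> \<kappa> T A B C)
       \<and> (\<forall>(T' :: ('o, 'm, 'c) ab_fun) \<theta>.
            right_exact_functor \<A> T' \<and> \<theta> \<in> nat_trans \<A> T T' \<longrightarrow>
              ladder_morphism (Nat_seq \<A> T A \<alpha> B \<beta> C) (Nat_seq \<A> T' A \<alpha> B \<beta> C)
                (Nat_ladder_T \<A> \<theta> A B C)
            \<and> ladder_morphism (H_seq T A \<alpha> B \<beta> C) (H_seq T' A \<alpha> B \<beta> C)
                (H_ladder_T T' \<theta> A B C)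
            \<and> ladder_square (Nat_seq \<A> T A \<alpha> B \<beta> C)
                (Nat_ladder_T \<A> \<theta> A B C) (Yoneda_ladder \<A> \<kappa> T' A B C)
                (Yoneda_ladder \<A> \<kappa> T A B C) (H_ladder_T T' \<theta> A B C))
       \<and> (\<forall>A' \<alpha>' B' \<beta>' C' a b c.
            termwise_split_ses \<A> A' \<alpha>' B' \<beta>' C' \<and>
            ses_morphism \<A> A \<alpha> B \<beta> C A' \<alpha>' B' \<beta>' C' a b c \<longrightarrow>
              ladder_morphism (Nat_seq \<A> T A \<alpha> B \<beta> C) (Nat_seq \<A> T A' \<alpha>' B' \<beta>' C')
                (Nat_ladder_ses \<A> A B C A' B' C' a b c)
            \<and> ladder_morphism (H_seq T A \<alpha> B \<beta> C) (H_seq T A' \<alpha>' B' \<beta>' C')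
                (H_ladder_ses T A' B' C' a b c)
            \<and> ladder_square (Nat_seq \<A> T A \<alpha> B \<beta> C)
                (Nat_ladder_ses \<A> A B C A' B' C' a b c) (Yoneda_ladder \<A> \<kappa> T A' B' C')
                (Yoneda_ladder \<A> \<kappa> T A B C) (H_ladder_ses T A' B' C' a b c))"
proof -
  \<comment> \<open>Stated for functors into groups over the type of T', which may differ from the
    type of T; the latter is covered by the interpretation that follows.\<close>
  have rex: "right_exact_fun \<A> F" if "right_exact_functor \<A> F" for F :: "('o, 'm, 'c) ab_fun"
    using assms(1) that by (simp add: right_exact_fun_def right_exact_fun_axioms_def)
  interpret right_exact_fun \<A> T
    using assms(1,3) by (simp add: right_exact_fun_def right_exact_fun_axioms_def)
  show ?thesis
  proof (intro conjI allI impI; (elim conjE)?)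
    fix T' :: "('o, 'm, 'c) ab_fun" and \<theta>
    assume T': "right_exact_functor \<A> T'" and \<theta>: "\<theta> \<in> nat_trans \<A> T T'"
    note nat = Yoneda_natural_functor[OF right_exact_fun_axioms rex[OF T'] \<theta> assms(2,4)]
    show "ladder_morphism (Nat_seq \<A> T A \<alpha> B \<beta> C) (Nat_seq \<A> T' A \<alpha> B \<beta> C)
        (Nat_ladder_T \<A> \<theta> A B C)"
      and "ladder_morphism (H_seq T A \<alpha> B \<beta> C) (H_seq T' A \<alpha> B \<beta> C) (H_ladder_T T' \<theta> A B C)"
      and "ladder_square (Nat_seq \<A> T A \<alpha> B \<beta> C)
        (Nat_ladder_T \<A> \<theta> A B C) (Yoneda_ladder \<A> \<kappa> T' A B C)
        (Yoneda_ladder \<A> \<kappa> T A B C) (H_ladder_T T' \<theta> A B C)"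
      by (fact nat)+
  qed (fact Yoneda_ladder_iso[OF assms(2,4)] long_exact_H_seq[OF assms(4)]
      Yoneda_natural_ses[OF assms(2,4)])+
qed

end
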